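(* The monoid $\mathsf{fP}$ is finitely generated.
   Context: Let $A=\{0,1\}$. A partial function $f:A^*\to A^*$ is polynomially balanced iff there exist polynomials $p,q$ such that for all $x\in\mathsf{Dom}(f)$: $|f(x)|\le p(|x|)$ and $|x|\le q(|f(x)|)$. $\mathsf{fP}$ is the set of all polynomially balanced partial functions $f:A^*\to A^*$ such that $x\in\mathsf{Dom}(f)\mapsto f(x)$ is computable by a deterministic polynomial-time Turing machine (a machine computing $f$ also serves as an acceptor of $\mathsf{Dom}(f)$, so $\mathsf{Dom}(f)\in\mathsf{P}$). $\mathsf{fP}$ is a monoid under composition of partial functions. *)

theory Defs
  imports "HOL-Algebra.Group" "HOL-Computational_Algebra.Polynomial"
begin

section \<open>Deterministic Turing machines\<close>

text \<open>
  Single-tape machines with a two-way infinite tape and an arbitrary finite tape alphabet.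
  States are the numbers below \<open>num_states\<close>, with \<open>0\<close> initial, \<open>1\<close> accepting and \<open>2\<close> rejecting;
  tape symbols are the numbers below \<open>num_symbols\<close>, where \<open>0\<close> is the blank and \<open>1\<close>, \<open>2\<close> are the
  letters 0, 1 of the words, represented by \<open>False\<close>, \<open>True\<close>.
\<close>

datatype direction = Leftward | Stationary | Rightward

fun offset :: "direction \<Rightarrow> int" where
  "offset Leftward = -1"
| "offset Stationary = 0"
| "offset Rightward = 1"

record tm =
  num_states :: nat
  num_symbols :: nat
  trans :: "nat \<Rightarrow> nat \<Rightarrow> nat \<times> nat \<times> direction"

definition turing_machine :: "tm \<Rightarrow> bool" where
  "turing_machine M \<longleftrightarrow>
     num_states M \<ge> 3 \<and> num_symbols M \<ge> 3 \<and>
     (\<forall>q < num_states M. \<forall>s < num_symbols M. \<forall>q' s' d.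
        trans M q s = (q', s', d) \<longrightarrow> q' < num_states M \<and> s' < num_symbols M)"

abbreviation (input) start_state :: nat where "start_state \<equiv> 0"
abbreviation (input) accept_state :: nat where "accept_state \<equiv> 1"
abbreviation (input) reject_state :: nat where "reject_state \<equiv> 2"

text \<open>A configuration consists of the state, the tape contents and the head position.\<close>

type_synonym config = "nat \<times> (int \<Rightarrow> nat) \<times> int"

definition halted :: "config \<Rightarrow> bool" where
  "halted c \<longleftrightarrow> fst c \<in> {accept_state, reject_state}"

fun step :: "tm \<Rightarrow> config \<Rightarrow> config" where
  "step M (q, tape, h) =
     (if halted (q, tape, h) then (q, tape, h)
      else let (q', s', d) = trans M q (tape h) in (q', tape(h := s'), h + offset d))"

text \<open>The tape that is blank except for the word \<open>w\<close>, whose first letter is in cell \<open>0\<close>.\<close>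

definition word_tape :: "bool list \<Rightarrow> int \<Rightarrow> nat" where
  "word_tape w i =
     (if 0 \<le> i \<and> i < int (length w) then (if w ! nat i then 2 else 1) else 0)"

definition initial_config :: "bool list \<Rightarrow> config" where
  "initial_config x = (start_state, word_tape x, 0)"

definition config_after :: "tm \<Rightarrow> bool list \<Rightarrow> nat \<Rightarrow> config" where
  "config_after M x t = (step M ^^ t) (initial_config x)"

text \<open>
  Output convention: at acceptance the tape contains the output word and is blank elsewhere,
  and the head is on the first letter of the output, wherever on the tape this is.
\<close>

definition accepts_with_output :: "config \<Rightarrow> bool list \<Rightarrow> bool" where
  "accepts_with_output c y \<longleftrightarrow>
     (case c of (q, tape, h) \<Rightarrow> q = accept_state \<and> (\<forall>i. tape (h + i) = word_tape y i))"

definition rejects :: "config \<Rightarrow> bool" where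
  "rejects c \<longleftrightarrow> fst c = reject_state"

definition computes :: "tm \<Rightarrow> (bool list \<rightharpoonup> bool list) \<Rightarrow> bool" where
  "computes M f \<longleftrightarrow>
     (\<forall>x. case f x of
            Some y \<Rightarrow> (\<exists>t. accepts_with_output (config_after M x t) y)
          | None \<Rightarrow> (\<exists>t. rejects (config_after M x t)))"

text \<open>
  Throughout, polynomials have natural number coefficients.  The time bound applies to all
  inputs, including those that are rejected.
\<close>

definition polynomial_time :: "tm \<Rightarrow> bool" where
  "polynomial_time M \<longleftrightarrow>
     (\<exists>p :: nat poly. \<forall>x. halted (config_after M x (poly p (length x))))"


section \<open>The monoid fP\<close>

definition polynomially_balanced :: "(bool list \<rightharpoonup> bool list) \<Rightarrow> bool" where
  "polynomially_balanced f \<longleftrightarrow>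
     (\<exists>p q :: nat poly. \<forall>x y. f x = Some y \<longrightarrow>
        length y \<le> poly p (length x) \<and> length x \<le> poly q (length y))"

definition fP :: "(bool list \<rightharpoonup> bool list) set" where
  "fP = {f. polynomially_balanced f \<and>
            (\<exists>M. turing_machine M \<and> polynomial_time M \<and> computes M f)}"

definition fP_monoid :: "(bool list \<rightharpoonup> bool list) monoid" where
  "fP_monoid = \<lparr>carrier = fP, monoid.mult = (\<circ>\<^sub>m), one = Some\<rparr>"

definition finitely_generated_monoid :: "('a, 'b) monoid_scheme \<Rightarrow> bool" where
  "finitely_generated_monoid G \<longleftrightarrow>
     monoid G \<and>
     (\<exists>S. finite S \<and> S \<subseteq> carrier G \<and> \<Inter>{H. submonoid H G \<and> S \<subseteq> H} = carrier G)"

end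

theory Submission imports Defs begin

text \<open>
  A finite set can generate \<open>fP\<close> because one of its members can be a universal machine that
  finds the program to be executed in its input; prepending a program letter by letter takes only
  finitely many generators.  What prevents the universal machine from doing everything alone is
  that a single element of \<open>fP\<close> has a fixed polynomial time bound and a fixed polynomial balance,
  whereas the elements to be generated have bounds of arbitrary degree.  Both are overcome by
  padding.  A function \<open>f\<close> with machine \<open>M\<close> is factorized as (\<open>factorization\<close>)

  \<^item> code the input \<open>x\<close> as a word with one letter of padding on either side;

  \<^item> iterate a generator that at least squares the amount of padding (\<open>expand\<close>) until the padding
    exceeds the running time of \<open>M\<close>;

  \<^item> turn the letters into memory cells of the universal machine, and enlarge the cells to the
    size that \<open>M\<close> requires;

  \<^item> prepend the program, run the universal machine for as many rounds as there is padding (this is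
    linear in its own input), and remove the program letter by letter;

  \<^item> read the output \<open>y\<close> off the cells, where everything else becomes padding again;

  \<^item> iterate a generator that divides the amount of padding by more than the length of \<open>y\<close>
    (\<open>ex_contract\<close>) until no padding is left.  Since \<open>f\<close> is balanced, the padding is polynomial
    in the length of \<open>y\<close>, hence a number of iterations that depends only on \<open>f\<close> suffices.

  The universal machine (\<open>ex_simulator\<close>) executes straight-line programs, repeatedly and on all cells
  in parallel: every cell has the same number of one-bit registers and an accumulator, and there are
  only instructions for conjunction, disjunction, clearing and selecting a register.  This is
  enough, because the configurations of a Turing machine evolve like those of a cellular automaton
  (\<open>local_rule_step\<close>), and if the state of a cell is kept in one-hot form, then a step of a cellular
  automaton is a finite disjunction of conjunctions over triples of neighbouring cells
  (\<open>fold_automaton_step\<close>).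

  All generators are iterated sequential transducers: they rewrite a word letter by letter from left
  to right, as often as needed.  Such a process is carried out by a Turing machine that keeps the
  word as a queue on its tape (\<open>transducer_machine\<close>), and no other Turing machines have to be
  programmed.  Together with the sequential composition of machines (\<open>seq_tm\<close>) this provides all
  memberships in \<open>fP\<close>.
\<close>


section \<open>Polynomial bounds\<close>

text \<open>
  The powers of \<open>n + 2\<close> dominate all polynomials with natural coefficients and are closed under sums,
  products and substitution up to a change of the exponent, so that exponents can stand for polynomials.
\<close>

definition poly_bounded :: "(nat \<Rightarrow> nat) \<Rightarrow> bool" where
  "poly_bounded g \<longleftrightarrow> (\<exists>k. \<forall>n. g n \<le> (n + 2) ^ k)"

lemma poly_boundedI: "(\<And>n. g n \<le> (n + 2) ^ k) \<Longrightarrow> poly_bounded g"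
  unfolding poly_bounded_def by blast

lemma poly_bounded_const: "poly_bounded (\<lambda>_. c)"
proof (rule poly_boundedI)
  fix n :: nat
  have "c \<le> 2 ^ c" by (rule less_imp_le, rule less_exp)
  also have "\<dots> \<le> (n + 2) ^ c" by (rule power_mono) auto
  finally show "c \<le> (n + 2) ^ c" .
qed

lemma poly_bounded_id: "poly_bounded (\<lambda>n. n)"
  by (rule poly_boundedI[of _ 1]) simp

lemma poly_bounded_mult:
  assumes "poly_bounded f" "poly_bounded g"
  shows "poly_bounded (\<lambda>n. f n * g n)"
proof -
  obtain k l where "\<And>n. f n \<le> (n + 2) ^ k" "\<And>n. g n \<le> (n + 2) ^ l"
    using assms unfolding poly_bounded_def by blast
  then have "f n * g n \<le> (n + 2) ^ (k + l)" for n
    unfolding power_add by (intro mult_le_mono)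
  then show ?thesis by (rule poly_boundedI)
qed

lemma poly_bounded_add:
  assumes "poly_bounded f" "poly_bounded g"
  shows "poly_bounded (\<lambda>n. f n + g n)"
proof -
  obtain k l where *: "\<And>n. f n \<le> (n + 2) ^ k" "\<And>n. g n \<le> (n + 2) ^ l"
    using assms unfolding poly_bounded_def by blast
  have "f n + g n \<le> (n + 2) ^ (k + l + 1)" for n
  proof -
    have "f n \<le> (n + 2) ^ (k + l)" "g n \<le> (n + 2) ^ (k + l)"
      by (rule order_trans[OF *(1)], rule power_increasing, simp, simp)
        (rule order_trans[OF *(2)], rule power_increasing, simp, simp)
    then have "f n + g n \<le> 2 * (n + 2) ^ (k + l)" by simp
    also have "\<dots> \<le> (n + 2) * (n + 2) ^ (k + l)" by (rule mult_le_mono1) simp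
    finally show ?thesis by simp
  qed
  then show ?thesis by (rule poly_boundedI)
qed

lemma power_poly_le: "((n + 2) ^ l + 2) ^ k \<le> (n + 2 :: nat) ^ ((l + 2) * k)"
proof -
  have "(n + 2) ^ l + 2 \<le> (n + 2) ^ l * 2 + 2 * 1" by simp
  also have "\<dots> \<le> (n + 2) ^ l * 2 + 2 * (n + 2) ^ l" by (intro add_left_mono mult_left_mono) auto
  also have "\<dots> = (n + 2) ^ l * (2 * 2)" by simp
  also have "\<dots> \<le> (n + 2) ^ l * ((n + 2) * (n + 2))"
    by (intro mult_le_mono) auto
  also have "\<dots> = (n + 2) ^ (l + 2)" by (simp only: power_add power2_eq_square)
  finally have "(n + 2) ^ l + 2 \<le> (n + 2) ^ (l + 2)" .
  then have "((n + 2) ^ l + 2) ^ k \<le> ((n + 2) ^ (l + 2)) ^ k" by (rule power_mono) simp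
  then show ?thesis by (simp only: power_mult)
qed

text \<open>
  The bound of \<open>f m\<close> is required for all arguments below \<open>g n\<close>, because \<open>f\<close> need not be monotone.
\<close>

lemma poly_bounded_comp:
  assumes "poly_bounded f" "poly_bounded g"
  shows "\<exists>h. poly_bounded h \<and> (\<forall>n m. m \<le> g n \<longrightarrow> f m \<le> h n)"
proof -
  obtain k l where *: "\<And>n. f n \<le> (n + 2) ^ k" "\<And>n. g n \<le> (n + 2) ^ l"
    using assms unfolding poly_bounded_def by blast
  have "f m \<le> (n + 2) ^ ((l + 2) * k)" if "m \<le> g n" for m n
  proof -
    have "f m \<le> (m + 2) ^ k" by (rule *)
    also have "\<dots> \<le> ((n + 2) ^ l + 2) ^ k"
      using that *(2)[of n] by (intro power_mono) auto
    also have "\<dots> \<le> (n + 2) ^ ((l + 2) * k)" by (rule power_poly_le)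
    finally show ?thesis .
  qed
  moreover have "poly_bounded (\<lambda>n. (n + 2) ^ ((l + 2) * k))" by (rule poly_boundedI) (rule order_refl)
  ultimately show ?thesis by blast
qed

lemma poly_bounded_poly: "poly_bounded (poly p)"
proof (induction p)
  case 0
  show ?case using poly_bounded_const[of 0] by (simp add: fun_eq_iff)
next
  case (pCons a p)
  have "poly (pCons a p) = (\<lambda>n. a + n * poly p n)" by auto
  then show ?case
    using poly_bounded_add[OF poly_bounded_const poly_bounded_mult[OF poly_bounded_id pCons.IH]]
    by simp
qed

section \<open>Runs of Turing machines\<close>

definition ntape :: "nat list \<Rightarrow> int \<Rightarrow> nat" where
  "ntape u i = (if 0 \<le> i \<and> i < int (length u) then u ! nat i else 0)"

definition bit_code :: "bool \<Rightarrow> nat" where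
  "bit_code b = (if b then 2 else 1)"

lemma word_tape_eq: "word_tape w = ntape (map bit_code w)"
  by (auto simp: fun_eq_iff word_tape_def ntape_def bit_code_def)

text \<open>
  The result \<open>None\<close> stands for rejection.  Inputs and outputs are words over the tape symbols rather
  than over the bits, since the intermediate results of composed machines use larger alphabets.
\<close>

definition delivers :: "tm \<Rightarrow> nat list \<Rightarrow> nat \<Rightarrow> nat list option \<Rightarrow> bool" where
  "delivers M u t r \<longleftrightarrow>
     (case (step M ^^ t) (start_state, ntape u, 0) of (q, tp, h) \<Rightarrow>
        (case r of Some v \<Rightarrow> q = accept_state \<and> (\<forall>i. tp (h + i) = ntape v i)
                 | None \<Rightarrow> q = reject_state))"

lemma turing_machineI:
  assumes "num_states M \<ge> 3" "num_symbols M \<ge> 3"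
    and "\<And>q s q' s' d. q < num_states M \<Longrightarrow> s < num_symbols M \<Longrightarrow> trans M q s = (q', s', d)
      \<Longrightarrow> q' < num_states M \<and> s' < num_symbols M"
  shows "turing_machine M"
  unfolding turing_machine_def using assms by blast

lemma turing_machineD:
  assumes "turing_machine M"
  shows "num_states M \<ge> 3" "num_symbols M \<ge> 3"
    and "q < num_states M \<Longrightarrow> s < num_symbols M \<Longrightarrow> trans M q s = (q', s', d)
      \<Longrightarrow> q' < num_states M \<and> s' < num_symbols M"
  using assms unfolding turing_machine_def by blast+

lemma step_halted: "halted c \<Longrightarrow> step M c = c"
  by (cases c) simp

lemma steps_halted: "halted c \<Longrightarrow> (step M ^^ t) c = c"
  by (induction t) (auto simp: step_halted)

lemma steps_mono:
  assumes "halted ((step M ^^ t) c)" "t \<le> t'"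
  shows "(step M ^^ t') c = (step M ^^ t) c"
proof -
  have "(step M ^^ t') c = (step M ^^ (t' - t)) ((step M ^^ t) c)"
    using assms(2) by (metis comp_apply funpow_add le_add_diff_inverse2)
  then show ?thesis using steps_halted[OF assms(1)] by simp
qed

lemma delivers_halted:
  assumes "delivers M u t r"
  shows "halted ((step M ^^ t) (0, ntape u, 0))"
  using assms by (auto simp: delivers_def halted_def split: option.splits)

lemma delivers_mono:
  assumes "delivers M u t r" "t \<le> t'"
  shows "delivers M u t' r"
  using assms steps_mono[OF delivers_halted[OF assms(1)] assms(2)]
  unfolding delivers_def by simp

text \<open>
  The first of two composed machines leaves its output wherever it stops, and the second machine has
  to start from there.
\<close>

fun shift_config :: "int \<Rightarrow> config \<Rightarrow> config" where
  "shift_config k (q, tp, h) = (q, (\<lambda>i. tp (i - k)), h + k)"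

lemma step_shift: "step M (shift_config k c) = shift_config k (step M c)"
proof -
  obtain q tp h where c: "c = (q, tp, h)" by (cases c)
  obtain q' s d where t: "trans M q (tp h) = (q', s, d)" by (cases "trans M q (tp h)")
  show ?thesis
  proof (cases "halted c")
    case True
    then have "halted (shift_config k c)" by (simp add: c halted_def)
    with True show ?thesis by (simp only: step_halted)
  next
    case False
    then show ?thesis by (auto simp: c t halted_def fun_eq_iff)
  qed
qed

lemma steps_shift: "(step M ^^ t) (shift_config k c) = shift_config k ((step M ^^ t) c)"
  by (induction t) (auto simp: step_shift)

definition valid_config :: "tm \<Rightarrow> config \<Rightarrow> bool" where
  "valid_config M c \<longleftrightarrow> fst c < num_states M \<and> (\<forall>i. fst (snd c) i < num_symbols M)"

lemma step_valid: "turing_machine M \<Longrightarrow> valid_config M c \<Longrightarrow> valid_config M (step M c)"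
proof -
  assume M: "turing_machine M" and v: "valid_config M c"
  obtain q tp h where c: "c = (q, tp, h)" by (cases c)
  obtain q' s d where t: "trans M q (tp h) = (q', s, d)" by (cases "trans M q (tp h)")
  have "q < num_states M" "tp h < num_symbols M" using v by (auto simp: c valid_config_def)
  then have "q' < num_states M" "s < num_symbols M"
    using turing_machineD(3)[OF M _ _ t] by simp_all
  then show "valid_config M (step M c)" using v by (simp add: c t valid_config_def)
qed

lemma steps_valid: "turing_machine M \<Longrightarrow> valid_config M c \<Longrightarrow> valid_config M ((step M ^^ t) c)"
  by (induction t) (auto simp: step_valid)

lemma initial_valid:
  assumes "turing_machine M" "\<And>s. s \<in> set u \<Longrightarrow> s < num_symbols M"
  shows "valid_config M (0, ntape u, 0)"
proof -
  have "u ! nat i < num_symbols M" if "0 \<le> i" "i < int (length u)" for i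
    using that by (intro assms(2) nth_mem) auto
  then show ?thesis using turing_machineD(1,2)[OF assms(1)] by (auto simp: valid_config_def ntape_def)
qed

section \<open>Sequential composition of Turing machines\<close>

text \<open>
  The states of \<open>N\<close> are moved above those of \<open>M\<close>, except that the halting states are shared.  Entering
  the accepting state of \<open>M\<close> becomes starting \<open>N\<close>.  A symbol that is foreign to the running machine
  can never be met and leads to rejection.
\<close>

definition seq_tm :: "tm \<Rightarrow> tm \<Rightarrow> tm" where
  "seq_tm M N = \<lparr>
     num_states = num_states M + num_states N,
     num_symbols = max (num_symbols M) (num_symbols N),
     trans = (\<lambda>q s.
       if q < num_states M then
         if s < num_symbols M then
           (case trans M q s of (q', s', d) \<Rightarrow>
              (if q' = accept_state then num_states M else q', s', d))
         else (reject_state, s, Stationary)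
       else
         if s < num_symbols N then
           (case trans N (q - num_states M) s of (q', s', d) \<Rightarrow>
              (if q' = accept_state \<or> q' = reject_state then q' else num_states M + q', s', d))
         else (reject_state, s, Stationary))\<rparr>"

lemma seq_tm_machine:
  assumes M: "turing_machine M" and N: "turing_machine N"
  shows "turing_machine (seq_tm M N)"
proof (rule turing_machineI)
  show "num_states (seq_tm M N) \<ge> 3" "num_symbols (seq_tm M N) \<ge> 3"
    using turing_machineD(1,2)[OF M] by (simp_all add: seq_tm_def)
next
  fix q s q' s' d
  assume q: "q < num_states (seq_tm M N)" and s: "s < num_symbols (seq_tm M N)"
    and t: "trans (seq_tm M N) q s = (q', s', d)"
  have ge: "num_states M \<ge> 3" by (rule turing_machineD(1)[OF M])
  show "q' < num_states (seq_tm M N) \<and> s' < num_symbols (seq_tm M N)"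
  proof (cases "q < num_states M")
    case True
    obtain p a e where pae: "trans M q s = (p, a, e)" by (cases "trans M q s")
    show ?thesis
      using True s t ge turing_machineD(1)[OF N] turing_machineD(3)[OF M _ _ pae]
      by (auto simp: seq_tm_def pae split: if_splits)
  next
    case False
    then have lt: "q - num_states M < num_states N" using q by (simp add: seq_tm_def)
    obtain p a e where pae: "trans N (q - num_states M) s = (p, a, e)"
      by (cases "trans N (q - num_states M) s")
    show ?thesis
      using False lt s t ge turing_machineD(3)[OF N _ _ pae]
      by (auto simp: seq_tm_def pae split: if_splits)
  qed
qed

fun first_embed :: "tm \<Rightarrow> config \<Rightarrow> config" where
  "first_embed M (q, c) = (if q = accept_state then num_states M else q, c)"

fun second_embed :: "tm \<Rightarrow> config \<Rightarrow> config" where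
  "second_embed M (q, c) =
     (if q = accept_state \<or> q = reject_state then q else num_states M + q, c)"

lemma seq_tm_first_step:
  assumes "turing_machine M" "valid_config M c" "\<not> halted c"
  shows "step (seq_tm M N) (first_embed M c) = first_embed M (step M c)"
proof -
  obtain q tp h where c: "c = (q, tp, h)" by (cases c)
  obtain q' s d where t: "trans M q (tp h) = (q', s, d)" by (cases "trans M q (tp h)")
  have "num_states M \<ge> 3" by (rule turing_machineD(1)[OF assms(1)])
  moreover have "q < num_states M" "tp h < num_symbols M"
    using assms(2) by (auto simp: c valid_config_def)
  ultimately show ?thesis using assms(3) t
    by (simp add: c seq_tm_def halted_def)
qed

text \<open>
  Fewer than \<open>t\<close> steps are needed if \<open>M\<close> halts early: then \<open>M\<close> stays where it is, but the composed
  machine would go on with \<open>N\<close>.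
\<close>

lemma seq_tm_first:
  assumes "turing_machine M" "valid_config M c"
  shows "\<exists>t'\<le>t. (step (seq_tm M N) ^^ t') (first_embed M c) = first_embed M ((step M ^^ t) c)"
  using assms(2)
proof (induction t arbitrary: c)
  case 0
  then show ?case by simp
next
  case (Suc t)
  show ?case
  proof (cases "halted c")
    case True
    then show ?thesis by (intro exI[of _ 0]) (simp only: steps_halted, simp)
  next
    case False
    obtain t' where "t' \<le> t" and
      t': "(step (seq_tm M N) ^^ t') (first_embed M (step M c)) = first_embed M ((step M ^^ t) (step M c))"
      using Suc.IH[OF step_valid[OF assms(1) Suc.prems]] by blast
    have "(step (seq_tm M N) ^^ Suc t') (first_embed M c) = first_embed M ((step M ^^ Suc t) c)"
      using t' seq_tm_first_step[OF assms(1) Suc.prems False] by (simp add: funpow_swap1)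
    then show ?thesis using \<open>t' \<le> t\<close> by (meson Suc_le_mono)
  qed
qed

lemma seq_tm_second_step:
  assumes "turing_machine M" "turing_machine N" "valid_config N c"
  shows "step (seq_tm M N) (second_embed M c) = second_embed M (step N c)"
proof -
  obtain q tp h where c: "c = (q, tp, h)" by (cases c)
  obtain q' s d where t: "trans N q (tp h) = (q', s, d)" by (cases "trans N q (tp h)")
  have "num_states M \<ge> 3" by (rule turing_machineD(1)[OF assms(1)])
  moreover have "q < num_states N" "tp h < num_symbols N"
    using assms(3) by (auto simp: c valid_config_def)
  ultimately show ?thesis using t
    by (simp add: c seq_tm_def halted_def)
qed

lemma seq_tm_second:
  assumes "turing_machine M" "turing_machine N" "valid_config N c"
  shows "(step (seq_tm M N) ^^ t) (second_embed M c) = second_embed M ((step N ^^ t) c)"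
  by (induction t) (auto simp: seq_tm_second_step[OF assms(1,2) steps_valid[OF assms(2,3)]])

lemma seq_tm_delivers_None:
  assumes "turing_machine M" "\<And>s. s \<in> set u \<Longrightarrow> s < num_symbols M"
    and "delivers M u t None"
  shows "delivers (seq_tm M N) u t None"
proof -
  have v: "valid_config M (0, ntape u, 0)" using assms by (intro initial_valid)
  obtain q tp h where c: "(step M ^^ t) (0, ntape u, 0) = (q, tp, h)" by (metis prod_cases3)
  with assms(3) have q: "q = 2" by (simp add: delivers_def)
  obtain t' where "t' \<le> t" "(step (seq_tm M N) ^^ t') (0, ntape u, 0) = (2, tp, h)"
    using seq_tm_first[OF assms(1) v, of t N] unfolding c q by auto
  then have "delivers (seq_tm M N) u t' None" by (simp add: delivers_def)
  then show ?thesis using \<open>t' \<le> t\<close> by (rule delivers_mono)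
qed

lemma seq_tm_delivers_Some:
  assumes M: "turing_machine M" and N: "turing_machine N"
    and u: "\<And>s. s \<in> set u \<Longrightarrow> s < num_symbols M" and v: "\<And>s. s \<in> set v \<Longrightarrow> s < num_symbols N"
    and d1: "delivers M u t1 (Some v)" and d2: "delivers N v t2 r"
  shows "delivers (seq_tm M N) u (t1 + t2) r"
proof -
  let ?S = "seq_tm M N"
  have val: "valid_config M (0, ntape u, 0)" using M u by (intro initial_valid)
  obtain q tp h where c: "(step M ^^ t1) (0, ntape u, 0) = (q, tp, h)" by (metis prod_cases3)
  with d1 have q: "q = 1" and tp: "\<And>i. tp (h + i) = ntape v i" by (auto simp: delivers_def)
  obtain t' where t': "t' \<le> t1" "(step ?S ^^ t') (0, ntape u, 0) = (num_states M, tp, h)"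
    using seq_tm_first[OF M val, of t1 N] unfolding c q by auto
  have tp': "tp = (\<lambda>i. ntape v (i - h))" using tp[of "i - h" for i] by (auto simp: fun_eq_iff)
  have m: "(num_states M, tp, h) = second_embed M (shift_config h (0, ntape v, 0))"
    by (simp add: tp')
  have "valid_config N (0, ntape v, 0)" using N v by (intro initial_valid)
  then have "valid_config N (shift_config h (0, ntape v, 0))" by (simp add: valid_config_def)
  from seq_tm_second[OF M N this, of t2]
  have run: "(step ?S ^^ (t2 + t')) (0, ntape u, 0)
      = second_embed M (shift_config h ((step N ^^ t2) (0, ntape v, 0)))"
    unfolding funpow_add comp_apply t'(2) m by (simp only: steps_shift)
  obtain q2 tp2 h2 where c2: "(step N ^^ t2) (0, ntape v, 0) = (q2, tp2, h2)" by (metis prod_cases3)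
  have "delivers ?S u (t2 + t') r"
    using d2 unfolding delivers_def run c2
    by (auto split: option.splits simp: algebra_simps)
  then show ?thesis by (rule delivers_mono) (use t'(1) in simp)
qed

lemma seq_tm_delivers:
  assumes M: "turing_machine M" and N: "turing_machine N"
    and u: "\<And>s. s \<in> set u \<Longrightarrow> s < num_symbols M"
    and d: "delivers M u t1 (map_option code x)"
    and rest: "\<And>y. x = Some y \<Longrightarrow> (\<forall>s\<in>set (code y). s < num_symbols N) \<and> delivers N (code y) t2 (g y)"
  shows "delivers (seq_tm M N) u (t1 + t2) (Option.bind x g)"
proof (cases x)
  case None
  then have "delivers (seq_tm M N) u t1 None"
    using d by (intro seq_tm_delivers_None[OF M u]) simp_all
  then show ?thesis using None by (auto intro: delivers_mono)
next
  case (Some y)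
  then show ?thesis using rest[OF Some] d by (auto intro: seq_tm_delivers_Some[OF M N u])
qed


section \<open>Turing machines over arbitrary finite types\<close>

text \<open>
  Machines are easier to program and to reason about if their states and symbols belong to suitable
  datatypes.  The configurations of such a machine stop changing in the states of \<open>H\<close>.
\<close>

fun typed_step :: "('a \<Rightarrow> 'c \<Rightarrow> 'a \<times> 'c \<times> direction) \<Rightarrow> 'a set \<Rightarrow>
    'a \<times> (int \<Rightarrow> 'c) \<times> int \<Rightarrow> 'a \<times> (int \<Rightarrow> 'c) \<times> int" where
  "typed_step tr H (q, tp, h) =
     (if q \<in> H then (q, tp, h)
      else let (q', s', d) = tr q (tp h) in (q', tp(h := s'), h + offset d))"

fun encode_config :: "('a \<Rightarrow> nat) \<Rightarrow> ('c \<Rightarrow> nat) \<Rightarrow> 'a \<times> (int \<Rightarrow> 'c) \<times> int \<Rightarrow> config" where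
  "encode_config es ec (q, tp, h) = (es q, ec \<circ> tp, h)"

lemma finite_inj_nat:
  assumes "finite A"
  obtains e :: "'a \<Rightarrow> nat" where "inj_on e A"
  using assms by (metis ex_bij_betw_finite_nat bij_betw_def)

lemma ex_state_encoding:
  assumes "finite A" "a \<noteq> b" "a \<noteq> c" "b \<noteq> c"
  obtains e :: "'a \<Rightarrow> nat" where "inj_on e A" "e a = 0" "e b = 1" "e c = 2"
    "\<And>x. e x = 1 \<longleftrightarrow> x = b" "\<And>x. e x = 2 \<longleftrightarrow> x = c"
proof -
  obtain g :: "'a \<Rightarrow> nat" where g: "inj_on g A" using finite_inj_nat[OF assms(1)] .
  define e where "e x = (if x = a then 0 else if x = b then 1 else if x = c then 2 else 3 + g x)" for x
  show thesis
    by (rule that[of e]) (use g assms(2-4) in \<open>auto simp: e_def inj_on_def\<close>)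
qed

lemma typed_machine:
  fixes tr :: "'a \<Rightarrow> 'c::finite \<Rightarrow> 'a \<times> 'c \<times> direction" and ec :: "'c \<Rightarrow> nat"
  assumes Q: "finite Q" "q0 \<in> Q" "yes \<in> Q" "no \<in> Q" "q0 \<noteq> yes" "q0 \<noteq> no" "yes \<noteq> no"
    and closed: "\<And>q s. q \<in> Q \<Longrightarrow> fst (tr q s) \<in> Q"
    and ec: "inj ec"
  obtains M es where "turing_machine M" "\<And>s. ec s < num_symbols M"
    "es q0 = 0" "es yes = 1" "es no = 2"
    "\<And>t q tp h. q \<in> Q \<Longrightarrow>
       (step M ^^ t) (encode_config es ec (q, tp, h))
         = encode_config es ec ((typed_step tr {yes, no} ^^ t) (q, tp, h))"
proof -
  obtain es :: "'a \<Rightarrow> nat" where es: "inj_on es Q" "es q0 = 0" "es yes = 1" "es no = 2"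
    "\<And>x. es x = 1 \<longleftrightarrow> x = yes" "\<And>x. es x = 2 \<longleftrightarrow> x = no"
    using ex_state_encoding[OF Q(1,5,6,7)] by blast
  define ns where "ns = Suc (Max (es ` Q)) + 3"
  define nc where "nc = Suc (Max (range ec)) + 3"
  have ns: "es q < ns" if "q \<in> Q" for q
  proof -
    have "es q \<le> Max (es ` Q)" using Q(1) that by simp
    then show ?thesis by (simp add: ns_def)
  qed
  have nc: "ec s < nc" for s
  proof -
    have "ec s \<le> Max (range ec)" by simp
    then show ?thesis unfolding nc_def by linarith
  qed
  define M where "M = \<lparr>num_states = ns, num_symbols = nc, trans = (\<lambda>q s.
     if q \<in> es ` Q \<and> s \<in> range ec then
       (case tr (inv_into Q es q) (inv_into UNIV ec s) of (q', s', d) \<Rightarrow> (es q', ec s', d))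
     else (2, s, Stationary))\<rparr>"
  have tm: "turing_machine M"
  proof (rule turing_machineI)
    show "num_states M \<ge> 3" "num_symbols M \<ge> 3" by (simp_all add: M_def ns_def nc_def)
  next
    fix q s q' s' d
    assume q: "q < num_states M" and s: "s < num_symbols M" and t: "trans M q s = (q', s', d)"
    show "q' < num_states M \<and> s' < num_symbols M"
    proof (cases "q \<in> es ` Q \<and> s \<in> range ec")
      case True
      obtain p a e where p: "tr (inv_into Q es q) (inv_into UNIV ec s) = (p, a, e)"
        by (cases "tr (inv_into Q es q) (inv_into UNIV ec s)")
      have "p \<in> Q" using closed[of "inv_into Q es q" "inv_into UNIV ec s"] True p
        by (simp add: inv_into_into)
      then show ?thesis using t True p ns[of p] nc[of a] by (simp add: M_def)
    next
      case False
      then show ?thesis using t s by (auto simp: M_def ns_def)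
    qed
  qed
  have one: "step M (encode_config es ec (q, tp, h)) = encode_config es ec (typed_step tr {yes, no} (q, tp, h))"
    if q: "q \<in> Q" for q tp h
  proof -
    obtain p a e where p: "tr q (tp h) = (p, a, e)" by (cases "tr q (tp h)")
    have "trans M (es q) (ec (tp h)) = (es p, ec a, e)"
      using q p by (simp add: M_def inv_into_f_f[OF es(1)] inv_f_f[OF ec])
    then show ?thesis using es(5)[of q] es(6)[of q] p
      by (auto simp: halted_def fun_eq_iff)
  qed
  have stay: "fst (typed_step tr {yes, no} (q, tp, h)) \<in> Q" if "q \<in> Q" for q tp h
    using that closed[OF that, of "tp h"] by (auto split: prod.split)
  have many: "(step M ^^ t) (encode_config es ec (q, tp, h))
         = encode_config es ec ((typed_step tr {yes, no} ^^ t) (q, tp, h))" if "q \<in> Q" for t q tp h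
    using that
  proof (induction t arbitrary: q tp h)
    case (Suc t)
    obtain q' tp' h' where c: "typed_step tr {yes, no} (q, tp, h) = (q', tp', h')" by (metis prod_cases3)
    then have "q' \<in> Q" using stay[OF Suc.prems, of tp h] by simp
    from Suc.IH[OF this, of tp' h'] show ?case
      unfolding funpow_Suc_right comp_apply one[OF Suc.prems] c .
  qed simp
  show thesis
    by (rule that[OF tm _ es(2-4) many]) (simp_all add: M_def nc)
qed

section \<open>Iterated sequential transducers\<close>

datatype 'q verdict = Accept | Reject | Again 'q

text \<open>
  During a pass each letter is replaced by a word.  When the whole word has been read, some more output
  may follow, and the state reached decides whether the result is final or another pass begins.
\<close>

record ('q, 's) transducer =
  init :: 'q
  move :: "'q \<Rightarrow> 's \<Rightarrow> 'q \<times> 's list"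
  final_output :: "'q \<Rightarrow> 's list"
  verdict :: "'q \<Rightarrow> 'q verdict"

fun pass :: "('q, 's) transducer \<Rightarrow> 'q \<Rightarrow> 's list \<Rightarrow> 'q \<times> 's list" where
  "pass T q [] = (q, [])"
| "pass T q (s # w) =
     (let (p, u) = move T q s; (p', v) = pass T p w in (p', u @ v))"

text \<open>
  Running times depend on two quantities: the number \<open>n\<close> of passes, and a bound \<open>L\<close> for the lengths
  of all words that arise.  The second does not follow from the first, as each pass can multiply
  the length.
\<close>

inductive exec :: "('q, 's) transducer \<Rightarrow> nat \<Rightarrow> nat \<Rightarrow> 'q \<Rightarrow> 's list \<Rightarrow> 's list option \<Rightarrow> bool"
  for T L where
  exec_accept: "exec T L (Suc 0) q w (Some (v @ final_output T p))"
    if "pass T q w = (p, v)" "verdict T p = Accept" "length w \<le> L" "length (v @ final_output T p) \<le> L"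
| exec_reject: "exec T L (Suc 0) q w None"
    if "pass T q w = (p, v)" "verdict T p = Reject" "length w \<le> L" "length (v @ final_output T p) \<le> L"
| exec_again: "exec T L (Suc n) q w r"
    if "pass T q w = (p, v)" "verdict T p = Again q'" "length w \<le> L" "length (v @ final_output T p) \<le> L"
      "exec T L n q' (v @ final_output T p) r"

definition finite_states :: "('q, 's) transducer \<Rightarrow> 'q set \<Rightarrow> bool" where
  "finite_states T Q \<longleftrightarrow> finite Q \<and> init T \<in> Q \<and>
     (\<forall>q\<in>Q. \<forall>s. fst (move T q s) \<in> Q) \<and> (\<forall>q\<in>Q. \<forall>q'. verdict T q = Again q' \<longrightarrow> q' \<in> Q)"

datatype ('q, 's) phase =
  Go "'q option" "'s option list" | Back "'q option" | Pop 'q | Yes | No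

text \<open>
  The word to be rewritten is a queue: letters are removed at its left end, and their replacements are
  written at its right end, so that a pass is one rotation.  On the tape \<open>None\<close> is the blank, and
  \<open>Some None\<close> marks the end of the part of the queue that remains to be read in the current pass.  In the
  phase \<open>Go k u\<close> the head walks to the right end in order to write \<open>u\<close>, and in the phase \<open>Back k\<close> it
  returns to the front, where \<open>k\<close> is the state in which reading continues or \<open>None\<close> if the result is
  complete.
\<close>

fun queue_trans :: "('q, 's) transducer \<Rightarrow> ('q, 's) phase \<Rightarrow> 's option option \<Rightarrow>
    ('q, 's) phase \<times> 's option option \<times> direction" where
  "queue_trans T (Go k u) (Some c) = (Go k u, Some c, Rightward)"
| "queue_trans T (Go k (a # u)) None = (Go k u, Some a, Rightward)"
| "queue_trans T (Go k []) None = (Back k, None, Leftward)"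
| "queue_trans T (Back k) (Some c) = (Back k, Some c, Leftward)"
| "queue_trans T (Back k) None = (case k of Some q \<Rightarrow> Pop q | None \<Rightarrow> Yes, None, Rightward)"
| "queue_trans T (Pop q) (Some (Some s)) =
     (Go (Some (fst (move T q s))) (map Some (snd (move T q s))), None, Rightward)"
| "queue_trans T (Pop q) (Some None) =
     (case verdict T q of
        Accept \<Rightarrow> Go None (map Some (final_output T q))
      | Reject \<Rightarrow> No
      | Again p \<Rightarrow> Go (Some p) (map Some (final_output T q) @ [None]), None, Rightward)"
| "queue_trans T _ s = (No, s, Stationary)"

definition queue_tape :: "int \<Rightarrow> 'c list \<Rightarrow> int \<Rightarrow> 'c option" where
  "queue_tape a w i = (if a \<le> i \<and> i < a + int (length w) then Some (w ! nat (i - a)) else None)"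

lemma queue_tape_in: "i < length w \<Longrightarrow> queue_tape a w (a + int i) = Some (w ! i)"
  by (simp add: queue_tape_def)

lemma queue_tape_out [simp]:
  "queue_tape a w (a - 1) = None" "queue_tape a w (a + int (length w)) = None"
  by (simp_all add: queue_tape_def)

lemma queue_tape_pop: "(queue_tape a (c # w))(a := None) = queue_tape (a + 1) w"
  by (auto simp: queue_tape_def fun_eq_iff nth_Cons' nat_diff_distrib' algebra_simps nat_eq_iff
      intro!: arg_cong[of _ _ "(!) w"])

lemma queue_tape_push:
  "(queue_tape a w)(a + int (length w) := Some c) = queue_tape a (w @ [c])"
  by (auto simp: queue_tape_def fun_eq_iff nth_append)

abbreviation queue_step where
  "queue_step T \<equiv> typed_step (queue_trans T) {Yes, No}"

lemma funpow_trans: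
  assumes "(f ^^ m) x = y" "(f ^^ n) y = z"
  shows "(f ^^ (m + n)) x = z"
  using assms by (metis add.commute comp_apply funpow_add)

lemma go_right:
  "i \<le> length w \<Longrightarrow> (queue_step T ^^ (length w - i)) (Go k u, queue_tape a w, a + int i)
     = (Go k u, queue_tape a w, a + int (length w))"
proof (induction "length w - i" arbitrary: i)
  case (Suc d)
  have i: "i < length w" using Suc.hyps(2) by simp
  have "queue_step T (Go k u, queue_tape a w, a + int i) = (Go k u, queue_tape a w, a + int (Suc i))"
    using i by (simp add: queue_tape_in) (simp add: fun_eq_iff queue_tape_in)
  moreover have "d = length w - Suc i" using Suc.hyps(2) by simp
  ultimately show ?case using Suc.hyps(1)[of "Suc i"] i Suc.hyps(2)[symmetric]
    by (simp add: funpow_swap1)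
qed simp

lemma go_write:
  "(queue_step T ^^ length u) (Go k u, queue_tape a w, a + int (length w))
     = (Go k [], queue_tape a (w @ u), a + int (length (w @ u)))"
proof (induction u arbitrary: w)
  case (Cons c u)
  have "queue_step T (Go k (c # u), queue_tape a w, a + int (length w))
      = (Go k u, queue_tape a (w @ [c]), a + int (length (w @ [c])))"
    by (simp add: queue_tape_push)
  with Cons.IH[of "w @ [c]"] show ?case by (simp add: funpow_swap1 algebra_simps)
qed simp

lemma go_back:
  "i \<le> length w \<Longrightarrow> (queue_step T ^^ i) (Back k, queue_tape a w, a + int i - 1)
     = (Back k, queue_tape a w, a - 1)"
proof (induction i)
  case (Suc i)
  have "queue_step T (Back k, queue_tape a w, a + int (Suc i) - 1)
      = (Back k, queue_tape a w, a + int i - 1)"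
    using Suc.prems by (simp add: queue_tape_in) (simp add: fun_eq_iff queue_tape_in)
  with Suc show ?case by (simp add: funpow_swap1)
qed simp

text \<open>
  Each letter that is read costs one such walk along the queue.
\<close>

lemma append_and_return:
  "(queue_step T ^^ (2 * length (w @ u) + 2)) (Go k u, queue_tape a w, a)
     = (case k of Some q \<Rightarrow> Pop q | None \<Rightarrow> Yes, queue_tape a (w @ u), a)"
proof -
  have 1: "(queue_step T ^^ length w) (Go k u, queue_tape a w, a)
     = (Go k u, queue_tape a w, a + int (length w))"
    using go_right[of 0 w T k u a] by simp
  have 3: "(queue_step T ^^ 1) (Go k [], queue_tape a (w @ u), a + int (length (w @ u)))
     = (Back k, queue_tape a (w @ u), a + int (length (w @ u)) - 1)"
    using queue_tape_out(2)[of a "w @ u"] by (auto simp: fun_eq_iff)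
  have 5: "(queue_step T ^^ 1) (Back k, queue_tape a (w @ u), a - 1)
     = (case k of Some q \<Rightarrow> Pop q | None \<Rightarrow> Yes, queue_tape a (w @ u), a)"
    using queue_tape_out(1)[of a "w @ u"] by (auto simp: fun_eq_iff)
  have e: "2 * length (w @ u) + 2 = (length w + length u) + 1 + length (w @ u) + 1" by simp
  show ?thesis unfolding e
    by (rule funpow_trans[OF funpow_trans[OF funpow_trans[OF funpow_trans[OF 1 go_write] 3]
          go_back[OF order_refl]] 5])
qed

lemma pop_symbol:
  "(queue_step T ^^ (2 * length (w @ u) + 3)) (Pop q, queue_tape a (c # w), a)
     = (case k of Some q \<Rightarrow> Pop q | None \<Rightarrow> Yes, queue_tape (a + 1) (w @ u), a + 1)"
  if "queue_trans T (Pop q) (Some c) = (Go k u, None, Rightward)"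
proof -
  have "queue_step T (Pop q, queue_tape a (c # w), a) = (Go k u, queue_tape (a + 1) w, a + 1)"
    using that by (simp add: queue_tape_pop queue_tape_in[of 0 "c # w" a, simplified])
  then have 1: "(queue_step T ^^ 1) (Pop q, queue_tape a (c # w), a)
      = (Go k u, queue_tape (a + 1) w, a + 1)" by simp
  have e: "2 * length (w @ u) + 3 = 1 + (2 * length (w @ u) + 2)" by simp
  show ?thesis unfolding e by (rule funpow_trans[OF 1 append_and_return])
qed

text \<open>
  Here \<open>z\<close> is the part of the queue behind the unread part \<open>w\<close>: the end marker and the output so far.
\<close>

lemma queue_pass:
  "pass T q w = (p, v) \<Longrightarrow> length w + length z + length v \<le> K \<Longrightarrow>
     \<exists>t \<le> length w * (2 * K + 3).
       (queue_step T ^^ t) (Pop q, queue_tape a (map Some w @ z), a)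
         = (Pop p, queue_tape (a + int (length w)) (z @ map Some v), a + int (length w))"
proof (induction w arbitrary: q a z v)
  case Nil
  then show ?case by (intro exI[of _ 0]) auto
next
  case (Cons s w)
  obtain q1 u where m: "move T q s = (q1, u)" by (cases "move T q s")
  obtain v' where v': "pass T q1 w = (p, v')" "v = u @ v'"
    using Cons.prems(1) m by (auto split: prod.splits)
  let ?t = "2 * length ((map Some w @ z) @ map Some u) + 3"
  have 1: "(queue_step T ^^ ?t) (Pop q, queue_tape a (Some s # map Some w @ z), a)
     = (Pop q1, queue_tape (a + 1) ((map Some w @ z) @ map Some u), a + 1)"
    using pop_symbol[of T q "Some s" "Some q1" "map Some u" "map Some w @ z" a] m by simp
  have "length w + length (z @ map Some u) + length v' \<le> K" using Cons.prems(2) v'(2) by simp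
  from Cons.IH[OF v'(1) this, of "a + 1"] obtain t where t: "t \<le> length w * (2 * K + 3)"
    "(queue_step T ^^ t) (Pop q1, queue_tape (a + 1) (map Some w @ z @ map Some u), a + 1)
     = (Pop p, queue_tape (a + 1 + int (length w)) ((z @ map Some u) @ map Some v'), a + 1 + int (length w))"
    by auto
  have "(queue_step T ^^ (?t + t)) (Pop q, queue_tape a (Some s # map Some w @ z), a)
     = (Pop p, queue_tape (a + 1 + int (length w)) ((z @ map Some u) @ map Some v'), a + 1 + int (length w))"
    by (rule funpow_trans[OF 1]) (use t(2) in simp)
  moreover have "?t + t \<le> length (s # w) * (2 * K + 3)"
    using Cons.prems(2) v'(2) t(1) by simp
  ultimately show ?case using v'(2)
    by (intro exI[of _ "?t + t"]) (simp add: algebra_simps)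
qed

lemma queue_exec:
  "exec T L n q w r \<Longrightarrow>
     \<exists>t \<le> n * ((L + 1) * (4 * L + 5)).
       case (queue_step T ^^ t) (Pop q, queue_tape a (map Some w @ [None]), a) of (q', tp, h) \<Rightarrow>
         (case r of Some y \<Rightarrow> q' = Yes \<and> tp = queue_tape h (map Some y) | None \<Rightarrow> q' = No)"
proof (induction arbitrary: a rule: exec.induct)
  case (exec_accept q w p v)
  let ?b = "a + int (length w)"
  \<comment> \<open>At any time the queue consists of unread input, the end marker and output.\<close>
  have "length w + length [None] + length v \<le> 2 * L + 1" using exec_accept(3,4) by simp
  from queue_pass[OF exec_accept(1) this, of a] obtain t where t: "t \<le> length w * (2 * (2 * L + 1) + 3)"
    "(queue_step T ^^ t) (Pop q, queue_tape a (map Some w @ [None]), a)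
      = (Pop p, queue_tape ?b (None # map Some v), ?b)" by auto
  let ?t = "2 * length (map Some v @ map Some (final_output T p)) + 3"
  have 2: "(queue_step T ^^ ?t) (Pop p, queue_tape ?b (None # map Some v), ?b)
      = (Yes, queue_tape (?b + 1) (map Some v @ map Some (final_output T p)), ?b + 1)"
    using pop_symbol[of T p None None "map Some (final_output T p)" "map Some v" ?b] exec_accept(2)
    by simp
  have "t \<le> L * (4 * L + 5)" by (rule order_trans[OF t(1)]) (use exec_accept(3) in \<open>auto intro: mult_le_mono\<close>)
  then have "t + ?t \<le> Suc 0 * ((L + 1) * (4 * L + 5))" using exec_accept(4) by simp
  then show ?case using funpow_trans[OF t(2) 2]
    by (intro exI[of _ "t + ?t"]) simp
next
  case (exec_reject q w p v)
  let ?b = "a + int (length w)"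
  have "length w + length [None] + length v \<le> 2 * L + 1" using exec_reject(3,4) by simp
  from queue_pass[OF exec_reject(1) this, of a] obtain t where t: "t \<le> length w * (2 * (2 * L + 1) + 3)"
    "(queue_step T ^^ t) (Pop q, queue_tape a (map Some w @ [None]), a)
      = (Pop p, queue_tape ?b (None # map Some v), ?b)" by auto
  have 2: "(queue_step T ^^ 1) (Pop p, queue_tape ?b (None # map Some v), ?b)
      = (No, queue_tape (?b + 1) (map Some v), ?b + 1)"
    using exec_reject(2) by (simp add: queue_tape_pop queue_tape_in[of 0 "None # map Some v" ?b, simplified])
  have "t \<le> L * (4 * L + 5)" by (rule order_trans[OF t(1)]) (use exec_reject(3) in \<open>auto intro: mult_le_mono\<close>)
  then have "t + 1 \<le> Suc 0 * ((L + 1) * (4 * L + 5))" using exec_reject(4) by simp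
  then show ?case using funpow_trans[OF t(2) 2]
    by (intro exI[of _ "t + 1"]) simp
next
  case (exec_again q w p v q' n r)
  let ?b = "a + int (length w)"
  let ?v = "map Some v @ map Some (final_output T p) @ [None]"
  have "length w + length [None] + length v \<le> 2 * L + 1" using exec_again(3,4) by simp
  from queue_pass[OF exec_again(1) this, of a] obtain t where t: "t \<le> length w * (2 * (2 * L + 1) + 3)"
    "(queue_step T ^^ t) (Pop q, queue_tape a (map Some w @ [None]), a)
      = (Pop p, queue_tape ?b (None # map Some v), ?b)" by auto
  let ?t = "2 * length ?v + 3"
  have 2: "(queue_step T ^^ ?t) (Pop p, queue_tape ?b (None # map Some v), ?b)
      = (Pop q', queue_tape (?b + 1) ?v, ?b + 1)"
    using pop_symbol[of T p None "Some q'" "map Some (final_output T p) @ [None]" "map Some v" ?b]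
      exec_again(2) by simp
  have "t \<le> L * (4 * L + 5)" by (rule order_trans[OF t(1)]) (use exec_again(3) in \<open>auto intro: mult_le_mono\<close>)
  then have tt: "t + ?t \<le> (L + 1) * (4 * L + 5)" using exec_again(4) by simp
  obtain t' where t': "t' \<le> n * ((L + 1) * (4 * L + 5))"
    "case (queue_step T ^^ t') (Pop q', queue_tape (?b + 1) ?v, ?b + 1) of (q', tp, h) \<Rightarrow>
         (case r of Some y \<Rightarrow> q' = Yes \<and> tp = queue_tape h (map Some y) | None \<Rightarrow> q' = No)"
    using exec_again.IH[of "?b + 1"] by auto
  have "(queue_step T ^^ (t + ?t + t')) (Pop q, queue_tape a (map Some w @ [None]), a)
      = (queue_step T ^^ t') (Pop q', queue_tape (?b + 1) ?v, ?b + 1)"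
    by (rule funpow_trans[OF funpow_trans[OF t(2) 2] refl])
  then show ?case using t' tt by (intro exI[of _ "t + ?t + t'"]) simp
qed

lemma queue_tape_shift: "queue_tape h w (h + i) = queue_tape 0 w i"
  by (simp add: queue_tape_def)

text \<open>
  The run starts by writing the end marker behind the input, which is the phase \<open>Go\<close> with output
  \<open>[None]\<close>.  The words that wait to be written have bounded length, so there are only finitely many
  phases.
\<close>

lemma transducer_machine:
  fixes T :: "('q, 's::finite) transducer" and se :: "'s \<Rightarrow> nat"
  assumes T: "finite_states T Q" and se: "inj se" "0 \<notin> range se"
  obtains M where "turing_machine M" "\<And>s. se s < num_symbols M"
    "\<And>w L n r. exec T L n (init T) w r \<Longrightarrow>
       delivers M (map se w) (2 * (length w + 1) + 2 + n * ((L + 1) * (4 * L + 5))) (map_option (map se) r)"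
proof -
  have "finite (length ` (\<lambda>(q, s). snd (move T q s)) ` (Q \<times> UNIV) \<union> length ` final_output T ` Q)"
    using T by (simp add: finite_states_def)
  then obtain B where B': "\<And>n. n \<in> length ` (\<lambda>(q, s). snd (move T q s)) ` (Q \<times> UNIV)
      \<union> length ` final_output T ` Q \<Longrightarrow> n \<le> B"
    by (meson finite_nat_set_iff_bounded_le)
  have TQ: "finite Q" "init T \<in> Q" "\<And>q s. q \<in> Q \<Longrightarrow> fst (move T q s) \<in> Q"
    "\<And>q q'. q \<in> Q \<Longrightarrow> verdict T q = Again q' \<Longrightarrow> q' \<in> Q"
    using T unfolding finite_states_def by blast+
  have B: "length (snd (move T q s)) \<le> B" "length (final_output T q) \<le> B" if "q \<in> Q" for q s
  proof -
    have "(q, s) \<in> Q \<times> UNIV" using that by simp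
    then have "snd (move T q s) \<in> (\<lambda>(q, s). snd (move T q s)) ` (Q \<times> UNIV)"
      by (rule rev_image_eqI) simp
    then show "length (snd (move T q s)) \<le> B" by (intro B' UnI1 imageI)
    show "length (final_output T q) \<le> B" using that by (intro B' UnI2 imageI)
  qed
  define U where "U = {u :: 's option list. length u \<le> B + 1}"
  have "finite U" unfolding U_def
    using finite_lists_length_le[of "UNIV :: 's option set" "B + 1"] by simp
  define QQ where "QQ = case_prod Go ` ((insert None (Some ` Q)) \<times> U) \<union> Back ` (insert None (Some ` Q))
    \<union> Pop ` Q \<union> {Yes, No}"
  have fin: "finite QQ" using TQ(1) \<open>finite U\<close> by (simp add: QQ_def)
  have GoI: "Go k u \<in> QQ" if "k = None \<or> (\<exists>q\<in>Q. k = Some q)" "length u \<le> B + 1" for k u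
  proof -
    have "(k, u) \<in> insert None (Some ` Q) \<times> U" using that by (auto simp: U_def)
    then show ?thesis unfolding QQ_def by (intro UnI1) (rule rev_image_eqI, auto)
  qed
  have BackI: "Back k \<in> QQ" if "k = None \<or> (\<exists>q\<in>Q. k = Some q)" for k
    using that by (auto simp: QQ_def)
  have PopI: "Pop p \<in> QQ" if "p \<in> Q" for p using that by (auto simp: QQ_def)
  have halt: "Yes \<in> QQ" "No \<in> QQ" by (auto simp: QQ_def)
  have ini: "Go (Some (init T)) [None] \<in> QQ" by (rule GoI) (use TQ(2) in auto)
  have closed: "fst (queue_trans T q s) \<in> QQ" if "q \<in> QQ" for q s
  proof (cases q)
    case (Go k u)
    then have k: "k = None \<or> (\<exists>q\<in>Q. k = Some q)" "length u \<le> B + 1"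
      using that by (auto simp: QQ_def U_def)
    have "length u' \<le> B + 1" if "u = a # u'" for a u' using k(2) that by simp
    then show ?thesis using Go GoI[OF k] GoI[OF k(1)] BackI[OF k(1)]
      by (cases s; cases u) simp_all
  next
    case (Back k)
    then have "k = None \<or> (\<exists>q\<in>Q. k = Some q)" using that by (auto simp: QQ_def)
    then show ?thesis using Back BackI[of k] halt PopI by (cases s; cases k) auto
  next
    case (Pop p)
    then have p: "p \<in> Q" using that by (auto simp: QQ_def)
    show ?thesis
    proof (cases s)
      case None
      then show ?thesis using Pop halt by simp
    next
      case (Some c)
      show ?thesis
      proof (cases c)
        case None
        show ?thesis
        proof (cases "verdict T p")
          case Accept
          then show ?thesis using Pop \<open>s = Some c\<close> None GoI[of None "map Some (final_output T p)"] B(2)[OF p]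
            by simp
        next
          case Reject
          then show ?thesis using Pop \<open>s = Some c\<close> None halt by simp
        next
          case (Again p')
          then show ?thesis using Pop \<open>s = Some c\<close> None TQ(4)[OF p Again] B(2)[OF p]
              GoI[of "Some p'" "map Some (final_output T p) @ [None]"]
            by simp
        qed
      next
        case (Some c')
        show ?thesis using Some \<open>s = Some c\<close> Pop B(1)[OF p, of c'] TQ(3)[OF p, of c']
            GoI[of "Some (fst (move T p c'))" "map Some (snd (move T p c'))"] by simp
      qed
    qed
  qed (use halt in simp_all)
  define ec where "ec x = (case x of None \<Rightarrow> 0 | Some None \<Rightarrow> Suc (Max (range se)) | Some (Some s) \<Rightarrow> se s)" for x
  have lt: "se s < Suc (Max (range se))" for s
    by (rule le_imp_less_Suc) simp
  have pos: "se s \<noteq> 0" for s using se(2) by (metis rangeI)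
  have ne: "se s \<noteq> Suc (Max (range se))" for s using lt[of s] by simp
  have ec: "inj ec"
    by (rule injI) (auto simp: ec_def pos ne ne[symmetric] inj_eq[OF se(1)] pos[symmetric] split: option.splits)
  have distinct: "Go (Some (init T)) [None] \<noteq> Yes" "Go (Some (init T)) [None] \<noteq> No"
    "Yes \<noteq> (No :: ('q, 's) phase)" by simp_all
  obtain M es where M: "turing_machine M" "\<And>s. ec s < num_symbols M"
    "es (Go (Some (init T)) [None]) = 0" "es Yes = 1" "es No = 2"
    "\<And>t q tp h. q \<in> QQ \<Longrightarrow>
       (step M ^^ t) (encode_config es ec (q, tp, h)) = encode_config es ec ((queue_step T ^^ t) (q, tp, h))"
    using typed_machine[where tr = "queue_trans T", OF fin ini halt distinct closed ec] by blast
  have ec0: "ec None = 0" "\<And>s. ec (Some (Some s)) = se s" unfolding ec_def by simp_all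
  have tape: "ec (queue_tape h (map Some w) (h + i)) = ntape (map se w) i" for w :: "'s list" and i h
  proof (cases "0 \<le> i \<and> i < int (length w)")
    case True
    then have lt: "nat i < length w" by linarith
    have 1: "queue_tape 0 (map Some w) i = Some (Some (w ! nat i))"
      unfolding queue_tape_def using True lt by simp
    have 2: "ntape (map se w) i = se (w ! nat i)"
      unfolding ntape_def using True lt by simp
    show ?thesis unfolding queue_tape_shift 1 2 ec0 ..
  next
    case False
    have 1: "queue_tape 0 (map Some w) i = None"
      unfolding queue_tape_def using False by auto
    have 2: "ntape (map se w) i = 0"
      unfolding ntape_def using False by auto
    show ?thesis unfolding queue_tape_shift 1 2 ec0 ..
  qed
  have "delivers M (map se w) (2 * (length w + 1) + 2 + n * ((L + 1) * (4 * L + 5))) (map_option (map se) r)"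
    if ex: "exec T L n (init T) w r" for w L n r
  proof -
    let ?t1 = "2 * (length w + 1) + 2"
    have e: "?t1 = 2 * length (map Some w @ [None]) + 2" by simp
    have 1: "(queue_step T ^^ ?t1) (Go (Some (init T)) [None], queue_tape 0 (map Some w), 0)
        = (Pop (init T), queue_tape 0 (map Some w @ [None]), 0)"
      unfolding e append_and_return option.case ..
    obtain t where t: "t \<le> n * ((L + 1) * (4 * L + 5))"
      "case (queue_step T ^^ t) (Pop (init T), queue_tape 0 (map Some w @ [None]), 0) of (q', tp, h) \<Rightarrow>
         (case r of Some y \<Rightarrow> q' = Yes \<and> tp = queue_tape h (map Some y) | None \<Rightarrow> q' = No)"
      using queue_exec[OF ex, of 0] by (elim exE conjE) (rule that)
    obtain q' tp h where c: "(queue_step T ^^ t) (Pop (init T), queue_tape 0 (map Some w @ [None]), 0) = (q', tp, h)"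
      by (metis prod_cases3)
    have "(0, ntape (map se w), 0) = encode_config es ec (Go (Some (init T)) [None], queue_tape 0 (map Some w), 0)"
      using M(3) tape[of 0 w] by (simp add: fun_eq_iff)
    then have run: "(step M ^^ (?t1 + t)) (0, ntape (map se w), 0) = encode_config es ec (q', tp, h)"
      using M(6)[OF ini] funpow_trans[OF 1 c] by (simp only:)
    have "delivers M (map se w) (?t1 + t) (map_option (map se) r)"
    proof (cases r)
      case None
      then have "q' = No" using t(2) c by simp
      then show ?thesis unfolding delivers_def run by (simp add: None M(5))
    next
      case (Some y)
      then have "q' = Yes" "tp = queue_tape h (map Some y)" using t(2) c by simp_all
      then show ?thesis unfolding delivers_def run by (simp add: Some M(4) tape)
    qed
    then show ?thesis by (rule delivers_mono) (use t(1) in simp)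
  qed
  moreover have "se s < num_symbols M" for s using M(2)[of "Some (Some s)"] by (simp add: ec_def)
  ultimately show thesis using that[OF M(1)] by blast
qed


section \<open>Polynomial-time functions on words over a fixed alphabet\<close>

text \<open>
  A single alphabet serves all generators.  \<open>Entry\<close> stands directly before an input and \<open>Answer\<close> directly
  before an output; \<open>Pad\<close> is padding that will grow and \<open>Filler\<close> is padding that will be removed.  The
  remaining letters describe programs and cells of the universal machine.  The Boolean component of a
  symbol is a mark by which loops count: a symbol is fresh at first (\<open>False\<close>) and burnt later (\<open>True\<close>).
\<close>

datatype instr = Tick | Load | Store | Clear | Rot

datatype letter = Bit bool | Entry | Answer | Pad | Filler | Instr instr | Reg bool | Sep bool

type_synonym sym = "letter \<times> bool"

instance instr :: finite
proof
  have "(UNIV :: instr set) = {Tick, Load, Store, Clear, Rot}" by (auto intro: instr.exhaust)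
  then show "finite (UNIV :: instr set)" by (metis finite.emptyI finite_insert)
qed

instance letter :: finite
proof
  have "(UNIV :: letter set)
      = range Bit \<union> range Instr \<union> range Reg \<union> range Sep \<union> {Entry, Answer, Pad, Filler}"
  proof -
    have "x \<in> range Bit \<union> range Instr \<union> range Reg \<union> range Sep \<union> {Entry, Answer, Pad, Filler}" for x
      by (cases x) auto
    then show ?thesis by blast
  qed
  moreover have "finite (range Bit \<union> range Instr \<union> range Reg \<union> range Sep \<union> {Entry, Answer, Pad, Filler})"
    by simp
  ultimately show "finite (UNIV :: letter set)" by metis
qed

abbreviation bit :: "bool \<Rightarrow> sym" where
  "bit b \<equiv> (Bit b, False)"

abbreviation bits :: "bool list \<Rightarrow> sym list" where
  "bits x \<equiv> map bit x"

text \<open>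
  The bits keep the codes of the input convention, so that a binary word and the corresponding word over
  \<open>sym\<close> are the same tape.
\<close>

definition sym_code :: "sym \<Rightarrow> nat" where
  "sym_code = (SOME e. inj e \<and> 0 \<notin> range e \<and> (\<forall>b. e (bit b) = bit_code b))"

lemma sym_code: "inj sym_code" "0 \<notin> range sym_code" "sym_code (bit b) = bit_code b"
proof -
  obtain g :: "sym \<Rightarrow> nat" where g: "inj g" using finite_inj_nat[of "UNIV :: sym set"] by auto
  define e where "e s = (if s = bit False then 1 else if s = bit True then 2 else 3 + g s)" for s
  have "inj e" using g by (auto simp: e_def inj_def)
  moreover have "0 \<notin> range e" by (auto simp: e_def)
  moreover have "\<forall>b. e (bit b) = bit_code b" by (auto simp: e_def bit_code_def)
  ultimately have "inj sym_code \<and> 0 \<notin> range sym_code \<and> (\<forall>b. sym_code (bit b) = bit_code b)"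
    unfolding sym_code_def
    by (intro someI[of "\<lambda>e. inj e \<and> 0 \<notin> range e \<and> (\<forall>b. e (bit b) = bit_code b)" e] conjI)
  then show "inj sym_code" "0 \<notin> range sym_code" "sym_code (bit b) = bit_code b" by auto
qed

definition polytime :: "(sym list \<rightharpoonup> sym list) \<Rightarrow> bool" where
  "polytime F \<longleftrightarrow> (\<exists>M g. turing_machine M \<and> (\<forall>s. sym_code s < num_symbols M) \<and> poly_bounded g \<and>
     (\<forall>w. delivers M (map sym_code w) (g (length w)) (map_option (map sym_code) (F w))))"

lemma polytime_transducer:
  fixes T :: "('q, sym) transducer"
  assumes T: "finite_states T Q" and b: "poly_bounded b"
    and ex: "\<And>w. \<exists>n\<le>b (length w). exec T (b (length w)) n (init T) w (F w)"
  shows "polytime F"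
proof -
  obtain M where M: "turing_machine M" "\<And>s. sym_code s < num_symbols M"
    "\<And>w L n r. exec T L n (init T) w r \<Longrightarrow>
       delivers M (map sym_code w) (2 * (length w + 1) + 2 + n * ((L + 1) * (4 * L + 5)))
         (map_option (map sym_code) r)"
    using transducer_machine[OF T sym_code(1,2)] by blast
  let ?g = "\<lambda>n. 2 * (n + 1) + 2 + b n * ((b n + 1) * (4 * b n + 5))"
  have "poly_bounded ?g"
    by (intro poly_bounded_add poly_bounded_mult poly_bounded_const poly_bounded_id b)
  moreover have "delivers M (map sym_code w) (?g (length w)) (map_option (map sym_code) (F w))" for w
  proof -
    obtain n where n: "n \<le> b (length w)" "exec T (b (length w)) n (init T) w (F w)"
      using ex by blast
    show ?thesis by (rule delivers_mono[OF M(3)[OF n(2)]]) (use n(1) in simp)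
  qed
  ultimately show ?thesis unfolding polytime_def using M(1,2) by blast
qed

text \<open>
  For a loop it is enough to know that its result has certain properties; the function that it computes
  need not be given explicitly.
\<close>

lemma polytime_transducer_choice:
  fixes T :: "('q, sym) transducer"
  assumes T: "finite_states T Q" and b: "poly_bounded b"
    and ex: "\<And>w. \<exists>r. (\<exists>n\<le>b (length w). exec T (b (length w)) n (init T) w r) \<and> R w r"
  obtains F where "polytime F" "\<And>w. R w (F w)"
proof -
  have "\<exists>F. \<forall>w. (\<exists>n\<le>b (length w). exec T (b (length w)) n (init T) w (F w)) \<and> R w (F w)"
    using ex by (intro choice) blast
  then obtain F where "\<And>w. (\<exists>n\<le>b (length w). exec T (b (length w)) n (init T) w (F w))" "\<And>w. R w (F w)"
    by blast
  with polytime_transducer[OF T b] that show thesis by blast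
qed

lemma polytime_one_pass:
  fixes T :: "('q, sym) transducer"
  assumes T: "finite_states T Q" and b: "poly_bounded b"
    and F: "\<And>w p v. pass T (init T) w = (p, v) \<Longrightarrow>
      length (v @ final_output T p) \<le> b (length w) \<and>
      (verdict T p = Accept \<and> F w = Some (v @ final_output T p) \<or> verdict T p = Reject \<and> F w = None)"
  shows "polytime F"
proof (rule polytime_transducer[OF T])
  show "poly_bounded (\<lambda>n. b n + n + 1)"
    by (intro poly_bounded_add poly_bounded_const poly_bounded_id b)
next
  fix w
  obtain p v where p: "pass T (init T) w = (p, v)" by (cases "pass T (init T) w")
  have "exec T (b (length w) + length w + 1) (Suc 0) (init T) w (F w)"
    using F[OF p] exec_accept[OF p, of "b (length w) + length w + 1"]
      exec_reject[OF p, of "b (length w) + length w + 1"] by auto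
  then show "\<exists>n\<le>b (length w) + length w + 1. exec T (b (length w) + length w + 1) n (init T) w (F w)"
    by (intro exI[of _ "Suc 0"]) simp
qed

text \<open>
  At most one blank cell is filled per step.  Hence the length of an output is bounded by the
  length of the input plus the running time, which bounds the time of a second machine that
  continues with this output.
\<close>

lemma tape_support:
  "finite {i. fst (snd ((step M ^^ t) c)) i \<noteq> 0} \<and>
   card {i. fst (snd ((step M ^^ t) c)) i \<noteq> 0} \<le> card {i. fst (snd c) i \<noteq> 0} + t"
  if "finite {i. fst (snd c) i \<noteq> 0}"
proof (induction t)
  case 0
  then show ?case using that by simp
next
  case (Suc t)
  obtain q tp h where c: "(step M ^^ t) c = (q, tp, h)" by (metis prod_cases3)
  have sub: "{i. fst (snd (step M (q, tp, h))) i \<noteq> 0} \<subseteq> insert h {i. tp i \<noteq> 0}"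
    by (auto split: prod.splits if_splits)
  have fin: "finite {i. tp i \<noteq> 0}" "card {i. tp i \<noteq> 0} \<le> card {i. fst (snd c) i \<noteq> 0} + t"
    using Suc unfolding c by auto
  have "card {i. fst (snd (step M (q, tp, h))) i \<noteq> 0} \<le> card (insert h {i. tp i \<noteq> 0})"
    by (rule card_mono) (use fin sub in auto)
  also have "\<dots> \<le> Suc (card {i. tp i \<noteq> 0})" by (rule card_insert_le_m1) auto
  finally have "card {i. fst (snd (step M (q, tp, h))) i \<noteq> 0} \<le> card {i. fst (snd c) i \<noteq> 0} + Suc t"
    using fin(2) by linarith
  moreover have "finite {i. fst (snd (step M (q, tp, h))) i \<noteq> 0}"
    using sub fin(1) by (meson finite_insert finite_subset)
  ultimately show ?case by (simp add: c)
qed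

lemma delivers_length:
  assumes "delivers M u t (Some v)" "0 \<notin> set v"
  shows "length v \<le> length u + t"
proof -
  obtain q tp h where c: "(step M ^^ t) (0, ntape u, 0) = (q, tp, h)" by (metis prod_cases3)
  have sub: "{i. ntape u i \<noteq> 0} \<subseteq> {0..<int (length u)}" by (auto simp: ntape_def split: if_splits)
  then have fin: "finite {i. ntape u i \<noteq> 0}" by (rule finite_subset) simp
  have "card {i. ntape u i \<noteq> 0} \<le> length u" using card_mono[OF _ sub] by simp
  moreover have "finite {i. tp i \<noteq> 0}" "card {i. tp i \<noteq> 0} \<le> card {i. ntape u i \<noteq> 0} + t"
    using tape_support[where c = "(0, ntape u, 0)" and M = M and t = t] fin c by auto
  moreover have "{h..<h + int (length v)} \<subseteq> {i. tp i \<noteq> 0}"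
  proof
    fix i assume i: "i \<in> {h..<h + int (length v)}"
    have "\<forall>j. tp (h + j) = ntape v j" using assms(1) c by (simp add: delivers_def)
    then have tp: "tp (h + (i - h)) = ntape v (i - h)" by (rule spec)
    have "v ! nat (i - h) \<in> set v" using i by (intro nth_mem) auto
    then have "v ! nat (i - h) \<noteq> 0" using assms(2) by metis
    then show "i \<in> {i. tp i \<noteq> 0}" using tp i by (simp add: ntape_def)
  qed
  ultimately have "card {h..<h + int (length v)} \<le> length u + t"
    by (meson card_mono le_trans add_le_mono1)
  then show ?thesis by simp
qed

lemma polytime_comp:
  assumes "polytime F" "polytime G"
  shows "polytime (G \<circ>\<^sub>m F)"
proof -
  obtain M f where M: "turing_machine M" "\<And>s. sym_code s < num_symbols M" "poly_bounded f"
    "\<And>w. delivers M (map sym_code w) (f (length w)) (map_option (map sym_code) (F w))"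
    using assms(1) unfolding polytime_def by blast
  obtain N g where N: "turing_machine N" "\<And>s. sym_code s < num_symbols N" "poly_bounded g"
    "\<And>w. delivers N (map sym_code w) (g (length w)) (map_option (map sym_code) (G w))"
    using assms(2) unfolding polytime_def by blast
  have "poly_bounded (\<lambda>n. n + f n)" by (intro poly_bounded_add poly_bounded_id M(3))
  from poly_bounded_comp[OF N(3) this]
  obtain h where h: "poly_bounded h" "\<And>n m. m \<le> n + f n \<Longrightarrow> g m \<le> h n" by blast
  have "delivers (seq_tm M N) (map sym_code w) (f (length w) + h (length w))
      (Option.bind (F w) (\<lambda>v. map_option (map sym_code) (G v)))" for w
  proof (rule seq_tm_delivers[OF M(1) N(1) _ M(4)])
    fix v assume v: "F w = Some v"
    have d: "delivers M (map sym_code w) (f (length w)) (Some (map sym_code v))"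
      using M(4)[of w] v by simp
    have "0 \<notin> set (map sym_code v)" using sym_code(2) by auto
    from delivers_length[OF d this] have "g (length v) \<le> h (length w)" by (intro h(2)) simp
    from delivers_mono[OF N(4) this]
    show "(\<forall>s\<in>set (map sym_code v). s < num_symbols N) \<and>
        delivers N (map sym_code v) (h (length w)) (map_option (map sym_code) (G v))" using N(2) by simp
  qed (use M(2) in auto)
  moreover have "Option.bind (F w) (\<lambda>v. map_option (map sym_code) (G v))
      = map_option (map sym_code) ((G \<circ>\<^sub>m F) w)" for w by (cases "F w") simp_all
  ultimately have "delivers (seq_tm M N) (map sym_code w) (f (length w) + h (length w))
      (map_option (map sym_code) ((G \<circ>\<^sub>m F) w))" for w by metis
  moreover have "poly_bounded (\<lambda>n. f n + h n)" by (intro poly_bounded_add M(3) h(1))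
  moreover have "sym_code s < num_symbols (seq_tm M N)" for s
    using M(2)[of s] by (simp add: seq_tm_def)
  ultimately show ?thesis unfolding polytime_def using seq_tm_machine[OF M(1) N(1)] by blast
qed

section \<open>Membership in the monoid\<close>

lemma fP_I:
  assumes M: "turing_machine M" and g: "poly_bounded g"
    and d: "\<And>x. delivers M (map bit_code x) (g (length x)) (map_option (map bit_code) (f x))"
    and bal: "polynomially_balanced f"
  shows "f \<in> fP"
proof -
  obtain k where k: "\<And>n. g n \<le> (n + 2) ^ k" using g unfolding poly_bounded_def by blast
  define p :: "nat poly" where "p = [:2, 1:] ^ k"
  have p: "delivers M (map bit_code x) (poly p (length x)) (map_option (map bit_code) (f x))" for x
    using d by (rule delivers_mono) (use k in \<open>simp add: p_def add.commute\<close>)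
  have c: "config_after M x t = (step M ^^ t) (0, ntape (map bit_code x), 0)" for x t
    by (simp add: config_after_def initial_config_def word_tape_eq)
  have "polynomial_time M"
    unfolding polynomial_time_def c using delivers_halted[OF p] by blast
  moreover have "computes M f"
    unfolding computes_def
  proof
    fix x
    show "case f x of Some y \<Rightarrow> \<exists>t. accepts_with_output (config_after M x t) y
      | None \<Rightarrow> \<exists>t. rejects (config_after M x t)"
    proof (cases "f x")
      case None
      then have "rejects (config_after M x (poly p (length x)))"
        using p[of x] unfolding delivers_def c[symmetric] rejects_def by (auto split: prod.splits)
      then show ?thesis using None by auto
    next
      case (Some y)
      then have "accepts_with_output (config_after M x (poly p (length x))) y"
        using p[of x] unfolding delivers_def c[symmetric] accepts_with_output_def word_tape_eq
        by (simp split: prod.splits)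
      then show ?thesis using Some by auto
    qed
  qed
  ultimately show ?thesis using M bal unfolding fP_def by blast
qed

lemma fP_E:
  assumes "f \<in> fP"
  obtains M g where "turing_machine M" "poly_bounded g"
    "\<And>x. delivers M (map bit_code x) (g (length x)) (map_option (map bit_code) (f x))"
    "polynomially_balanced f"
proof -
  obtain M where M: "turing_machine M" "polynomial_time M" "computes M f" and bal: "polynomially_balanced f"
    using assms unfolding fP_def by blast
  obtain p where p: "\<And>x. halted (config_after M x (poly p (length x)))"
    using M(2) unfolding polynomial_time_def by blast
  have c: "config_after M x t = (step M ^^ t) (0, ntape (map bit_code x), 0)" for x t
    by (simp add: config_after_def initial_config_def word_tape_eq)
  have result: "case f x of Some y \<Rightarrow> \<exists>t. accepts_with_output (config_after M x t) y
      | None \<Rightarrow> \<exists>t. rejects (config_after M x t)" for x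
    using M(3) unfolding computes_def by (rule spec)
  have same: "config_after M x t = config_after M x (poly p (length x))"
    if "halted (config_after M x t)" for x t
    using that p[of x] unfolding c by (metis nle_le steps_mono)
  have "delivers M (map bit_code x) (poly p (length x)) (map_option (map bit_code) (f x))" for x
  proof (cases "f x")
    case None
    then obtain t where t: "rejects (config_after M x t)" using result[of x] by auto
    then have "halted (config_after M x t)" by (simp add: rejects_def halted_def)
    from same[OF this] t have "fst (config_after M x (poly p (length x))) = 2"
      by (simp add: rejects_def)
    then show ?thesis unfolding delivers_def c[symmetric] using None by (auto split: prod.split)
  next
    case (Some y)
    then obtain t where t: "accepts_with_output (config_after M x t) y" using result[of x] by auto
    then have "halted (config_after M x t)"
      by (auto simp: accepts_with_output_def halted_def split: prod.splits)
    from same[OF this] t have "accepts_with_output (config_after M x (poly p (length x))) y"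
      by simp
    then show ?thesis
      unfolding delivers_def c[symmetric] accepts_with_output_def word_tape_eq using Some
      by (simp split: prod.splits)
  qed
  then show thesis using that[OF M(1) poly_bounded_poly _ bal] by blast
qed

lemma fP_of_polytime:
  assumes F: "polytime F" and f: "\<And>x. F (bits x) = map_option bits (f x)"
    and bal: "polynomially_balanced f"
  shows "f \<in> fP"
proof -
  obtain M g where M: "turing_machine M" "poly_bounded g"
    "\<And>w. delivers M (map sym_code w) (g (length w)) (map_option (map sym_code) (F w))"
    using F unfolding polytime_def by blast
  have b: "map sym_code (bits x) = map bit_code x" for x by (simp add: sym_code(3))
  have "map_option (map sym_code) (F (bits x)) = map_option (map bit_code) (f x)" for x
    by (simp add: f option.map_comp comp_def sym_code(3))
  then have "delivers M (map bit_code x) (g (length x)) (map_option (map bit_code) (f x))" for x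
    using M(3)[of "bits x"] unfolding b length_map by simp
  then show ?thesis by (rule fP_I[OF M(1,2) _ bal])
qed

lemma polynomially_balancedI:
  assumes "poly_bounded g" "\<And>x y. f x = Some y \<Longrightarrow> length y \<le> g (length x) \<and> length x \<le> g (length y)"
  shows "polynomially_balanced f"
proof -
  obtain k where k: "\<And>n. g n \<le> (n + 2) ^ k" using assms(1) unfolding poly_bounded_def by blast
  have "length y \<le> poly ([:2, 1:] ^ k) (length x) \<and> length x \<le> poly ([:2, 1:] ^ k) (length y)"
    if "f x = Some y" for x y
    using assms(2)[OF that] k[of "length x"] k[of "length y"] by (auto simp: add.commute intro: order_trans)
  then show ?thesis unfolding polynomially_balanced_def by blast
qed

lemma polynomially_balancedE:
  assumes "polynomially_balanced f"
  obtains g where "poly_bounded g"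
    "\<And>x y. f x = Some y \<Longrightarrow> length y \<le> g (length x) \<and> length x \<le> g (length y)"
proof -
  obtain p q where "\<And>x y. f x = Some y \<Longrightarrow> length y \<le> poly p (length x) \<and> length x \<le> poly q (length y)"
    using assms unfolding polynomially_balanced_def by blast
  then show thesis using that[of "\<lambda>n. poly p n + poly q n"] poly_bounded_add[OF poly_bounded_poly poly_bounded_poly]
    by (metis trans_le_add1 trans_le_add2)
qed

lemma fP_one: "Some \<in> fP"
proof -
  define M where "M = \<lparr>num_states = 3, num_symbols = 3, trans = (\<lambda>q s. (1, s, Stationary))\<rparr>"
  have tm: "turing_machine M" by (rule turing_machineI) (auto simp: M_def)
  show ?thesis
  proof (rule fP_I[OF tm poly_bounded_const[of 1]])
    fix x show "delivers M (map bit_code x) 1 (map_option (map bit_code) (Some x))"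
      by (simp add: delivers_def M_def halted_def)
  next
    show "polynomially_balanced Some"
      by (rule polynomially_balancedI[OF poly_bounded_id]) simp
  qed
qed

lemma fP_comp:
  assumes "f \<in> fP" "g \<in> fP"
  shows "g \<circ>\<^sub>m f \<in> fP"
proof -
  obtain M a where M: "turing_machine M" "poly_bounded a"
    "\<And>x. delivers M (map bit_code x) (a (length x)) (map_option (map bit_code) (f x))"
    "polynomially_balanced f" using fP_E[OF assms(1)] by blast
  obtain N b where N: "turing_machine N" "poly_bounded b"
    "\<And>x. delivers N (map bit_code x) (b (length x)) (map_option (map bit_code) (g x))"
    "polynomially_balanced g" using fP_E[OF assms(2)] by blast
  obtain c where c: "poly_bounded c"
    "\<And>x y. f x = Some y \<Longrightarrow> length y \<le> c (length x) \<and> length x \<le> c (length y)"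
    using polynomially_balancedE[OF M(4)] by blast
  obtain d where d: "poly_bounded d"
    "\<And>x y. g x = Some y \<Longrightarrow> length y \<le> d (length x) \<and> length x \<le> d (length y)"
    using polynomially_balancedE[OF N(4)] by blast
  obtain h where h: "poly_bounded h" "\<And>n m. m \<le> c n \<Longrightarrow> b m \<le> h n"
    using poly_bounded_comp[OF N(2) c(1)] by blast
  obtain e1 where e1: "poly_bounded e1" "\<And>n m. m \<le> c n \<Longrightarrow> d m \<le> e1 n"
    using poly_bounded_comp[OF d(1) c(1)] by blast
  obtain e2 where e2: "poly_bounded e2" "\<And>n m. m \<le> d n \<Longrightarrow> c m \<le> e2 n"
    using poly_bounded_comp[OF c(1) d(1)] by blast
  have code: "bit_code z < num_symbols M" "bit_code z < num_symbols N" for z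
    using turing_machineD(2)[OF M(1)] turing_machineD(2)[OF N(1)] by (auto simp: bit_code_def)
  have "delivers (seq_tm M N) (map bit_code x) (a (length x) + h (length x))
      (Option.bind (f x) (\<lambda>y. map_option (map bit_code) (g y)))" for x
  proof (rule seq_tm_delivers[OF M(1) N(1) _ M(3)])
    fix y assume "f x = Some y"
    then have "b (length y) \<le> h (length x)" using c(2) by (intro h(2)) simp
    from delivers_mono[OF N(3) this]
    show "(\<forall>s\<in>set (map bit_code y). s < num_symbols N) \<and>
        delivers N (map bit_code y) (h (length x)) (map_option (map bit_code) (g y))" using code by simp
  qed (use code in auto)
  moreover have "Option.bind (f x) (\<lambda>y. map_option (map bit_code) (g y))
      = map_option (map bit_code) ((g \<circ>\<^sub>m f) x)" for x by (cases "f x") simp_all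
  ultimately have "delivers (seq_tm M N) (map bit_code x) (a (length x) + h (length x))
      (map_option (map bit_code) ((g \<circ>\<^sub>m f) x))" for x by metis
  moreover have "polynomially_balanced (g \<circ>\<^sub>m f)"
  proof (rule polynomially_balancedI)
    show "poly_bounded (\<lambda>n. e1 n + e2 n)" by (intro poly_bounded_add e1(1) e2(1))
  next
    fix x z assume "(g \<circ>\<^sub>m f) x = Some z"
    then obtain y where y: "f x = Some y" "g y = Some z" by (auto simp: map_comp_Some_iff)
    have "length z \<le> e1 (length x)" using c(2)[OF y(1)] d(2)[OF y(2)] e1(2) by (meson le_trans)
    moreover have "length x \<le> e2 (length z)" using c(2)[OF y(1)] d(2)[OF y(2)] e2(2) by (meson le_trans)
    ultimately show "length z \<le> e1 (length x) + e2 (length x) \<and> length x \<le> e1 (length z) + e2 (length z)"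
      by simp
  qed
  ultimately show ?thesis
    by (intro fP_I[OF seq_tm_machine[OF M(1) N(1)] poly_bounded_add[OF M(2) h(1)]])
qed

lemma fP_monoid: "monoid fP_monoid"
proof
  fix f g h
  show "(f \<otimes>\<^bsub>fP_monoid\<^esub> g) \<otimes>\<^bsub>fP_monoid\<^esub> h = f \<otimes>\<^bsub>fP_monoid\<^esub> (g \<otimes>\<^bsub>fP_monoid\<^esub> h)"
    by (auto simp: fP_monoid_def map_comp_def fun_eq_iff split: option.split)
next
  fix f g
  assume "f \<in> carrier fP_monoid" "g \<in> carrier fP_monoid"
  then show "f \<otimes>\<^bsub>fP_monoid\<^esub> g \<in> carrier fP_monoid"
    by (simp add: fP_monoid_def fP_comp)
qed (auto simp: fP_monoid_def fP_one map_comp_def fun_eq_iff split: option.split)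

section \<open>Words over the alphabet as binary words\<close>

definition all_syms :: "sym list" where
  "all_syms = (SOME xs. set xs = UNIV \<and> distinct xs)"

lemma all_syms: "set all_syms = UNIV"
proof -
  have "\<exists>xs :: sym list. set xs = UNIV \<and> distinct xs"
    using finite_distinct_list[of "UNIV :: sym set"] by auto
  then show ?thesis unfolding all_syms_def by (rule someI2_ex) simp
qed

text \<open>
  The code of a letter is its indicator function on a list of all letters: an injective code of
  constant length.
\<close>

definition block :: "sym \<Rightarrow> bool list" where
  "block s = map (\<lambda>t. t = s) all_syms"

lemma block_inj: "block s = block t \<longleftrightarrow> s = t"
proof
  assume "block s = block t"
  then have "\<forall>u\<in>set all_syms. (u = s) = (u = t)" by (simp add: block_def)
  then show "s = t" using all_syms by blast
qed simp

definition width :: nat where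
  "width = length all_syms"

lemma length_block [simp]: "length (block s) = width"
  by (simp add: block_def width_def)

lemma width_pos: "width > 0"
  using all_syms by (auto simp: width_def)

lemma block_nonempty [simp]: "block s \<noteq> []"
  using width_pos length_block[of s] by (metis less_irrefl list.size(3))

definition spell :: "sym list \<Rightarrow> bool list" where
  "spell w = concat (map block w)"

lemma spell_simps [simp]: "spell [] = []" "spell (s # w) = block s @ spell w"
  by (simp_all add: spell_def)

lemma length_spell: "length (spell w) = width * length w"
  by (induction w) auto

lemma spell_inj: "spell v = spell w \<longleftrightarrow> v = w"
proof (induction v arbitrary: w)
  case Nil
  then show ?case by (cases w) simp_all
next
  case (Cons s v)
  then show ?case by (cases w) (simp_all add: block_inj)
qed

definition unspell :: "bool list \<Rightarrow> sym list option" where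
  "unspell x = (if x \<in> range spell then Some (inv_into UNIV spell x) else None)"

lemma unspell_eq: "unspell x = Some w \<longleftrightarrow> x = spell w"
proof
  assume "unspell x = Some w"
  then have "x \<in> range spell" "w = inv_into UNIV spell x" by (simp_all add: unspell_def split: if_splits)
  then show "x = spell w" by (simp add: f_inv_into_f)
next
  assume x: "x = spell w"
  have "inj spell" by (simp add: inj_def spell_inj)
  then show "unspell x = Some w" by (simp add: unspell_def x)
qed

lemma unspell_spell [simp]: "unspell (spell w) = Some w"
  by (simp add: unspell_eq)

subsection \<open>Homomorphisms, deletion of the first letter, decoding\<close>

definition hom_transducer :: "sym list \<Rightarrow> (sym \<Rightarrow> sym list) \<Rightarrow> sym list \<Rightarrow> (bool, sym) transducer" where
  "hom_transducer u h v = \<lparr>init = False,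
     move = (\<lambda>q s. (True, if q then h s else u @ h s)),
     final_output = (\<lambda>q. if q then v else u @ v),
     verdict = (\<lambda>_. Accept)\<rparr>"

lemma hom_length_bound:
  fixes h :: "sym \<Rightarrow> sym list"
  obtains B where "\<And>w. length (concat (map h w)) \<le> B * length w"
proof -
  define B where "B = (\<Sum>s\<in>UNIV. length (h s))"
  have "length (h s) \<le> B" for s unfolding B_def by (rule member_le_sum) auto
  then have "length (concat (map h w)) \<le> B * length w" for w
    by (induction w) (auto simp: add_mono)
  then show thesis by (rule that)
qed

lemma polytime_hom: "polytime (\<lambda>w. Some (u @ concat (map h w) @ v))"
proof -
  let ?T = "hom_transducer u h v"
  obtain B where B: "\<And>w. length (concat (map h w)) \<le> B * length w"
    using hom_length_bound[of h] by blast
  have p: "pass ?T True w = (True, concat (map h w))" for w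
    by (induction w) (simp_all add: hom_transducer_def)
  have "pass ?T False w = (w \<noteq> [], if w = [] then [] else u @ concat (map h w))" for w
    using p by (cases w) (simp_all add: hom_transducer_def)
  note pass = this
  show ?thesis
  proof (rule polytime_one_pass[of ?T UNIV])
    show "finite_states ?T UNIV" by (simp add: finite_states_def)
    show "poly_bounded (\<lambda>n. length u + B * n + length v)"
      by (intro poly_bounded_add poly_bounded_mult poly_bounded_const poly_bounded_id)
  next
    fix w p v' assume "pass ?T (init ?T) w = (p, v')"
    then have "pass ?T False w = (p, v')" by (simp add: hom_transducer_def)
    then have "p = (w \<noteq> [])" "v' = (if w = [] then [] else u @ concat (map h w))"
      unfolding pass by auto
    moreover have "final_output ?T q = (if q then v else u @ v)" "verdict ?T q = Accept" for q
      by (simp_all add: hom_transducer_def)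
    ultimately show "length (v' @ final_output ?T p) \<le> length u + B * length w + length v \<and>
      (verdict ?T p = Accept \<and> Some (u @ concat (map h w) @ v) = Some (v' @ final_output ?T p) \<or>
       verdict ?T p = Reject \<and> Some (u @ concat (map h w) @ v) = None)"
      using B[of w] by auto
  qed
qed

fun drop_first :: "(sym \<Rightarrow> bool) \<Rightarrow> sym set \<Rightarrow> sym list \<Rightarrow> sym list option" where
  "drop_first P S [] = None"
| "drop_first P S (s # w) = (if P s \<and> set w \<subseteq> S then Some w else None)"

definition drop_transducer :: "(sym \<Rightarrow> bool) \<Rightarrow> sym set \<Rightarrow> (bool option, sym) transducer" where
  "drop_transducer P S = \<lparr>init = None,
     move = (\<lambda>q s. case q of None \<Rightarrow> (Some (P s), []) | Some b \<Rightarrow> (Some (b \<and> s \<in> S), [s])),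
     final_output = (\<lambda>_. []),
     verdict = (\<lambda>q. if q = Some True then Accept else Reject)\<rparr>"

lemma polytime_drop_first: "polytime (drop_first P S)"
proof -
  let ?T = "drop_transducer P S"
  have p: "pass ?T (Some b) w = (Some (b \<and> set w \<subseteq> S), w)" for w b
    by (induction w arbitrary: b) (auto simp: drop_transducer_def)
  show ?thesis
  proof (rule polytime_one_pass[of ?T UNIV])
    show "finite_states ?T UNIV" by (simp add: finite_states_def)
    show "poly_bounded (\<lambda>n. n)" by (rule poly_bounded_id)
  next
    fix w p v' assume pv: "pass ?T (init ?T) w = (p, v')"
    show "length (v' @ final_output ?T p) \<le> length w \<and>
      (verdict ?T p = Accept \<and> drop_first P S w = Some (v' @ final_output ?T p) \<or>
       verdict ?T p = Reject \<and> drop_first P S w = None)"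
    proof (cases w)
      case Nil
      then show ?thesis using pv by (auto simp: drop_transducer_def)
    next
      case (Cons s z)
      have "move ?T (init ?T) s = (Some (P s), [])" by (simp add: drop_transducer_def)
      then have "p = Some (P s \<and> set z \<subseteq> S)" "v' = z" using pv by (auto simp: Cons p)
      then show ?thesis by (auto simp: Cons drop_transducer_def)
    qed
  qed
qed

text \<open>
  The decoder keeps the beginning of an unfinished block in its state, and fails on everything
  that is not a sequence of complete blocks.
\<close>

definition decode_transducer :: "(sym list option, sym) transducer" where
  "decode_transducer = \<lparr>init = Some [],
     move = (\<lambda>q s. case q of None \<Rightarrow> (None, [])
       | Some z \<Rightarrow> if length z + 1 < width then (Some (z @ [s]), [])
           else if z @ [s] \<in> range (bits \<circ> block) then (Some [], [inv_into UNIV (bits \<circ> block) (z @ [s])])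
           else (None, [])),
     final_output = (\<lambda>_. []),
     verdict = (\<lambda>q. if q = Some [] then Accept else Reject)\<rparr>"

lemma decode_buffer:
  "length z + length u < width \<Longrightarrow>
     pass decode_transducer (Some z) (u @ w) = pass decode_transducer (Some (z @ u)) w"
  by (induction u arbitrary: z) (simp_all add: decode_transducer_def)

lemma bits_inj: "bits x = bits y \<longleftrightarrow> x = y"
proof -
  have "inj bit" by (rule injI) simp
  then show ?thesis by (rule inj_map_eq_map)
qed

lemma decode_block: "pass decode_transducer (Some []) (bits (block s) @ w) =
    (let (p, v) = pass decode_transducer (Some []) w in (p, s # v))"
proof -
  have "bits (block s) \<noteq> []" by simp
  then obtain z c where z: "bits (block s) = z @ [c]" by (metis rev_exhaust)
  have "length (bits (block s)) = width" by simp
  then have len: "length z + 1 = width" unfolding z by simp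
  have "inj (bits \<circ> block)" by (rule injI) (simp only: comp_apply bits_inj block_inj)
  then have "inv_into UNIV (bits \<circ> block) ((bits \<circ> block) s) = s" by (intro inv_into_f_f) simp_all
  moreover have "(bits \<circ> block) s = z @ [c]" unfolding comp_apply z ..
  moreover have "(bits \<circ> block) s \<in> range (bits \<circ> block)" by (rule rangeI)
  ultimately have "inv_into UNIV (bits \<circ> block) (z @ [c]) = s" "z @ [c] \<in> range (bits \<circ> block)" by simp_all
  then have "move decode_transducer (Some z) c = (Some [], [s])"
    using len by (simp add: decode_transducer_def)
  moreover have "pass decode_transducer (Some []) (z @ c # w) = pass decode_transducer (Some z) (c # w)"
    using decode_buffer[of "[]" z "c # w"] len by simp
  ultimately show ?thesis by (simp add: z split: prod.split)
qed

lemma decode_fail: "pass decode_transducer None w = (None, [])"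
  by (induction w) (simp_all add: decode_transducer_def)

lemma decode_bad:
  assumes "length u = width" "u \<notin> range (bits \<circ> block)"
  shows "pass decode_transducer (Some []) (u @ w) = (None, [])"
proof -
  have "u \<noteq> []" using width_pos assms(1) by auto
  then obtain z c where z: "u = z @ [c]" by (metis rev_exhaust)
  then have len: "length z + 1 = width" using assms(1) by simp
  have "move decode_transducer (Some z) c = (None, [])"
    using len assms(2) z by (simp add: decode_transducer_def)
  moreover have "pass decode_transducer (Some []) (z @ c # w) = pass decode_transducer (Some z) (c # w)"
    using decode_buffer[of "[]" z "c # w"] len by simp
  ultimately show ?thesis by (simp add: z decode_fail)
qed

definition decode :: "sym list \<Rightarrow> sym list option" where
  "decode u = (if \<exists>w. u = bits (spell w) then Some (THE w. u = bits (spell w)) else None)"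

lemma decode_eq: "decode u = Some w \<longleftrightarrow> u = bits (spell w)"
  by (auto simp: decode_def bits_inj spell_inj)

lemma decode_pass:
  "pass decode_transducer (Some []) u = (p, v) \<Longrightarrow>
     length v \<le> length u \<and> (p = Some [] \<and> decode u = Some v \<or> p \<noteq> Some [] \<and> decode u = None)"
proof (induction "length u" arbitrary: u p v rule: less_induct)
  case less
  show ?case
  proof (cases "length u < width")
    case True
    then have p: "p = Some u" "v = []"
      using less.prems decode_buffer[of "[]" u "[]"] by simp_all
    show ?thesis
    proof (cases u)
      case Nil
      then show ?thesis using p decode_eq[of "[]" "[]"] by simp
    next
      case (Cons a u')
      have "decode u \<noteq> Some w" for w
      proof
        assume "decode u = Some w"
        then have w: "u = bits (spell w)" by (simp add: decode_eq)
        then have "length u = width * length w" by (simp add: length_spell)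
        moreover have "w \<noteq> []" using w Cons by auto
        then have "width * 1 \<le> width * length w" by (intro mult_le_mono2) (simp add: Suc_leI)
        ultimately show False using True by simp
      qed
      then show ?thesis using p Cons by auto
    qed
  next
    case False
    define b r where "b = take width u" and "r = drop width u"
    have u: "u = b @ r" "length b = width" using False by (simp_all add: b_def r_def)
    show ?thesis
    proof (cases "b \<in> range (bits \<circ> block)")
      case in_range: True
      then obtain s where s: "b = bits (block s)" by auto
      obtain v' where v': "pass decode_transducer (Some []) r = (p, v')" "v = s # v'"
        using less.prems unfolding u(1) s decode_block by (auto split: prod.splits)
      have lt: "length r < length u" using u width_pos by simp
      have eq: "decode u = Some (s # w) \<longleftrightarrow> decode r = Some w" for w
        by (simp add: decode_eq u(1) s)
      have none: "decode u = None" if "decode r = None"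
      proof (rule ccontr)
        assume "decode u \<noteq> None"
        then obtain w where w: "u = bits (spell w)" by (auto simp: decode_eq)
        obtain t w' where "w = t # w'" using w False width_pos by (cases w) simp_all
        then have "b @ r = bits (block t) @ bits (spell w')" using w u(1) by simp
        then have "r = bits (spell w')" using u(2) by simp
        then show False using that decode_eq[of r w'] by simp
      qed
      have IH: "length v' \<le> length r \<and> (p = Some [] \<and> decode r = Some v' \<or> p \<noteq> Some [] \<and> decode r = None)"
        by (rule less.hyps[OF lt v'(1)])
      then have len: "length v \<le> length u" using v'(2) lt by simp
      from IH have "p = Some [] \<and> decode u = Some v \<or> p \<noteq> Some [] \<and> decode u = None"
        using eq[of v'] none unfolding v'(2) by blast
      with len show ?thesis by blast
    next
      case not_block: False
      then have p: "p = None" "v = []" using decode_bad[OF u(2) not_block, of r] less.prems u(1) by simp_all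
      have "decode u \<noteq> Some w" for w
      proof
        assume "decode u = Some w"
        then have w: "u = bits (spell w)" by (simp add: decode_eq)
        obtain t w' where "w = t # w'" using w False width_pos by (cases w) simp_all
        then have "b @ r = bits (block t) @ bits (spell w')" using w u(1) by simp
        then have "b = bits (block t)" using u(2) by simp
        then show False using not_block by simp
      qed
      then show ?thesis using p by auto
    qed
  qed
qed

lemma polytime_decode: "polytime decode"
proof (rule polytime_one_pass)
  let ?Q = "insert None (Some ` {z :: sym list. length z \<le> width})"
  have "finite {z :: sym list. length z \<le> width}"
    using finite_lists_length_le[of "UNIV :: sym set" width] by simp
  then show "finite_states decode_transducer ?Q"
    by (auto simp: finite_states_def decode_transducer_def split: option.split)
  show "poly_bounded (\<lambda>n. n)" by (rule poly_bounded_id)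
next
  fix w p v assume "pass decode_transducer (init decode_transducer) w = (p, v)"
  then have "pass decode_transducer (Some []) w = (p, v)" by (simp add: decode_transducer_def)
  from decode_pass[OF this]
  show "length (v @ final_output decode_transducer p) \<le> length w \<and>
     (verdict decode_transducer p = Accept \<and> decode w = Some (v @ final_output decode_transducer p) \<or>
      verdict decode_transducer p = Reject \<and> decode w = None)"
    by (auto simp: decode_transducer_def)
qed

subsection \<open>Binary versions\<close>

text \<open>
  On a binary word that codes no word over \<open>sym\<close> the binary version is undefined, so that its balance
  has to be established for codes only.
\<close>

definition binary :: "(sym list \<rightharpoonup> sym list) \<Rightarrow> (bool list \<rightharpoonup> bool list)" where
  "binary F = map_option spell \<circ> (F \<circ>\<^sub>m unspell)"

lemma binary_spell [simp]: "binary F (spell w) = map_option spell (F w)"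
  by (simp add: binary_def)

lemma bits_spell: "concat (map (\<lambda>s. bits (block s)) w) = bits (spell w)"
  by (induction w) simp_all

text \<open>
  Binary codes are longer than the coded words by a constant factor; monotonicity of the bound allows
  to pass from one length to the other.
\<close>

definition word_balanced :: "(sym list \<rightharpoonup> sym list) \<Rightarrow> bool" where
  "word_balanced F \<longleftrightarrow> (\<exists>g. poly_bounded g \<and> mono g \<and>
     (\<forall>w v. F w = Some v \<longrightarrow> length v \<le> g (length w) \<and> length w \<le> g (length v)))"

lemma binary_fP:
  assumes F: "polytime F" and bal: "word_balanced F"
  shows "binary F \<in> fP"
proof -
  let ?e = "\<lambda>w. Some ([] @ concat (map (\<lambda>s. bits (block s)) w) @ [])"
  have pt: "polytime (?e \<circ>\<^sub>m (F \<circ>\<^sub>m decode))"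
    by (intro polytime_comp polytime_hom F polytime_decode)
  have eq: "(?e \<circ>\<^sub>m (F \<circ>\<^sub>m decode)) (bits x) = map_option bits (binary F x)" for x
  proof (cases "unspell x")
    case None
    have "decode (bits x) = None"
    proof (rule ccontr)
      assume "decode (bits x) \<noteq> None"
      then obtain w where "x = spell w" by (auto simp: decode_eq bits_inj)
      then show False using None by simp
    qed
    then show ?thesis using None by (simp add: binary_def map_comp_def)
  next
    case (Some w)
    then have "decode (bits x) = Some w" by (simp add: decode_eq unspell_eq)
    then show ?thesis using Some by (auto simp: binary_def map_comp_def bits_spell split: option.split)
  qed
  obtain g where g: "poly_bounded g" "mono g"
    "\<And>w v. F w = Some v \<Longrightarrow> length v \<le> g (length w) \<and> length w \<le> g (length v)"
    using bal unfolding word_balanced_def by blast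
  have "polynomially_balanced (binary F)"
  proof (rule polynomially_balancedI)
    show "poly_bounded (\<lambda>n. width * g n)" by (intro poly_bounded_mult poly_bounded_const g(1))
  next
    fix x y assume "binary F x = Some y"
    then obtain w v where w: "x = spell w" "F w = Some v" "y = spell v"
      by (auto simp: binary_def map_comp_Some_iff unspell_eq)
    have "n \<le> width * n" for n using width_pos by simp
    then have m: "g n \<le> g (width * n)" for n using g(2) by (simp add: monoD)
    have "length v \<le> g (width * length w)" "length w \<le> g (width * length v)"
      using g(3)[OF w(2)] m le_trans by blast+
    then show "length y \<le> width * g (length x) \<and> length x \<le> width * g (length y)"
      by (simp add: w length_spell)
  qed
  with fP_of_polytime[OF pt eq] show ?thesis .
qed

definition input_map :: "bool list \<rightharpoonup> bool list" where
  "input_map x = Some (spell ([(Pad, False), (Entry, False)] @ bits x @ [(Pad, False)]))"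

lemma input_map_fP: "input_map \<in> fP"
proof -
  let ?F = "\<lambda>w. Some ([(Pad, False), (Entry, False)] @ concat (map (\<lambda>s. [s]) w) @ [(Pad, False)])"
  let ?e = "\<lambda>w. Some ([] @ concat (map (\<lambda>s. bits (block s)) w) @ [])"
  have pt: "polytime (?e \<circ>\<^sub>m ?F)" by (intro polytime_comp polytime_hom)
  have single: "concat (map (\<lambda>s. [s]) w) = w" for w :: "sym list" by (induction w) simp_all
  have eq: "(?e \<circ>\<^sub>m ?F) (bits x) = map_option bits (input_map x)" for x
    using bits_spell[of "[(Pad, False), (Entry, False)] @ bits x @ [(Pad, False)]"]
    by (simp add: input_map_def single)
  have "polynomially_balanced input_map"
  proof (rule polynomially_balancedI)
    show "poly_bounded (\<lambda>n. width * (n + 3))"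
      by (intro poly_bounded_mult poly_bounded_add poly_bounded_const poly_bounded_id)
  next
    fix x y assume "input_map x = Some y"
    then have "length y = width * (length x + 3)" by (auto simp: input_map_def length_spell algebra_simps)
    moreover have "n \<le> width * n" for n using width_pos by simp
    ultimately show "length y \<le> width * (length x + 3) \<and> length x \<le> width * (length y + 3)"
      by (metis add.commute le_add2 le_trans order_refl)
  qed
  with fP_of_polytime[OF pt eq] show ?thesis .
qed

definition output_map :: "bool list \<rightharpoonup> bool list" where
  "output_map x = (if \<exists>y. x = spell ((Answer, False) # bits y)
     then Some (THE y. x = spell ((Answer, False) # bits y)) else None)"

lemma output_map_eq: "output_map x = Some y \<longleftrightarrow> x = spell ((Answer, False) # bits y)"
  unfolding output_map_def by (auto simp only: spell_inj list.inject bits_inj the_equality split: if_splits)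

lemma output_map_fP: "output_map \<in> fP"
proof -
  let ?F = "drop_first (\<lambda>s. s = (Answer, False)) (range bit)"
  have pt: "polytime (?F \<circ>\<^sub>m decode)" by (intro polytime_comp polytime_drop_first polytime_decode)
  have eq: "(?F \<circ>\<^sub>m decode) (bits x) = map_option bits (output_map x)" for x
  proof (cases "output_map x")
    case None
    have "(?F \<circ>\<^sub>m decode) (bits x) \<noteq> Some v" for v
    proof
      assume "(?F \<circ>\<^sub>m decode) (bits x) = Some v"
      then obtain w where w: "bits x = bits (spell w)" "?F w = Some v"
        by (auto simp: map_comp_Some_iff decode_eq)
      then obtain z where z: "w = (Answer, False) # z" "set z \<subseteq> range bit"
        by (cases w) (auto split: if_splits)
      have "z \<in> lists (range bit)" using z(2) by (auto simp: in_lists_conv_set)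
      then obtain y where "z = bits y" unfolding lists_image by auto
      then have "bits x = bits (spell ((Answer, False) # bits y))" using w(1) z(1) by (simp only:)
      then have "output_map x = Some y" unfolding output_map_eq bits_inj .
      then show False using None by simp
    qed
    then show ?thesis using None by auto
  next
    case (Some y)
    then have "decode (bits x) = Some ((Answer, False) # bits y)" by (simp add: decode_eq output_map_eq)
    then show ?thesis using Some by auto
  qed
  have "polynomially_balanced output_map"
  proof (rule polynomially_balancedI)
    show "poly_bounded (\<lambda>n. width * (n + 1))"
      by (intro poly_bounded_mult poly_bounded_add poly_bounded_const poly_bounded_id)
  next
    fix x y assume "output_map x = Some y"
    then have "length x = width * (length y + 1)" by (simp add: output_map_eq length_spell)
    moreover have "n \<le> width * n" for n using width_pos by simp
    ultimately show "length y \<le> width * (length x + 1) \<and> length x \<le> width * (length y + 1)"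
      by (metis add.commute le_add2 le_trans order_refl)
  qed
  with fP_of_polytime[OF pt eq] show ?thesis .
qed


section \<open>Padding: expansion and contraction\<close>

definition fresh_word :: "letter list \<Rightarrow> sym list" where
  "fresh_word bs = map (\<lambda>b. (b, False)) bs"

abbreviation all_fresh :: "sym list \<Rightarrow> bool" where
  "all_fresh w \<equiv> list_all (\<lambda>s. \<not> snd s) w"

definition fresh_count :: "sym list \<Rightarrow> nat" where
  "fresh_count w = length (filter (\<lambda>s. \<not> snd s) w)"

subsection \<open>Expansion\<close>

text \<open>
  Each pass burns one fresh letter and adds one filler behind every letter \<open>Pad\<close>.  The fillers are
  added in burnt form, hence the number of passes is the number of letters that were fresh initially,
  plus one pass that finds no fresh letter any more.  The final pass turns the fillers into letters
  \<open>Pad\<close>.  If the whole word was fresh, their number has been multiplied by more than its length.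
\<close>

datatype expand_state = Search | Found | Finish

definition expand_transducer :: "(expand_state, sym) transducer" where
  "expand_transducer = \<lparr>init = Search,
     move = (\<lambda>q (s, f). case q of
         Search \<Rightarrow> (if f then Search else Found, (s, True) # (if s = Pad then [(Filler, True)] else []))
       | Found \<Rightarrow> (Found, (s, f) # (if s = Pad then [(Filler, True)] else []))
       | Finish \<Rightarrow> (Finish, [(if s = Filler then Pad else s, False)])),
     final_output = (\<lambda>_. []),
     verdict = (\<lambda>q. case q of Search \<Rightarrow> Again Finish | Found \<Rightarrow> Again Search | Finish \<Rightarrow> Accept)\<rparr>"

definition add_fillers :: "letter list \<Rightarrow> letter list" where
  "add_fillers bs = concat (map (\<lambda>b. if b = Pad then [Pad, Filler] else [b]) bs)"

definition expansion :: "nat \<Rightarrow> letter list \<Rightarrow> letter list" where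
  "expansion k bs = concat (map (\<lambda>b. if b = Pad then replicate (k + 1) Pad
     else if b = Filler then [Pad] else [b]) bs)"

text \<open>
  A letter \<open>Pad\<close> collects one filler per pass, and fillers are not multiplied.
\<close>

lemma add_fillers_iter:
  "map (\<lambda>b. if b = Filler then Pad else b) ((add_fillers ^^ k) bs) = expansion k bs"
proof (induction k arbitrary: bs)
  case 0
  show ?case by (induction bs) (auto simp: expansion_def)
next
  case (Suc k)
  have "expansion k (add_fillers bs) = expansion (Suc k) bs"
    by (induction bs) (auto simp: expansion_def add_fillers_def replicate_append_same)
  then show ?case using Suc.IH[of "add_fillers bs"] by (simp add: funpow_swap1)
qed

lemma expansion_length: "length bs \<le> length (expansion k bs)" "length (expansion k bs) \<le> (k + 1) * length bs"
  by (induction bs) (auto simp: expansion_def)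

lemma add_fillers_length: "length bs \<le> length (add_fillers bs)"
  by (induction bs) (auto simp: add_fillers_def)

lemma expand_found_pass:
  "pass expand_transducer Found w = (p, v) \<Longrightarrow>
     p = Found \<and> map fst v = add_fillers (map fst w) \<and> fresh_count v = fresh_count w"
  by (induction w arbitrary: v)
    (auto simp: expand_transducer_def add_fillers_def fresh_count_def split: prod.splits)

lemma expand_search_pass:
  "pass expand_transducer Search w = (p, v) \<Longrightarrow>
     p = (if fresh_count w = 0 then Search else Found) \<and>
     map fst v = add_fillers (map fst w) \<and> fresh_count v = fresh_count w - 1"
proof (induction w arbitrary: v)
  case Nil
  then show ?case by (simp add: fresh_count_def add_fillers_def)
next
  case (Cons a w)
  obtain s f where a: "a = (s, f)" by (cases a)
  let ?q = "if f then Search else Found"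
  obtain p' v' where v': "pass expand_transducer ?q w = (p', v')" by (cases "pass expand_transducer ?q w")
  have pv: "p = p'" "v = (s, True) # (if s = Pad then [(Filler, True)] else []) @ v'"
    using Cons.prems v' by (simp_all add: a expand_transducer_def)
  show ?case
  proof (cases f)
    case True
    then show ?thesis using Cons.IH[of v'] v' pv by (auto simp: a add_fillers_def fresh_count_def)
  next
    case False
    then show ?thesis using expand_found_pass[of w p' v'] v' pv
      by (auto simp: a add_fillers_def fresh_count_def)
  qed
qed

lemma expand_finish_pass:
  "pass expand_transducer Finish w = (Finish, fresh_word (map (\<lambda>b. if b = Filler then Pad else b) (map fst w)))"
  by (induction w) (auto simp: expand_transducer_def fresh_word_def split: prod.splits)

lemma expand_simps [simp]:
  "init expand_transducer = Search" "final_output expand_transducer q = []"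
  "verdict expand_transducer Search = Again Finish" "verdict expand_transducer Found = Again Search"
  "verdict expand_transducer Finish = Accept"
  by (simp_all add: expand_transducer_def)

lemma expand_exec:
  "length (expansion (fresh_count w + 1) (map fst w)) \<le> L \<Longrightarrow>
     exec expand_transducer L (fresh_count w + 2) Search w
       (Some (fresh_word (expansion (fresh_count w + 1) (map fst w))))"
proof (induction "fresh_count w" arbitrary: w)
  case 0
  obtain p v where pv: "pass expand_transducer Search w = (p, v)" by (cases "pass expand_transducer Search w")
  then have p: "p = Search" "map fst v = add_fillers (map fst w)"
    using expand_search_pass[OF pv] 0(1) by simp_all
  have e: "map (\<lambda>b. if b = Filler then Pad else b) (add_fillers (map fst w)) = expansion 1 (map fst w)"
    using add_fillers_iter[of 1 "map fst w"] by simp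
  have len: "length v = length (expansion 1 (map fst w))"
    using arg_cong[OF e, of length] p(2) by (metis length_map)
  have L: "length v \<le> L" using 0 len by simp
  have "length w \<le> L" using expansion_length(1)[of "map fst w" 1] 0 by simp
  have fin: "pass expand_transducer Finish v = (Finish, fresh_word (expansion 1 (map fst w)))"
    using expand_finish_pass[of v] p(2) e by simp
  have "exec expand_transducer L (Suc 0) Finish v (Some (fresh_word (expansion 1 (map fst w))))"
    using exec_accept[OF fin, of L] L len by (simp add: fresh_word_def)
  then show ?case
    using exec_again[OF pv, of Finish L "Suc 0"] p(1) L \<open>length w \<le> L\<close> 0(1) by (simp add: numeral_2_eq_2)
next
  case (Suc k)
  obtain p v where pv: "pass expand_transducer Search w = (p, v)" by (cases "pass expand_transducer Search w")
  then have p: "p = Found" "map fst v = add_fillers (map fst w)" "fresh_count v = k"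
    using expand_search_pass[OF pv] Suc(2) by simp_all
  have e: "expansion (k + 1) (map fst v) = expansion (fresh_count w + 1) (map fst w)"
    unfolding p(2) using Suc(2) add_fillers_iter[of "k + 1" "add_fillers (map fst w)"]
      add_fillers_iter[of "k + 2" "map fst w"] by (simp add: funpow_swap1)
  have L: "length v \<le> L" using expansion_length(1)[of "map fst v" "k + 1"] e Suc.prems by simp
  have "length w \<le> L" using add_fillers_length[of "map fst w"] p(2) L by (metis length_map le_trans)
  have "exec expand_transducer L (k + 2) Search v (Some (fresh_word (expansion (k + 1) (map fst v))))"
    using Suc(1)[of v] p(3) Suc.prems e by simp
  then show ?case
    using exec_again[OF pv, of Search L "k + 2"] p(1) L \<open>length w \<le> L\<close> e Suc(2) by simp
qed

definition expand :: "sym list \<rightharpoonup> sym list" where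
  "expand w = Some (fresh_word (expansion (fresh_count w + 1) (map fst w)))"

lemma fresh_count_le: "fresh_count w \<le> length w"
  by (simp add: fresh_count_def)

lemma expand_length: "length (expansion (fresh_count w + 1) (map fst w)) \<le> (length w + 2) * length w"
proof -
  have "length (expansion (fresh_count w + 1) (map fst w)) \<le> (fresh_count w + 1 + 1) * length w"
    using expansion_length(2)[of "fresh_count w + 1" "map fst w"] by simp
  also have "\<dots> \<le> (length w + 2) * length w" using fresh_count_le[of w] by (intro mult_le_mono1) simp
  finally show ?thesis .
qed

instance expand_state :: finite
proof
  have "(UNIV :: expand_state set) = {Search, Found, Finish}" by (auto intro: expand_state.exhaust)
  then show "finite (UNIV :: expand_state set)" by (metis finite.emptyI finite_insert)
qed

lemma polytime_expand: "polytime expand"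
proof (rule polytime_transducer[of expand_transducer UNIV])
  show "finite_states expand_transducer UNIV" by (simp add: finite_states_def)
  show "poly_bounded (\<lambda>n. (n + 2) * n + n + 2)"
    by (intro poly_bounded_add poly_bounded_mult poly_bounded_const poly_bounded_id)
next
  fix w
  show "\<exists>n\<le>(length w + 2) * length w + length w + 2.
    exec expand_transducer ((length w + 2) * length w + length w + 2) n (init expand_transducer) w (expand w)"
    using expand_exec[of w "(length w + 2) * length w + length w + 2"] expand_length[of w] fresh_count_le[of w]
    unfolding expand_def by (intro exI[of _ "fresh_count w + 2"]) simp
qed

lemma word_balancedI:
  assumes "poly_bounded g" "mono g"
    "\<And>w v. F w = Some v \<Longrightarrow> length v \<le> g (length w) \<and> length w \<le> g (length v)"
  shows "word_balanced F"
  using assms unfolding word_balanced_def by blast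

lemma expand_balanced: "word_balanced expand"
proof (rule word_balancedI[of "\<lambda>n. (n + 2) * n + n"])
  show "poly_bounded (\<lambda>n. (n + 2) * n + n)"
    by (intro poly_bounded_add poly_bounded_mult poly_bounded_const poly_bounded_id)
  show "mono (\<lambda>n :: nat. (n + 2) * n + n)" by (intro monoI add_mono mult_le_mono) auto
next
  fix w v assume "expand w = Some v"
  then have "v = fresh_word (expansion (fresh_count w + 1) (map fst w))" by (simp add: expand_def)
  then have v: "length v = length (expansion (fresh_count w + 1) (map fst w))"
    by (simp add: fresh_word_def)
  show "length v \<le> (length w + 2) * length w + length w \<and> length w \<le> (length v + 2) * length v + length v"
    using expand_length[of w] expansion_length(1)[of "map fst w" "fresh_count w + 1"] unfolding v by simp
qed

text \<open>
  The tape is infinite in both directions, so padding is needed on both sides.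
\<close>

definition padded_input :: "nat \<Rightarrow> bool list \<Rightarrow> sym list" where
  "padded_input a x = fresh_word (replicate a Pad @ [Entry] @ map Bit x @ replicate a Pad)"

lemma expand_padded:
  "expand (padded_input a x) = Some (padded_input (a * (2 * a + 1 + length x + 2)) x)"
proof -
  have f: "fresh_count (fresh_word bs) = length bs" "map fst (fresh_word bs) = bs" for bs
    by (induction bs) (auto simp: fresh_count_def fresh_word_def)
  have p: "expansion k (replicate n Pad) = replicate (n * (k + 1)) Pad" for k n
    by (induction n) (simp_all add: expansion_def replicate_add[symmetric] algebra_simps)
  have b: "expansion k (map Bit x) = map Bit x" for k
    by (induction x) (simp_all add: expansion_def)
  have app: "expansion k (u @ v) = expansion k u @ expansion k v" for k u v by (simp add: expansion_def)
  have e: "expansion k [Entry] = [Entry]" for k by (simp add: expansion_def)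
  let ?k = "length (replicate a Pad @ [Entry] @ map Bit x @ replicate a Pad) + 1"
  have k: "?k + 1 = 2 * a + 1 + length x + 2" by simp
  show ?thesis unfolding expand_def padded_input_def f app p b e k ..
qed

subsection \<open>Contraction\<close>

text \<open>
  The letters other than \<open>Filler\<close> form the core of the word.  A pass of kind \<open>Delete\<close> removes the first
  fresh filler and burns the first fresh letter of the core.  When the whole core is burnt, a pass of kind
  \<open>Keep\<close> burns, and thereby preserves, the first fresh filler and makes the core fresh again.  Thus one of
  \<open>m + 1\<close> fillers survives, where \<open>m\<close> is the length of the core.  The components of \<open>Delete d b m\<close> tell
  whether a filler has been removed, a core letter has been burnt, and another fresh core letter has been
  seen in the current pass.
\<close>

datatype contract_state = Delete bool bool bool | Keep bool | Clean

instance contract_state :: finite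
proof
  have "(UNIV :: contract_state set)
      = (\<lambda>(q, b, m). Delete q b m) ` UNIV \<union> range Keep \<union> {Clean}"
  proof -
    have "x \<in> (\<lambda>(q, b, m). Delete q b m) ` UNIV \<union> range Keep \<union> {Clean}" for x
      by (cases x) (auto simp: image_iff)
    then show ?thesis by blast
  qed
  moreover have "finite ((\<lambda>(q, b, m). Delete q b m) ` UNIV \<union> range Keep \<union> {Clean})" by simp
  ultimately show "finite (UNIV :: contract_state set)" by metis
qed

definition contract_transducer :: "(contract_state, sym) transducer" where
  "contract_transducer = \<lparr>init = Delete False False False,
     move = (\<lambda>q (s, f). case q of
         Delete d b m \<Rightarrow>
           (if s = Filler then
              (if f \<or> d then (Delete d b m, [(s, f)]) else (Delete True b m, []))
            else if f then (Delete d b m, [(s, f)])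
            else if b then (Delete d b True, [(s, f)])
            else (Delete d True m, [(s, True)]))
       | Keep d \<Rightarrow>
           (if s = Filler then (if f \<or> d then (Keep d, [(s, f)]) else (Keep True, [(s, True)]))
            else (Keep d, [(s, False)]))
       | Clean \<Rightarrow> (Clean, [(s, False)])),
     final_output = (\<lambda>_. []),
     verdict = (\<lambda>q. case q of
         Delete d b m \<Rightarrow> (if \<not> d then Again Clean
           else if m then Again (Delete False False False) else Again (Keep False))
       | Keep d \<Rightarrow> (if d then Again (Delete False False False) else Again Clean)
       | Clean \<Rightarrow> Accept)\<rparr>"

lemma contract_simps [simp]:
  "init contract_transducer = Delete False False False" "final_output contract_transducer q = []"
  "verdict contract_transducer (Delete d b m) = (if \<not> d then Again Clean
           else if m then Again (Delete False False False) else Again (Keep False))"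
  "verdict contract_transducer (Keep d) = (if d then Again (Delete False False False) else Again Clean)"
  "verdict contract_transducer Clean = Accept"
  by (simp_all add: contract_transducer_def)

definition core :: "sym list \<Rightarrow> letter list" where
  "core w = filter (\<lambda>b. b \<noteq> Filler) (map fst w)"

definition fillers :: "sym list \<Rightarrow> nat" where
  "fillers w = length (filter (\<lambda>s. fst s = Filler) w)"

definition free_fillers :: "sym list \<Rightarrow> nat" where
  "free_fillers w = length (filter (\<lambda>s. s = (Filler, False)) w)"

definition kept_fillers :: "sym list \<Rightarrow> nat" where
  "kept_fillers w = length (filter (\<lambda>s. s = (Filler, True)) w)"

definition fresh_core :: "sym list \<Rightarrow> nat" where
  "fresh_core w = length (filter (\<lambda>s. fst s \<noteq> Filler \<and> \<not> snd s) w)"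

lemmas contract_counts = core_def fillers_def free_fillers_def kept_fillers_def fresh_core_def

lemma fillers_split: "fillers w = free_fillers w + kept_fillers w"
  by (induction w) (auto simp: contract_counts)

lemma word_length_split: "length w = length (core w) + fillers w"
  by (induction w) (auto simp: contract_counts)

lemma fresh_core_le: "fresh_core w \<le> length (core w)"
  by (induction w) (auto simp: contract_counts)

lemma contract_delete_pass:
  "pass contract_transducer (Delete d b m) w = (p, v) \<Longrightarrow>
     p = Delete (d \<or> free_fillers w > 0) (b \<or> fresh_core w > 0) (m \<or> fresh_core w \<ge> (if b then 1 else 2)) \<and>
     free_fillers v = (if d then free_fillers w else free_fillers w - 1) \<and>
     kept_fillers v = kept_fillers w \<and> core v = core w \<and>
     fresh_core v = (if b then fresh_core w else fresh_core w - 1)"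
proof (induction w arbitrary: d b m p v)
  case Nil
  then show ?case by (auto simp: contract_counts)
next
  case (Cons a w)
  obtain s f where a: "a = (s, f)" by (cases a)
  obtain q u where m1: "move contract_transducer (Delete d b m) a = (q, u)"
    by (cases "move contract_transducer (Delete d b m) a")
  obtain p' v' where v': "pass contract_transducer q w = (p', v')" by (cases "pass contract_transducer q w")
  have pv: "p = p'" "v = u @ v'" using Cons.prems m1 v' by simp_all
  consider "s = Filler" "f \<or> d" | "s = Filler" "\<not> f" "\<not> d" | "s \<noteq> Filler" "f"
    | "s \<noteq> Filler" "\<not> f" "b" | "s \<noteq> Filler" "\<not> f" "\<not> b" by blast
  then show ?case
  proof cases
    case 1
    then have "q = Delete d b m" "u = [a]" using m1 a by (auto simp: contract_transducer_def)
    then show ?thesis using Cons.IH[of d b m p' v'] v' pv 1 a by (auto simp: contract_counts)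
  next
    case 2
    then have "q = Delete True b m" "u = []" using m1 a by (auto simp: contract_transducer_def)
    then show ?thesis using Cons.IH[of True b m p' v'] v' pv 2 a by (auto simp: contract_counts)
  next
    case 3
    then have "q = Delete d b m" "u = [a]" using m1 a by (auto simp: contract_transducer_def)
    then show ?thesis using Cons.IH[of d b m p' v'] v' pv 3 a by (auto simp: contract_counts)
  next
    case 4
    then have "q = Delete d b True" "u = [a]" using m1 a by (auto simp: contract_transducer_def)
    then show ?thesis using Cons.IH[of d b True p' v'] v' pv 4 a by (auto simp: contract_counts)
  next
    case 5
    then have "q = Delete d True m" "u = [(s, True)]" using m1 a by (auto simp: contract_transducer_def)
    then show ?thesis using Cons.IH[of d True m p' v'] v' pv 5 a by (auto simp: contract_counts)
  qed
qed

lemma contract_keep_pass: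
  "pass contract_transducer (Keep d) w = (p, v) \<Longrightarrow>
     p = Keep (d \<or> free_fillers w > 0) \<and>
     free_fillers v = (if d then free_fillers w else free_fillers w - 1) \<and>
     kept_fillers v = kept_fillers w + (if \<not> d \<and> free_fillers w > 0 then 1 else 0) \<and> core v = core w \<and>
     fresh_core v = length (core w)"
proof (induction w arbitrary: d p v)
  case Nil
  then show ?case by (simp add: contract_counts)
next
  case (Cons a w)
  obtain s f where a: "a = (s, f)" by (cases a)
  obtain q u where m1: "move contract_transducer (Keep d) a = (q, u)"
    by (cases "move contract_transducer (Keep d) a")
  obtain p' v' where v': "pass contract_transducer q w = (p', v')" by (cases "pass contract_transducer q w")
  have pv: "p = p'" "v = u @ v'" using Cons.prems m1 v' by simp_all
  consider "s = Filler" "f \<or> d" | "s = Filler" "\<not> f" "\<not> d" | "s \<noteq> Filler" by blast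
  then show ?case
  proof cases
    case 1
    then have "q = Keep d" "u = [a]" using m1 a by (auto simp: contract_transducer_def)
    then show ?thesis using Cons.IH[of d p' v'] v' pv 1 a by (auto simp: contract_counts)
  next
    case 2
    then have "q = Keep True" "u = [(s, True)]" using m1 a by (auto simp: contract_transducer_def)
    then show ?thesis using Cons.IH[of True p' v'] v' pv 2 a by (auto simp: contract_counts)
  next
    case 3
    then have "q = Keep d" "u = [(s, False)]" using m1 a by (auto simp: contract_transducer_def)
    then show ?thesis using Cons.IH[of d p' v'] v' pv 3 a by (auto simp: contract_counts)
  qed
qed

lemma contract_clean_pass:
  "pass contract_transducer Clean w = (Clean, map (\<lambda>s. (fst s, False)) w)"
  by (induction w) (auto simp: contract_transducer_def)

lemma contract_clean_exec:
  assumes "length w \<le> L"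
  shows "\<exists>v. exec contract_transducer L (Suc 0) Clean w (Some v) \<and> core v = core w \<and>
    fillers v = fillers w \<and> all_fresh v"
proof (intro exI conjI)
  let ?v = "map (\<lambda>s. (fst s, False)) w :: sym list"
  show "exec contract_transducer L (Suc 0) Clean w (Some ?v)"
    using exec_accept[OF contract_clean_pass, where L = L and w = w] assms by simp
  show "core ?v = core w" "fillers ?v = fillers w"
    by (simp_all add: core_def fillers_def filter_map comp_def)
  show "all_fresh ?v" by (simp add: list_all_iff)
qed

text \<open>
  Started in state \<open>q\<close>, the transducer turns \<open>w\<close> into \<open>v\<close> and keeps \<open>e\<close> of the fresh fillers.
\<close>

definition contracts_to :: "nat \<Rightarrow> contract_state \<Rightarrow> sym list \<Rightarrow> sym list \<Rightarrow> nat \<Rightarrow> bool" where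
  "contracts_to L q w v e \<longleftrightarrow>
     (\<exists>n\<le>free_fillers w + 2. exec contract_transducer L n q w (Some v)) \<and>
     core v = core w \<and> all_fresh v \<and> fillers v = kept_fillers w + e \<and> e \<le> free_fillers w"

lemma contracts_to_stop:
  assumes pass: "pass contract_transducer q w = (p, u)" "verdict contract_transducer p = Again Clean"
    and u: "core u = core w" "kept_fillers u = kept_fillers w" "free_fillers u = 0"
    and w: "free_fillers w = 0" "length w \<le> L"
  shows "\<exists>v. contracts_to L q w v 0"
proof -
  have fu: "fillers u = kept_fillers w" using u(2,3) fillers_split[of u] by simp
  then have uL: "length u \<le> L" using w u(1) word_length_split[of u] word_length_split[of w]
      fillers_split[of w] by simp
  from contract_clean_exec[OF uL] obtain v where v: "exec contract_transducer L (Suc 0) Clean u (Some v)"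
    "core v = core u" "fillers v = fillers u" "all_fresh v" by blast
  have "exec contract_transducer L 2 q w (Some v)"
    using exec_again[OF pass w(2), of "Suc 0"] uL v(1) by (simp add: numeral_2_eq_2)
  then show ?thesis using v fu u(1) unfolding contracts_to_def
    by (intro exI[of _ v] conjI exI[of _ 2]) simp_all
qed

lemma contracts_to_again:
  assumes "pass contract_transducer q w = (p, u)" "verdict contract_transducer p = Again q'"
    and "length w \<le> L" "length u \<le> L" "core u = core w" "free_fillers w = Suc (free_fillers u)"
    and "kept_fillers u = kept_fillers w + c" "c \<le> 1" "contracts_to L q' u v e"
  shows "contracts_to L q w v (c + e)"
proof -
  obtain n where n: "n \<le> free_fillers u + 2" "exec contract_transducer L n q' u (Some v)"
    using assms(9) unfolding contracts_to_def by blast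
  have "exec contract_transducer L (Suc n) q w (Some v)"
    by (rule exec_again[OF assms(1,2)]) (use assms(3,4) n(2) in simp_all)
  then show ?thesis using assms(5-9) n(1) unfolding contracts_to_def
    by (intro conjI exI[of _ "Suc n"]) simp_all
qed

text \<open>
  The upper bounds for \<open>e\<close> are the progress that the iteration needs; the lower bounds (the word was not
  much longer than the square of the result) make the contraction balanced.  The statement covers both
  kinds of passes, since each kind leads to the other.
\<close>

lemma contract_exec:
  fixes w :: "sym list"
  assumes "length w \<le> L"
  shows "(\<exists>v e. contracts_to L (Delete False False False) w v e \<and>
       free_fillers w \<le> (length (core w) + 2) * e + max (fresh_core w) 1 \<and>
       (core w \<noteq> [] \<longrightarrow> (length (core w) + 1) * e \<le> free_fillers w + (length (core w) - fresh_core w))) \<and>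
     (\<exists>v e. contracts_to L (Keep False) w v e \<and>
       free_fillers w \<le> (length (core w) + 2) * e \<and>
       (core w \<noteq> [] \<longrightarrow> (length (core w) + 1) * e \<le> free_fillers w + length (core w)))"
  using assms
proof (induction "free_fillers w" arbitrary: w)
  case 0
  note zero = 0(1)[symmetric] and wL = 0(2)
  obtain p u where pu: "pass contract_transducer (Delete False False False) w = (p, u)"
    by (cases "pass contract_transducer (Delete False False False) w")
  obtain p' u' where pu': "pass contract_transducer (Keep False) w = (p', u')"
    by (cases "pass contract_transducer (Keep False) w")
  have "\<exists>v. contracts_to L (Delete False False False) w v 0"
    by (rule contracts_to_stop[OF pu]) (use contract_delete_pass[OF pu] zero wL in simp_all)
  moreover have "\<exists>v. contracts_to L (Keep False) w v 0"
    by (rule contracts_to_stop[OF pu']) (use contract_keep_pass[OF pu'] zero wL in simp_all)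
  ultimately show ?case unfolding zero by fastforce
next
  case (Suc k)
  note k = Suc(2)[symmetric] and wL = Suc(3)
  let ?m = "length (core w)"
  obtain p u where pu: "pass contract_transducer (Delete False False False) w = (p, u)"
    by (cases "pass contract_transducer (Delete False False False) w")
  obtain p' u' where pu': "pass contract_transducer (Keep False) w = (p', u')"
    by (cases "pass contract_transducer (Keep False) w")
  have u: "p = Delete True (fresh_core w > 0) (fresh_core w \<ge> 2)" "free_fillers u = k"
    "kept_fillers u = kept_fillers w" "core u = core w" "fresh_core u = fresh_core w - 1"
    using contract_delete_pass[OF pu] k by simp_all
  have u': "p' = Keep True" "free_fillers u' = k"
    "kept_fillers u' = kept_fillers w + 1" "core u' = core w" "fresh_core u' = ?m"
    using contract_keep_pass[OF pu'] k by simp_all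
  have uL: "length u \<le> L" "length u' \<le> L"
    using wL u u' k word_length_split[of u] word_length_split[of u'] word_length_split[of w]
      fillers_split[of u] fillers_split[of u'] fillers_split[of w] by simp_all
  note IH = Suc(1)[of u, OF u(2)[symmetric] uL(1)] and IH' = Suc(1)[of u', OF u'(2)[symmetric] uL(2)]
  have delete: "contracts_to L (Delete False False False) w v e"
    if "contracts_to L q' u v e" "verdict contract_transducer p = Again q'" for v e q'
    using contracts_to_again[OF pu that(2) wL uL(1) u(4) _ _ _ that(1), of 0] u(2,3) k by simp
  have "\<exists>v e. contracts_to L (Keep False) w v e \<and> free_fillers w \<le> (?m + 2) * e \<and>
       (core w \<noteq> [] \<longrightarrow> (?m + 1) * e \<le> free_fillers w + ?m)"
  proof -
    obtain v e where v: "contracts_to L (Delete False False False) u' v e"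
      "k \<le> (?m + 2) * e + max ?m 1" "core w \<noteq> [] \<longrightarrow> (?m + 1) * e \<le> k"
      using IH' unfolding u' by auto
    have "contracts_to L (Keep False) w v (1 + e)"
      by (rule contracts_to_again[OF pu' _ wL uL(2) u'(4) _ u'(3) _ v(1)]) (use u'(1,2) k in simp_all)
    moreover have "Suc k \<le> (?m + 2) * (1 + e)" using v(2) by (simp add: max_def split: if_splits)
    moreover have "core w \<noteq> [] \<longrightarrow> (?m + 1) * (1 + e) \<le> Suc k + ?m" using v(3) by simp
    ultimately show ?thesis unfolding k by blast
  qed
  moreover have "\<exists>v e. contracts_to L (Delete False False False) w v e \<and>
       free_fillers w \<le> (?m + 2) * e + max (fresh_core w) 1 \<and>
       (core w \<noteq> [] \<longrightarrow> (?m + 1) * e \<le> free_fillers w + (?m - fresh_core w))"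
  proof (cases "fresh_core w \<ge> 2")
    case True
    obtain v e where v: "contracts_to L (Delete False False False) u v e"
      "k \<le> (?m + 2) * e + max (fresh_core w - 1) 1"
      "core w \<noteq> [] \<longrightarrow> (?m + 1) * e \<le> k + (?m - (fresh_core w - 1))"
      using IH unfolding u by blast
    have "Suc k \<le> (?m + 2) * e + max (fresh_core w) 1" using v(2) True by (simp add: max_def split: if_splits)
    moreover have "core w \<noteq> [] \<longrightarrow> (?m + 1) * e \<le> Suc k + (?m - fresh_core w)"
      using v(3) True fresh_core_le[of w] by auto
    ultimately show ?thesis using delete[OF v(1)] u(1) True unfolding k by auto
  next
    case False
    obtain v e where v: "contracts_to L (Keep False) u v e"
      "k \<le> (?m + 2) * e" "core w \<noteq> [] \<longrightarrow> (?m + 1) * e \<le> k + ?m"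
      using IH unfolding u by blast
    have "Suc k \<le> (?m + 2) * e + max (fresh_core w) 1" using v(2) by (simp add: max_def)
    moreover have "core w \<noteq> [] \<longrightarrow> (?m + 1) * e \<le> Suc k + (?m - fresh_core w)"
      using v(3) False fresh_core_le[of w] by auto
    ultimately show ?thesis using delete[OF v(1)] u(1) False unfolding k by auto
  qed
  ultimately show ?case by blast
qed

definition contracting :: "(sym list \<rightharpoonup> sym list) \<Rightarrow> bool" where
  "contracting C \<longleftrightarrow> (\<forall>w. \<exists>v. C w = Some v \<and> core v = core w \<and> all_fresh v \<and>
     (all_fresh w \<and> core w \<noteq> [] \<longrightarrow> (length (core w) + 1) * fillers v \<le> fillers w))"

lemma ex_contract: obtains C where "polytime C" "word_balanced C" "contracting C"
proof -
  define R where "R w r \<longleftrightarrow> (\<exists>v. r = Some v \<and> core v = core w \<and> all_fresh v \<and>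
       (all_fresh w \<and> core w \<noteq> [] \<longrightarrow> (length (core w) + 1) * fillers v \<le> fillers w) \<and>
       length v \<le> length w \<and> length w \<le> (length v + 2) * length v + length v + length v + 1)"
    for w :: "sym list" and r
  have "\<exists>r. (\<exists>n\<le>length w + 2. exec contract_transducer (length w + 2) n (init contract_transducer) w r) \<and> R w r"
    for w
  proof -
    obtain v e where c: "contracts_to (length w + 2) (Delete False False False) w v e"
      and low: "free_fillers w \<le> (length (core w) + 2) * e + max (fresh_core w) 1"
      and up: "core w \<noteq> [] \<longrightarrow> (length (core w) + 1) * e \<le> free_fillers w + (length (core w) - fresh_core w)"
      using conjunct1[OF contract_exec[of w "length w + 2"]] by auto
    obtain n where n: "n \<le> free_fillers w + 2"
      "exec contract_transducer (length w + 2) n (Delete False False False) w (Some v)"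
      and v: "core v = core w" "all_fresh v" "fillers v = kept_fillers w + e" "e \<le> free_fillers w"
      using c unfolding contracts_to_def by blast
    have len: "length w = length (core w) + kept_fillers w + free_fillers w"
      "length v = length (core w) + kept_fillers w + e"
      using word_length_split[of w] word_length_split[of v] fillers_split[of w] v(1,3) by simp_all
    have nw: "n \<le> length w + 2" and vw: "length v \<le> length w" using n(1) v(4) len by simp_all
    have "(length (core w) + 1) * fillers v \<le> fillers w" if f: "all_fresh w" and ne: "core w \<noteq> []"
    proof -
      have "kept_fillers w = 0" "fresh_core w = length (core w)"
        using f by (induction w) (auto simp: contract_counts)
      then show ?thesis using v(3) up ne fillers_split[of w] by simp
    qed
    moreover have "(length (core w) + 2) * e \<le> (length v + 2) * length v" using len by (intro mult_le_mono) auto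
    then have "free_fillers w \<le> (length v + 2) * length v + max (fresh_core w) 1" using low by linarith
    then have "length w \<le> (length v + 2) * length v + length v + length v + 1"
      using len fresh_core_le[of w] by (simp add: max_def split: if_splits)
    ultimately show ?thesis using vw v(1,2) nw n(2) unfolding R_def contract_simps by blast
  qed
  moreover have "finite_states contract_transducer UNIV" by (simp add: finite_states_def)
  moreover have "poly_bounded (\<lambda>n. n + 2)" by (intro poly_bounded_add poly_bounded_const poly_bounded_id)
  ultimately obtain F where F: "polytime F" "\<And>w. R w (F w)"
    using polytime_transducer_choice[of contract_transducer UNIV "\<lambda>n. n + 2" R] by blast
  have "word_balanced F"
  proof (rule word_balancedI[of "\<lambda>n. (n + 2) * n + n + n + 1"])
    show "poly_bounded (\<lambda>n. (n + 2) * n + n + n + 1)"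
      by (intro poly_bounded_add poly_bounded_mult poly_bounded_const poly_bounded_id)
    show "mono (\<lambda>n :: nat. (n + 2) * n + n + n + 1)" by (intro monoI add_mono mult_le_mono) auto
  next
    fix w v assume "F w = Some v"
    then show "length v \<le> (length w + 2) * length w + length w + length w + 1 \<and>
       length w \<le> (length v + 2) * length v + length v + length v + 1"
      using F(2)[of w] unfolding R_def by auto
  qed
  moreover have "contracting F" using F(2) unfolding R_def contracting_def by blast
  ultimately show thesis using F(1) that by blast
qed


section \<open>A universal machine: straight-line programs acting on all cells in parallel\<close>

text \<open>
  The input of the universal machine is a program, written as a sequence of instructions, followed by an
  array of cells.  A cell consists of its registers and a separator; the separator holds the accumulator of
  the cell, and its mark tells whether the fuel of the cell is spent.  An instruction is executed in one pass
  and acts on the first register of each cell; \<open>Rot\<close> rotates the registers, whereby all of them can become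
  the first one.  Since the separator comes last, the accumulator of a cell can be combined only with the
  registers of the next cell during a pass from left to right: \<open>Load\<close> and \<open>Store\<close> shift information
  by one cell to the right.  The component \<open>c\<close> of a state carries this information.

  The instruction \<open>Tick\<close> burns the fuel of one cell, and the computation ends when it finds no fuel.  It is
  required to occur once, at the beginning of the program; the program is rotated by one instruction per
  pass, and therefore executed once per unit of fuel.
\<close>

datatype place = At_start | Inside | Holding bool

datatype sim_state = Begin | Fetch | Program instr | Data instr bool place | Fail

instance place :: finite
proof
  have "x \<in> {At_start, Inside} \<union> range Holding" for x by (cases x) auto
  then have "(UNIV :: place set) = {At_start, Inside} \<union> range Holding" by blast
  moreover have "finite ({At_start, Inside} \<union> range Holding)" by simp
  ultimately show "finite (UNIV :: place set)" by metis
qed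

instance sim_state :: finite
proof
  let ?A = "{Begin, Fetch, Fail} \<union> range Program \<union> (\<lambda>(i, c, l). Data i c l) ` UNIV"
  have "x \<in> ?A" for x by (cases x) (auto simp: image_iff)
  then have "(UNIV :: sim_state set) = ?A" by blast
  moreover have "finite ?A" by simp
  ultimately show "finite (UNIV :: sim_state set)" by metis
qed

fun data_move :: "instr \<Rightarrow> bool \<Rightarrow> place \<Rightarrow> sym \<Rightarrow> sim_state \<times> sym list" where
  "data_move i c l (Reg b, f) =
     (if l = At_start then
        (case i of
           Tick \<Rightarrow> (Data i c Inside, [(Reg b, f)])
         | Load \<Rightarrow> (Data i (c \<and> b) Inside, [(Reg b, f)])
         | Store \<Rightarrow> (Data i c Inside, [(Reg (b \<or> c), f)])
         | Clear \<Rightarrow> (Data i c Inside, [(Reg False, f)])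
         | Rot \<Rightarrow> (Data i c (Holding b), []))
      else (Data i c l, [(Reg b, f)]))"
| "data_move i c l (Sep a, f) =
     (case i of
        Tick \<Rightarrow> if \<not> c \<and> \<not> f then (Data i True At_start, [(Sep a, True)])
                 else (Data i c At_start, [(Sep a, f)])
      | Load \<Rightarrow> (Data i a At_start, [(Sep c, f)])
      | Store \<Rightarrow> (Data i a At_start, [(Sep True, f)])
      | Clear \<Rightarrow> (Data i c At_start, [(Sep a, f)])
      | Rot \<Rightarrow> (Data i c At_start, (case l of Holding b \<Rightarrow> [(Reg b, False)] | _ \<Rightarrow> []) @ [(Sep a, f)]))"
| "data_move i c l _ = (Fail, [])"

fun sim_move :: "sim_state \<Rightarrow> sym \<Rightarrow> sim_state \<times> sym list" where
  "sim_move Begin s = (if s = (Instr Tick, False) then Program Tick else Fail, [])"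
| "sim_move Fetch s = (case s of (Instr i, False) \<Rightarrow> Program i | _ \<Rightarrow> Fail, [])"
| "sim_move (Program i) (Instr j, f) =
     (if f \<or> i = Tick \<and> j = Tick then (Fail, []) else (Program i, [(Instr j, False)]))"
| "sim_move (Program i) s = (let (q, u) = data_move i False At_start s in (q, (Instr i, False) # u))"
| "sim_move (Data i c l) s = data_move i c l s"
| "sim_move Fail s = (Fail, [])"

definition sim_transducer :: "(sim_state, sym) transducer" where
  "sim_transducer = \<lparr>init = Begin, move = sim_move,
     final_output = (\<lambda>q. case q of
         Program i \<Rightarrow> [(Instr i, False)]
       | Data i c (Holding b) \<Rightarrow> [(Reg b, False)]
       | _ \<Rightarrow> []),
     verdict = (\<lambda>q. case q of
         Program i \<Rightarrow> (if i = Tick then Accept else Again Fetch)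
       | Data i c l \<Rightarrow> (if i = Tick \<and> \<not> c then Accept else Again Fetch)
       | _ \<Rightarrow> Reject)\<rparr>"

lemma sim_simps [simp]:
  "init sim_transducer = Begin" "move sim_transducer = sim_move"
  "final_output sim_transducer (Program i) = [(Instr i, False)]"
  "final_output sim_transducer (Data i c (Holding b)) = [(Reg b, False)]"
  "final_output sim_transducer (Data i c At_start) = []"
  "final_output sim_transducer (Data i c Inside) = []"
  "final_output sim_transducer Fail = []"
  "final_output sim_transducer Begin = []"
  "verdict sim_transducer (Program i) = (if i = Tick then Accept else Again Fetch)"
  "verdict sim_transducer (Data i c l) = (if i = Tick \<and> \<not> c then Accept else Again Fetch)"
  "verdict sim_transducer Begin = Reject" "verdict sim_transducer Fail = Reject"
  by (simp_all add: sim_transducer_def)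

definition is_data :: "sym list \<Rightarrow> bool" where
  "is_data d \<longleftrightarrow> list_all (\<lambda>s. fst s \<in> range Reg \<union> range Sep) d"

definition fuel :: "sym list \<Rightarrow> nat" where
  "fuel d = length (filter (\<lambda>s. s \<in> {(Sep False, False), (Sep True, False)}) d)"

text \<open>
  The number of registers that have been read but not yet written again.
\<close>

definition held :: "place \<Rightarrow> nat" where
  "held l = (case l of Holding _ \<Rightarrow> 1 | _ \<Rightarrow> 0)"

lemma is_data_simps [simp]:
  "is_data []" "is_data (s # d) \<longleftrightarrow> fst s \<in> range Reg \<union> range Sep \<and> is_data d"
  "is_data (d @ e) \<longleftrightarrow> is_data d \<and> is_data e"
  by (auto simp: is_data_def)

lemma fuel_simps [simp]:
  "fuel [] = 0" "fuel ((Reg b, f) # d) = fuel d" "fuel ((Sep a, f) # d) = (if f then fuel d else Suc (fuel d))"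
  "fuel (d @ e) = fuel d + fuel e"
  by (auto simp: fuel_def)

lemma held_simps [simp]: "held At_start = 0" "held Inside = 0" "held (Holding b) = 1"
  by (simp_all add: held_def)

text \<open>
  No instruction changes the number of letters, and only \<open>Tick\<close> uses up fuel; in case of \<open>Tick\<close> the carry
  records whether fuel was found.
\<close>

lemma data_pass:
  assumes "is_data d" "held l = 0 \<or> i = Rot"
  shows "\<exists>c' l' v. pass sim_transducer (Data i c l) d = (Data i c' l', v) \<and>
     is_data (v @ final_output sim_transducer (Data i c' l')) \<and>
     length (v @ final_output sim_transducer (Data i c' l')) = length d + held l \<and>
     (if i = Tick then c' = (c \<or> fuel d > 0) \<and>
        fuel (v @ final_output sim_transducer (Data i c' l')) = (if c then fuel d else fuel d - 1)
      else fuel (v @ final_output sim_transducer (Data i c' l')) = fuel d)"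
  using assms
proof (induction d arbitrary: c l)
  case Nil
  then show ?case by (cases l) auto
next
  case (Cons s d)
  obtain x f where s: "s = (x, f)" by (cases s)
  have d: "is_data d" using Cons.prems(1) by simp
  have h: "held At_start = 0 \<or> i = Rot" "held Inside = 0 \<or> i = Rot" "held l = 0 \<or> i = Rot"
    using Cons.prems(2) by simp_all
  consider b where "x = Reg b" | a where "x = Sep a" using Cons.prems(1) s by auto
  then show ?case
  proof cases
    case 1
    show ?thesis
    proof (cases "l = At_start")
      case True
      show ?thesis
      proof (cases i)
        case Tick
        then show ?thesis using Cons.IH[OF d h(2), of c] s 1 True by auto
      next
        case Load
        then show ?thesis using Cons.IH[OF d h(2), of "c \<and> b"] s 1 True by auto
      next
        case Store
        then show ?thesis using Cons.IH[OF d h(2), of c] s 1 True by auto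
      next
        case Clear
        then show ?thesis using Cons.IH[OF d h(2), of c] s 1 True by auto
      next
        case Rot
        then show ?thesis using Cons.IH[OF d, of "Holding b" c] s 1 True by auto
      qed
    next
      case False
      obtain c' l' v where v: "pass sim_transducer (Data i c l) d = (Data i c' l', v)"
        "is_data (v @ final_output sim_transducer (Data i c' l'))"
        "length (v @ final_output sim_transducer (Data i c' l')) = length d + held l"
        "if i = Tick then c' = (c \<or> fuel d > 0) \<and>
           fuel (v @ final_output sim_transducer (Data i c' l')) = (if c then fuel d else fuel d - 1)
         else fuel (v @ final_output sim_transducer (Data i c' l')) = fuel d"
        using Cons.IH[OF d h(3), of c] by blast
      have "pass sim_transducer (Data i c l) (s # d) = (Data i c' l', s # v)"
        using v(1) False by (simp add: s 1)
      then show ?thesis using v(2-4) s 1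
        by (intro exI[of _ c'] exI[of _ l'] exI[of _ "s # v"]) (auto split: if_splits)
    qed
  next
    case 2
    show ?thesis
    proof (cases i)
      case Tick
      then show ?thesis using Cons.IH[OF d h(1), of True] Cons.IH[OF d h(1), of c] h(3) s 2
        by (cases "\<not> c \<and> \<not> f") auto
    next
      case Load
      then show ?thesis using Cons.IH[OF d h(1), of a] h(3) s 2 by auto
    next
      case Store
      then show ?thesis using Cons.IH[OF d h(1), of a] h(3) s 2 by auto
    next
      case Clear
      then show ?thesis using Cons.IH[OF d h(1), of c] h(3) s 2 by auto
    next
      case Rot
      then show ?thesis using Cons.IH[OF d h(1), of c] s 2 by (cases l) auto
    qed
  qed
qed

lemma fail_pass: "pass sim_transducer Fail w = (Fail, [])"
  by (induction w) simp_all

definition run_instr :: "instr \<Rightarrow> sym list \<Rightarrow> sym list" where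
  "run_instr i d = (let (p, v) = pass sim_transducer (Data i False At_start) d
     in v @ final_output sim_transducer p)"

lemma run_instr_data:
  assumes "is_data d"
  shows "is_data (run_instr i d)" "length (run_instr i d) = length d"
    "i \<noteq> Tick \<Longrightarrow> fuel (run_instr i d) = fuel d" "fuel (run_instr Tick d) = fuel d - 1"
  using data_pass[OF assms, of At_start i False] data_pass[OF assms, of At_start Tick False]
  by (auto simp: run_instr_def split: if_splits)

definition program_word :: "instr list \<Rightarrow> sym list" where
  "program_word is = map (\<lambda>i. (Instr i, False)) is"

lemma program_word_simps [simp]:
  "program_word [] = []" "program_word (i # is) = (Instr i, False) # program_word is"
  "program_word (is @ js) = program_word is @ program_word js" "length (program_word is) = length is"
  by (simp_all add: program_word_def)

lemma program_pass:
  assumes "is_data d" "i = Tick \<longrightarrow> Tick \<notin> set is"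
  shows "\<exists>p v. pass sim_transducer (Program i) (program_word is @ d) = (p, v) \<and>
     v @ final_output sim_transducer p = program_word (is @ [i]) @ run_instr i d \<and>
     verdict sim_transducer p = (if i = Tick \<and> fuel d = 0 then Accept else Again Fetch)"
  using assms(2)
proof (induction "is")
  case Nil
  show ?case
  proof (cases d)
    case Nil
    then show ?thesis by (simp add: run_instr_def)
  next
    case (Cons s d')
    then have s: "fst s \<in> range Reg \<union> range Sep" using assms(1) by simp
    then have m: "sim_move (Program i) s = (let (q, u) = data_move i False At_start s in (q, (Instr i, False) # u))"
      by (cases s) auto
    obtain c' l' v where v: "pass sim_transducer (Data i False At_start) d = (Data i c' l', v)"
      "i = Tick \<longrightarrow> c' = (fuel d > 0)"
      using data_pass[OF assms(1), of At_start i False] by (auto split: if_splits)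
    have "pass sim_transducer (Program i) d = (Data i c' l', (Instr i, False) # v)"
      using v(1) m unfolding Cons by (auto split: prod.splits)
    then show ?thesis using v by (auto simp: run_instr_def)
  qed
next
  case (Cons j js)
  then show ?case by (auto split: prod.splits)
qed

lemma fetch_pass:
  assumes "is_data d" "i = Tick \<longrightarrow> Tick \<notin> set is"
    and "q = Fetch \<or> q = Begin \<and> i = Tick"
  obtains p v where "pass sim_transducer q (program_word (i # is) @ d) = (p, v)"
    "v @ final_output sim_transducer p = program_word (is @ [i]) @ run_instr i d"
    "verdict sim_transducer p = (if i = Tick \<and> fuel d = 0 then Accept else Again Fetch)"
  using program_pass[OF assms(1,2)] assms(3) by auto

definition run_program :: "instr list \<Rightarrow> sym list \<Rightarrow> sym list" where
  "run_program is d = fold run_instr is d"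

lemma run_program_simps [simp]:
  "run_program [] d = d" "run_program (i # is) d = run_program is (run_instr i d)"
  "run_program (is @ js) d = run_program js (run_program is d)"
  by (simp_all add: run_program_def)

lemma run_program_data:
  assumes "is_data d" "Tick \<notin> set is"
  shows "is_data (run_program is d) \<and> length (run_program is d) = length d \<and> fuel (run_program is d) = fuel d"
  using assms
proof (induction "is" arbitrary: d)
  case (Cons i js)
  then show ?case using run_instr_data(1-3)[OF Cons.prems(1), of i] by auto
qed simp

text \<open>
  While the instructions \<open>is\<close> are executed, they move one by one from the front of the program to its end.
\<close>

lemma sim_exec_program:
  assumes "is_data d" "Tick \<notin> set is" "length is + length js + length d \<le> L"
    and "exec sim_transducer L n Fetch (program_word (js @ is) @ run_program is d) r"
  shows "exec sim_transducer L (n + length is) Fetch (program_word (is @ js) @ d) r"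
  using assms
proof (induction "is" arbitrary: d js)
  case (Cons i ks)
  have i: "i \<noteq> Tick" using Cons.prems(2) by auto
  have h: "i = Tick \<longrightarrow> Tick \<notin> set (ks @ js)" "Fetch = Fetch \<or> Fetch = Begin \<and> i = Tick"
    using i by simp_all
  obtain p v where pv': "pass sim_transducer Fetch (program_word (i # ks @ js) @ d) = (p, v)"
    "v @ final_output sim_transducer p = program_word ((ks @ js) @ [i]) @ run_instr i d"
    "verdict sim_transducer p = (if i = Tick \<and> fuel d = 0 then Accept else Again Fetch)"
    by (rule fetch_pass[OF Cons.prems(1) h])
  have v: "verdict sim_transducer p = Again Fetch" using pv'(3) i by simp
  note pv = pv'(1,2) v
  have "exec sim_transducer L (n + length ks) Fetch (program_word (ks @ (js @ [i])) @ run_instr i d) r"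
    by (rule Cons.IH) (use Cons.prems run_instr_data(1-3)[OF Cons.prems(1), of i] in auto)
  then have "exec sim_transducer L (n + length ks) Fetch (v @ final_output sim_transducer p) r"
    unfolding pv(2) by simp
  moreover have "length (v @ final_output sim_transducer p) \<le> L"
    unfolding pv(2) using Cons.prems(3) run_instr_data(2)[OF Cons.prems(1), of i] by simp
  ultimately have "exec sim_transducer L (Suc (n + length ks)) Fetch (program_word (i # ks @ js) @ d) r"
    using exec_again[OF pv(1,3), of L] Cons.prems(3) by simp
  then show ?case by simp
qed simp

definition sim_result :: "instr list \<Rightarrow> sym list \<Rightarrow> sym list" where
  "sim_result is d = program_word (is @ [Tick]) @
     run_instr Tick (((\<lambda>d. run_program is (run_instr Tick d)) ^^ fuel d) d)"

lemma sim_exec: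
  assumes "is_data d" "Tick \<notin> set is" "length is + length d + 1 \<le> L"
    and "q = Fetch \<or> q = Begin"
  shows "exec sim_transducer L (fuel d * (length is + 1) + 1) q (program_word (Tick # is) @ d)
    (Some (sim_result is d))"
  using assms
proof (induction "fuel d" arbitrary: d q)
  case 0
  have h: "Tick = Tick \<longrightarrow> Tick \<notin> set is" "q = Fetch \<or> q = Begin \<and> Tick = Tick"
    using 0(3,5) by auto
  obtain p v where pv': "pass sim_transducer q (program_word (Tick # is) @ d) = (p, v)"
    "v @ final_output sim_transducer p = program_word (is @ [Tick]) @ run_instr Tick d"
    "verdict sim_transducer p = (if Tick = Tick \<and> fuel d = 0 then Accept else Again Fetch)"
    by (rule fetch_pass[OF 0(2) h])
  note pv = pv'(1,2) pv'(3)[folded 0(1), simplified]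
  have "length (v @ final_output sim_transducer p) \<le> L"
    unfolding pv(2) using 0(4) run_instr_data(2)[OF 0(2)] by simp
  then have "exec sim_transducer L (Suc 0) q (program_word (Tick # is) @ d) (Some (v @ final_output sim_transducer p))"
    using 0(4) by (intro exec_accept[OF pv(1,3)]) auto
  then show ?case unfolding pv(2) sim_result_def using 0(1) by simp
next
  case (Suc k)
  have h: "Tick = Tick \<longrightarrow> Tick \<notin> set is" "q = Fetch \<or> q = Begin \<and> Tick = Tick"
    using Suc(4,6) by auto
  obtain p v where pv': "pass sim_transducer q (program_word (Tick # is) @ d) = (p, v)"
    "v @ final_output sim_transducer p = program_word (is @ [Tick]) @ run_instr Tick d"
    "verdict sim_transducer p = (if Tick = Tick \<and> fuel d = 0 then Accept else Again Fetch)"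
    by (rule fetch_pass[OF Suc(3) h])
  note pv = pv'(1,2) pv'(3)[folded Suc(2), simplified]
  let ?d = "run_program is (run_instr Tick d)"
  have t: "is_data (run_instr Tick d)" "length (run_instr Tick d) = length d" "fuel (run_instr Tick d) = k"
    using run_instr_data(1,2)[OF Suc(3), of Tick] run_instr_data(4)[OF Suc(3)] Suc(2)[symmetric] by simp_all
  have d: "is_data ?d" "length ?d = length d" "fuel ?d = k"
    using run_program_data[OF t(1) Suc(4)] t by simp_all
  have L: "length (v @ final_output sim_transducer p) \<le> L"
    unfolding pv(2) using Suc(5) t(2) by simp
  have same: "sim_result is ?d = sim_result is d"
    unfolding sim_result_def d(3) Suc(2)[symmetric] by (simp only: funpow_Suc_right comp_apply)
  have "exec sim_transducer L (k * (length is + 1) + 1) Fetch (program_word (Tick # is) @ ?d) (Some (sim_result is d))"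
    using Suc(1)[of ?d Fetch] d Suc(4,5) same by simp
  then have "exec sim_transducer L (k * (length is + 1) + 1 + length is) Fetch
     (program_word (is @ [Tick]) @ run_instr Tick d) (Some (sim_result is d))"
    by (intro sim_exec_program t(1) Suc(4)) (use Suc(5) t(2) in auto)
  then have "exec sim_transducer L (Suc (k * (length is + 1) + 1 + length is)) q
     (program_word (Tick # is) @ d) (Some (sim_result is d))"
    using exec_again[OF pv(1,3) _ L] Suc(5) unfolding pv(2) by simp
  then show ?case unfolding Suc(2)[symmetric] by (simp add: add_ac)
qed

lemma data_or_fail:
  "\<not> is_data d \<Longrightarrow> fst (pass sim_transducer (Data i c l) d) = Fail"
proof (induction d arbitrary: c l)
  case (Cons s d)
  show ?case
  proof (cases "fst s \<in> range Reg \<union> range Sep")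
    case True
    then have nd: "\<not> is_data d" using Cons.prems by simp
    have "\<exists>c' l'. fst (data_move i c l s) = Data i c' l'"
      using True by (cases "(i, c, l, s)" rule: data_move.cases) (auto split: instr.split)
    then show ?thesis using Cons.IH[OF nd] by (auto split: prod.splits) (metis fst_conv)
  next
    case False
    then have "data_move i c l s = (Fail, [])"
      by (cases "(i, c, l, s)" rule: data_move.cases) auto
    then show ?thesis by (simp add: fail_pass)
  qed
qed simp

text \<open>
  Inputs of any other form are rejected in the first pass.  This is what guarantees termination, as a
  program without \<open>Tick\<close> would run forever.
\<close>

lemma program_or_fail:
  "(\<exists>is d. w = program_word is @ d \<and> Tick \<notin> set is \<and> is_data d) \<or>
     fst (pass sim_transducer (Program Tick) w) = Fail"
proof (induction w)
  case Nil
  show ?case by (intro disjI1 exI[of _ "[]"]) simp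
next
  case (Cons s w)
  obtain x f where s: "s = (x, f)" by (cases s)
  show ?case
  proof (cases "\<exists>j. x = Instr j")
    case True
    then obtain j where x: "x = Instr j" by blast
    show ?thesis
    proof (cases "f \<or> j = Tick")
      case True
      then show ?thesis using s x by (simp add: fail_pass)
    next
      case False
      from Cons.IH show ?thesis
      proof
        assume "\<exists>is d. w = program_word is @ d \<and> Tick \<notin> set is \<and> is_data d"
        then obtain "is" d where "w = program_word is @ d" "Tick \<notin> set is" "is_data d" by blast
        then have "s # w = program_word (j # is) @ d" "Tick \<notin> set (j # is)" "is_data d"
          using False s x by auto
        then show ?thesis by blast
      next
        assume "fst (pass sim_transducer (Program Tick) w) = Fail"
        then show ?thesis using False s x by (auto split: prod.splits)
      qed
    qed
  next
    case False
    then have m: "sim_move (Program Tick) s =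
        (let (q, u) = data_move Tick False At_start s in (q, (Instr Tick, False) # u))"
      using s by (cases x) auto
    show ?thesis
    proof (cases "is_data (s # w)")
      case True
      then show ?thesis by (intro disjI1 exI[of _ "[]"] exI[of _ "s # w"]) simp
    next
      case bad: False
      from data_or_fail[OF this, of Tick False At_start] show ?thesis
        using m by (auto split: prod.splits)
    qed
  qed
qed

lemma data_move_length: "length (snd (data_move i c l s)) \<le> 2"
  by (cases "(i, c, l, s)" rule: data_move.cases) (auto split: instr.split place.split)

lemma sim_move_length: "length (snd (sim_move q s)) \<le> 3"
proof (cases q)
  case (Program i)
  obtain x f where s: "s = (x, f)" by (cases s)
  show ?thesis
  proof (cases "\<exists>j. x = Instr j")
    case True
    then show ?thesis using Program s by auto
  next
    case False
    then have "snd (sim_move q s) = (Instr i, False) # snd (data_move i False At_start s)"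
      using Program s by (cases x) (auto simp: case_prod_beta simp del: data_move.simps)
    then show ?thesis using data_move_length[of i False At_start s] by simp
  qed
next
  case (Data i c l)
  then show ?thesis using data_move_length[of i c l s] by (simp add: le_SucI del: data_move.simps)
qed simp_all

lemma sim_pass_length: "length (snd (pass sim_transducer q w)) \<le> 3 * length w"
proof (induction w arbitrary: q)
  case (Cons s w)
  obtain p u where p: "sim_move q s = (p, u)" by (cases "sim_move q s")
  obtain p' v where v: "pass sim_transducer p w = (p', v)" by (cases "pass sim_transducer p w")
  show ?case using sim_move_length[of q s] Cons.IH[of p] p v by simp
qed simp

lemma program_word_inj:
  "program_word is @ d = program_word js @ e \<Longrightarrow> is_data d \<Longrightarrow> is_data e \<Longrightarrow> is = js \<and> d = e"
proof (induction "is" arbitrary: js)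
  case Nil
  then show ?case by (cases js) auto
next
  case (Cons i ks)
  then show ?case by (cases js) auto
qed

lemma sim_result_length:
  assumes "Tick \<notin> set is" "is_data d"
  shows "length (sim_result is d) = length is + 1 + length d"
proof -
  have "is_data (((\<lambda>d. run_program is (run_instr Tick d)) ^^ n) d) \<and>
      length (((\<lambda>d. run_program is (run_instr Tick d)) ^^ n) d) = length d" for n
  proof (induction n)
    case (Suc n)
    then show ?case using run_program_data[OF run_instr_data(1) assms(1)] run_instr_data(2) by simp
  qed (use assms(2) in simp)
  then show ?thesis using run_instr_data(2) by (simp add: sim_result_def)
qed

lemma begin_rejects:
  assumes "\<nexists>is d. w = program_word (Tick # is) @ d \<and> Tick \<notin> set is \<and> is_data d"
    and pv: "pass sim_transducer Begin w = (p, v)"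
  shows "p = Begin \<or> p = Fail"
proof (cases w)
  case Nil
  then show ?thesis using pv by simp
next
  case (Cons s w')
  show ?thesis
  proof (cases "s = (Instr Tick, False)")
    case True
    have "\<nexists>is d. w' = program_word is @ d \<and> Tick \<notin> set is \<and> is_data d"
      using assms(1) Cons True by simp
    then have "fst (pass sim_transducer (Program Tick) w') = Fail" using program_or_fail[of w'] by blast
    then show ?thesis using pv Cons True by (auto split: prod.splits)
  next
    case False
    then show ?thesis using pv Cons by (auto simp: fail_pass)
  qed
qed

definition universal :: "(sym list \<rightharpoonup> sym list) \<Rightarrow> bool" where
  "universal U \<longleftrightarrow> (\<forall>is d. Tick \<notin> set is \<longrightarrow> is_data d \<longrightarrow>
     U (program_word (Tick # is) @ d) = Some (sim_result is d))"

lemma ex_simulator: obtains U where "polytime U" "word_balanced U" "universal U"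
proof -
  define R where "R w r \<longleftrightarrow> (\<forall>v. r = Some v \<longrightarrow> length v = length w) \<and>
      (\<forall>is d. w = program_word (Tick # is) @ d \<longrightarrow> Tick \<notin> set is \<longrightarrow> is_data d \<longrightarrow> r = Some (sim_result is d))"
    for w r
  define b :: "nat \<Rightarrow> nat" where "b n = n * (n + 1) + 3 * n + 1" for n
  have "\<exists>r. (\<exists>n\<le>b (length w). exec sim_transducer (b (length w)) n (init sim_transducer) w r) \<and> R w r" for w
  proof (cases "\<exists>is d. w = program_word (Tick # is) @ d \<and> Tick \<notin> set is \<and> is_data d")
    case True
    then obtain "is" d where w: "w = program_word (Tick # is) @ d" "Tick \<notin> set is" "is_data d" by blast
    have lw: "length w = length is + 1 + length d" using w(1) by simp
    have "fuel d \<le> length d" by (simp add: fuel_def)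
    then have "fuel d * (length is + 1) \<le> length w * (length w + 1)"
      using lw by (intro mult_le_mono) simp_all
    then have "fuel d * (length is + 1) + 1 \<le> b (length w)" by (simp add: b_def)
    moreover have "exec sim_transducer (b (length w)) (fuel d * (length is + 1) + 1) Begin w (Some (sim_result is d))"
      unfolding w(1) by (rule sim_exec[OF w(3,2)]) (simp_all add: b_def)
    moreover have "R w (Some (sim_result is d))"
      unfolding R_def
    proof (intro conjI allI impI)
      fix v assume "Some (sim_result is d) = Some v"
      then show "length v = length w" using sim_result_length[OF w(2,3)] lw by auto
    next
      fix js e assume "w = program_word (Tick # js) @ e" "Tick \<notin> set js" "is_data e"
      then have "is = js \<and> d = e" using w by (intro program_word_inj) simp_all
      then show "Some (sim_result is d) = Some (sim_result js e)" by simp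
    qed
    ultimately show ?thesis unfolding sim_simps(1) by blast
  next
    case False
    obtain p v where pv: "pass sim_transducer Begin w = (p, v)" by (cases "pass sim_transducer Begin w")
    have "length (snd (pass sim_transducer Begin w)) \<le> 3 * length w" by (rule sim_pass_length)
    then have "length v \<le> 3 * length w" using pv by simp
    then have "exec sim_transducer (b (length w)) (Suc 0) Begin w None"
      by (intro exec_reject[OF pv]) (use begin_rejects[OF False pv] in \<open>auto simp: b_def\<close>)
    moreover have "Suc 0 \<le> b (length w)" by (simp add: b_def)
    moreover have "R w None" using False unfolding R_def by blast
    ultimately show ?thesis unfolding sim_simps(1) by blast
  qed
  moreover have "finite_states sim_transducer UNIV" by (simp add: finite_states_def)
  moreover have "poly_bounded b" unfolding b_def
    by (intro poly_bounded_add poly_bounded_mult poly_bounded_const poly_bounded_id)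
  ultimately obtain U where U: "polytime U" "\<And>w. R w (U w)"
    using polytime_transducer_choice[of sim_transducer UNIV b R] by blast
  have "word_balanced U"
    by (rule word_balancedI[of "\<lambda>n. n"]) (use U(2) in \<open>auto simp: poly_bounded_id monoI R_def\<close>)
  moreover have "universal U" using U(2) unfolding R_def universal_def by blast
  ultimately show thesis using U(1) that by blast
qed


subsection \<open>The effect of a program on planes of registers\<close>

type_synonym planes = "nat \<Rightarrow> nat \<Rightarrow> bool"

definition reg_word :: "bool list \<Rightarrow> sym list" where
  "reg_word rs = map (\<lambda>b. (Reg b, False)) rs"

definition cell_word :: "bool list \<Rightarrow> bool \<Rightarrow> bool \<Rightarrow> sym list" where
  "cell_word rs a f = reg_word rs @ [(Sep a, f)]"

text \<open>
  Register \<open>k\<close> of cell \<open>i\<close> contains \<open>S k i\<close>; a row \<open>S k\<close> of such bits is called a plane.  The list \<open>ks\<close>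
  gives the current order of the registers in the cells, so that rotation changes only \<open>ks\<close>.
\<close>

definition array_word :: "nat list \<Rightarrow> nat \<Rightarrow> planes \<Rightarrow> (nat \<Rightarrow> bool) \<Rightarrow> (nat \<Rightarrow> bool) \<Rightarrow> sym list" where
  "array_word ks N S \<alpha> \<phi> = concat (map (\<lambda>i. cell_word (map (\<lambda>k. S k i) ks) (\<alpha> i) (\<phi> i)) [0..<N])"

lemma reg_word_simps [simp]:
  "reg_word [] = []" "reg_word (b # rs) = (Reg b, False) # reg_word rs"
  "reg_word (rs @ rs') = reg_word rs @ reg_word rs'" "length (reg_word rs) = length rs"
  by (simp_all add: reg_word_def)

lemma is_data_reg_word [simp]: "is_data (reg_word rs)" "fuel (reg_word rs) = 0"
  by (induction rs) simp_all

lemma is_data_cell_word [simp]: "is_data (cell_word rs a f)" "fuel (cell_word rs a f) = (if f then 0 else 1)"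
  by (simp_all add: cell_word_def)

lemma is_data_concat: "(\<And>i. i \<in> set is \<Longrightarrow> is_data (g i)) \<Longrightarrow> is_data (concat (map g is))"
  by (induction "is") simp_all

lemma is_data_array_word [simp]: "is_data (array_word ks N S \<alpha> \<phi>)"
  unfolding array_word_def by (rule is_data_concat) simp

lemma array_word_cong:
  assumes "\<And>k i. k \<in> set ks \<Longrightarrow> i < N \<Longrightarrow> S k i = S' k i" "\<And>i. i < N \<Longrightarrow> \<alpha> i = \<alpha>' i"
    "\<And>i. i < N \<Longrightarrow> \<phi> i = \<phi>' i"
  shows "array_word ks N S \<alpha> \<phi> = array_word ks N S' \<alpha>' \<phi>'"
proof -
  have m: "map (\<lambda>k. S k i) ks = map (\<lambda>k. S' k i) ks" if "i < N" for i
    using assms(1) that by (intro map_cong) auto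
  then show ?thesis unfolding array_word_def
    by (intro arg_cong[of _ _ concat] map_cong) (use assms(2,3) in \<open>auto simp: m\<close>)
qed

text \<open>
  An arbitrary carry \<open>c\<close> is needed for induction along the array.
\<close>

definition instr_output :: "instr \<Rightarrow> bool \<Rightarrow> sym list \<Rightarrow> sym list" where
  "instr_output i c d = (let (p, v) = pass sim_transducer (Data i c At_start) d
     in v @ final_output sim_transducer p)"

lemma run_instr_output: "run_instr i d = instr_output i False d"
  by (simp add: run_instr_def instr_output_def)

lemma instr_output_Nil [simp]: "instr_output i c [] = []"
  by (simp add: instr_output_def)

lemma pass_reg_word:
  "l \<noteq> At_start \<Longrightarrow> pass sim_transducer (Data i c l) (reg_word rs @ w) =
     (let (p, v) = pass sim_transducer (Data i c l) w in (p, reg_word rs @ v))"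
  by (induction rs) (auto split: prod.splits)

lemma instr_output_cell:
  "instr_output Load c (cell_word (r # rs) a f @ w) = cell_word (r # rs) (c \<and> r) f @ instr_output Load a w"
  "instr_output Store c (cell_word (r # rs) a f @ w) = cell_word ((r \<or> c) # rs) True f @ instr_output Store a w"
  "instr_output Clear c (cell_word (r # rs) a f @ w) = cell_word (False # rs) a f @ instr_output Clear c w"
  "instr_output Rot c (cell_word (r # rs) a f @ w) = cell_word (rs @ [r]) a f @ instr_output Rot c w"
  "instr_output Tick c (cell_word (r # rs) a f @ w) = cell_word (r # rs) a (f \<or> \<not> c) @ instr_output Tick (c \<or> \<not> f) w"
  by (auto simp: instr_output_def cell_word_def pass_reg_word split: prod.splits)

lemma upt_split: "[m..<m + Suc n] = m # [Suc m..<Suc m + n]"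
  by (simp add: upt_conv_Cons del: upt_Suc)

lemma load_array:
  assumes ks: "ks = k # ks'"
  shows "run_instr Load (array_word ks N S \<alpha> \<phi>) = array_word ks N S (\<lambda>i. i > 0 \<and> \<alpha> (i - 1) \<and> S k i) \<phi>"
proof -
  have "instr_output Load c (concat (map (\<lambda>i. cell_word (map (\<lambda>k. S k i) ks) (\<alpha> i) (\<phi> i)) [m..<m + n]))
      = concat (map (\<lambda>i. cell_word (map (\<lambda>k. S k i) ks) ((if i = m then c else \<alpha> (i - 1)) \<and> S k i) (\<phi> i)) [m..<m + n])"
    for c m n
  proof (induction n arbitrary: c m)
    case (Suc n)
    let ?w = "concat (map (\<lambda>i. cell_word (map (\<lambda>k. S k i) ks) (\<alpha> i) (\<phi> i)) [Suc m..<Suc m + n])"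
    have 1: "instr_output Load c (cell_word (map (\<lambda>k. S k m) ks) (\<alpha> m) (\<phi> m) @ ?w)
        = cell_word (map (\<lambda>k. S k m) ks) (c \<and> S k m) (\<phi> m) @ instr_output Load (\<alpha> m) ?w"
      by (simp add: ks instr_output_cell)
    have eq: "map (\<lambda>i. cell_word (map (\<lambda>k. S k i) ks) ((if i = Suc m then \<alpha> m else \<alpha> (i - 1)) \<and> S k i) (\<phi> i)) [Suc m..<Suc m + n]
        = map (\<lambda>i. cell_word (map (\<lambda>k. S k i) ks) ((if i = m then c else \<alpha> (i - 1)) \<and> S k i) (\<phi> i)) [Suc m..<Suc m + n]"
      by (intro map_cong) auto
    show ?case unfolding upt_split list.map concat.simps 1 Suc.IH eq by simp
  qed simp
  from this[of False 0 N] have "run_instr Load (array_word ks N S \<alpha> \<phi>) =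
      array_word ks N S (\<lambda>i. (if i = 0 then False else \<alpha> (i - 1)) \<and> S k i) \<phi>"
    by (simp add: run_instr_output array_word_def)
  also have "\<dots> = array_word ks N S (\<lambda>i. i > 0 \<and> \<alpha> (i - 1) \<and> S k i) \<phi>"
    by (rule array_word_cong) auto
  finally show ?thesis .
qed

lemma store_array:
  assumes ks: "ks = k # ks'" "k \<notin> set ks'"
  shows "run_instr Store (array_word ks N S \<alpha> \<phi>)
    = array_word ks N (S(k := \<lambda>i. S k i \<or> i > 0 \<and> \<alpha> (i - 1))) (\<lambda>_. True) \<phi>"
proof -
  have "instr_output Store c (concat (map (\<lambda>i. cell_word (map (\<lambda>k. S k i) ks) (\<alpha> i) (\<phi> i)) [m..<m + n]))
      = concat (map (\<lambda>i. cell_word ((S k i \<or> (if i = m then c else \<alpha> (i - 1))) # map (\<lambda>k. S k i) ks') True (\<phi> i)) [m..<m + n])"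
    for c m n
  proof (induction n arbitrary: c m)
    case (Suc n)
    let ?w = "concat (map (\<lambda>i. cell_word (map (\<lambda>k. S k i) ks) (\<alpha> i) (\<phi> i)) [Suc m..<Suc m + n])"
    have 1: "instr_output Store c (cell_word (map (\<lambda>k. S k m) ks) (\<alpha> m) (\<phi> m) @ ?w)
        = cell_word ((S k m \<or> c) # map (\<lambda>k. S k m) ks') True (\<phi> m) @ instr_output Store (\<alpha> m) ?w"
      by (simp add: ks instr_output_cell)
    have eq: "map (\<lambda>i. cell_word ((S k i \<or> (if i = Suc m then \<alpha> m else \<alpha> (i - 1))) # map (\<lambda>k. S k i) ks') True (\<phi> i)) [Suc m..<Suc m + n]
        = map (\<lambda>i. cell_word ((S k i \<or> (if i = m then c else \<alpha> (i - 1))) # map (\<lambda>k. S k i) ks') True (\<phi> i)) [Suc m..<Suc m + n]"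
      by (intro map_cong) auto
    show ?case unfolding upt_split list.map concat.simps 1 Suc.IH eq by simp
  qed simp
  from this[of False 0 N] have "run_instr Store (array_word ks N S \<alpha> \<phi>) =
      concat (map (\<lambda>i. cell_word ((S k i \<or> (if i = 0 then False else \<alpha> (i - 1))) # map (\<lambda>k. S k i) ks') True (\<phi> i)) [0..<N])"
    by (simp add: run_instr_output array_word_def)
  also have "\<dots> = array_word ks N (S(k := \<lambda>i. S k i \<or> i > 0 \<and> \<alpha> (i - 1))) (\<lambda>_. True) \<phi>"
  proof -
    have nn: "map (\<lambda>l. (S(k := \<lambda>i. S k i \<or> i > 0 \<and> \<alpha> (i - 1))) l i) ks' = map (\<lambda>l. S l i) ks'" for i
      using ks(2) by (intro map_cong) auto
    show ?thesis unfolding array_word_def ks(1) list.map fun_upd_same nn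
      by (intro arg_cong[of _ _ concat] map_cong) auto
  qed
  finally show ?thesis .
qed

lemma clear_array:
  assumes ks: "ks = k # ks'" "k \<notin> set ks'"
  shows "run_instr Clear (array_word ks N S \<alpha> \<phi>) = array_word ks N (S(k := \<lambda>_. False)) \<alpha> \<phi>"
proof -
  have "instr_output Clear c (concat (map (\<lambda>i. cell_word (map (\<lambda>k. S k i) ks) (\<alpha> i) (\<phi> i)) is))
      = concat (map (\<lambda>i. cell_word (False # map (\<lambda>k. S k i) ks') (\<alpha> i) (\<phi> i)) is)" for c "is"
    by (induction "is" arbitrary: c) (simp_all add: ks instr_output_cell)
  moreover have nn: "map (\<lambda>l. (S(k := \<lambda>_. False)) l i) ks' = map (\<lambda>l. S l i) ks'" for i
    using ks(2) by (intro map_cong) auto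
  ultimately show ?thesis unfolding run_instr_output array_word_def
    by (simp only: ks(1) list.map fun_upd_same nn)
qed

lemma rot_array:
  assumes ks: "ks \<noteq> []"
  shows "run_instr Rot (array_word ks N S \<alpha> \<phi>) = array_word (rotate1 ks) N S \<alpha> \<phi>"
proof -
  obtain k ks' where k: "ks = k # ks'" using ks by (cases ks) auto
  have "instr_output Rot c (concat (map (\<lambda>i. cell_word (map (\<lambda>k. S k i) ks) (\<alpha> i) (\<phi> i)) is))
      = concat (map (\<lambda>i. cell_word (map (\<lambda>k. S k i) (rotate1 ks)) (\<alpha> i) (\<phi> i)) is)" for c "is"
    by (induction "is" arbitrary: c) (simp_all add: k instr_output_cell)
  then show ?thesis by (simp add: run_instr_output array_word_def)
qed

lemma tick_array:
  assumes ks: "ks \<noteq> []"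
  shows "\<exists>\<phi>'. run_instr Tick (array_word ks N S \<alpha> \<phi>) = array_word ks N S \<alpha> \<phi>'"
proof -
  obtain k ks' where k: "ks = k # ks'" using ks by (cases ks) auto
  have "\<exists>\<phi>'. instr_output Tick c (concat (map (\<lambda>i. cell_word (map (\<lambda>k. S k i) ks) (\<alpha> i) (\<phi> i)) [m..<m + n]))
      = concat (map (\<lambda>i. cell_word (map (\<lambda>k. S k i) ks) (\<alpha> i) (\<phi>' i)) [m..<m + n])" for c m n
  proof (induction n arbitrary: c m)
    case (Suc n)
    obtain \<phi>' where \<phi>': "instr_output Tick (c \<or> \<not> \<phi> m) (concat (map (\<lambda>i. cell_word (map (\<lambda>k. S k i) ks) (\<alpha> i) (\<phi> i)) [Suc m..<Suc m + n]))
      = concat (map (\<lambda>i. cell_word (map (\<lambda>k. S k i) ks) (\<alpha> i) (\<phi>' i)) [Suc m..<Suc m + n])"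
      using Suc.IH by blast
    let ?\<psi> = "\<phi>'(m := \<phi> m \<or> \<not> c)"
    let ?w = "concat (map (\<lambda>i. cell_word (map (\<lambda>k. S k i) ks) (\<alpha> i) (\<phi> i)) [Suc m..<Suc m + n])"
    have 1: "instr_output Tick c (cell_word (map (\<lambda>k. S k m) ks) (\<alpha> m) (\<phi> m) @ ?w)
        = cell_word (map (\<lambda>k. S k m) ks) (\<alpha> m) (?\<psi> m) @ instr_output Tick (c \<or> \<not> \<phi> m) ?w"
      by (simp add: k instr_output_cell)
    have eq: "map (\<lambda>i. cell_word (map (\<lambda>k. S k i) ks) (\<alpha> i) (?\<psi> i)) [Suc m..<Suc m + n]
        = map (\<lambda>i. cell_word (map (\<lambda>k. S k i) ks) (\<alpha> i) (\<phi>' i)) [Suc m..<Suc m + n]"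
      by (intro map_cong) auto
    show ?case unfolding upt_split list.map concat.simps 1 \<phi>'
      by (intro exI[of _ ?\<psi>]) (simp only: eq list.map concat.simps)
  qed simp
  from this[of False 0 N] show ?thesis by (simp add: run_instr_output array_word_def)
qed

fun effect :: "nat \<times> instr \<Rightarrow> planes \<times> (nat \<Rightarrow> bool) \<Rightarrow> planes \<times> (nat \<Rightarrow> bool)" where
  "effect (k, Load) (S, \<alpha>) = (S, \<lambda>i. i > 0 \<and> \<alpha> (i - 1) \<and> S k i)"
| "effect (k, Store) (S, \<alpha>) = (S(k := \<lambda>i. S k i \<or> i > 0 \<and> \<alpha> (i - 1)), \<lambda>_. True)"
| "effect (k, Clear) (S, \<alpha>) = (S(k := \<lambda>_. False), \<alpha>)"
| "effect _ c = c"

text \<open>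
  Register \<open>k\<close> is rotated to the front, and the rotation is completed to a full turn afterwards.
\<close>

definition on_register :: "nat \<Rightarrow> nat \<times> instr \<Rightarrow> instr list" where
  "on_register B ki = replicate (fst ki) Rot @ [snd ki] @ replicate (B - fst ki) Rot"

lemma rotate_array:
  "ks \<noteq> [] \<Longrightarrow> run_program (replicate j Rot) (array_word ks N S \<alpha> \<phi>) = array_word (rotate j ks) N S \<alpha> \<phi>"
proof (induction j arbitrary: ks)
  case (Suc j)
  then show ?case using Suc.IH[of "rotate1 ks"] by (simp add: rot_array rotate_def funpow_swap1)
qed simp

lemma run_on_register:
  assumes "k < B" "i \<in> {Load, Store, Clear}" "effect (k, i) (S, \<alpha>) = (S', \<alpha>')"
  shows "run_program (on_register B (k, i)) (array_word [0..<B] N S \<alpha> \<phi>) = array_word [0..<B] N S' \<alpha>' \<phi>"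
proof -
  have r: "rotate k [0..<B] = k # ([Suc k..<B] @ [0..<k])"
  proof -
    have "k mod length [0..<B] = k" using assms(1) by simp
    then show ?thesis unfolding rotate_drop_take
      using assms(1) by (simp only: drop_upt take_upt add_0 upt_conv_Cons[of k B] append_Cons less_imp_le)
  qed
  have full: "rotate (B - k) (rotate k [0..<B]) = [0..<B]"
    using assms(1) by (simp add: rotate_rotate)
  have ne: "[0..<B] \<noteq> []" "rotate k [0..<B] \<noteq> []" using assms(1) by auto
  have nin: "k \<notin> set ([Suc k..<B] @ [0..<k])" by simp
  have "run_instr i (array_word (rotate k [0..<B]) N S \<alpha> \<phi>) = array_word (rotate k [0..<B]) N S' \<alpha>' \<phi>"
    using assms(2,3) load_array[OF r] store_array[OF r nin] clear_array[OF r nin] by auto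
  then show ?thesis using rotate_array[OF ne(1)] rotate_array[OF ne(2)] full
    by (simp add: on_register_def)
qed

lemma run_registers:
  assumes "\<And>k i. (k, i) \<in> set kis \<Longrightarrow> k < B \<and> i \<in> {Load, Store, Clear}"
    "fold effect kis (S, \<alpha>) = (S', \<alpha>')"
  shows "run_program (concat (map (on_register B) kis)) (array_word [0..<B] N S \<alpha> \<phi>) = array_word [0..<B] N S' \<alpha>' \<phi>"
  using assms
proof (induction kis arbitrary: S \<alpha>)
  case (Cons ki kis)
  obtain k i where ki: "ki = (k, i)" by (cases ki)
  obtain S1 \<alpha>1 where e: "effect (k, i) (S, \<alpha>) = (S1, \<alpha>1)" by (cases "effect (k, i) (S, \<alpha>)")
  have "run_program (on_register B (k, i)) (array_word [0..<B] N S \<alpha> \<phi>) = array_word [0..<B] N S1 \<alpha>1 \<phi>"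
    by (rule run_on_register[OF _ _ e]) (use Cons.prems(1)[of k i] ki in auto)
  moreover have "run_program (concat (map (on_register B) kis)) (array_word [0..<B] N S1 \<alpha>1 \<phi>) = array_word [0..<B] N S' \<alpha>' \<phi>"
    by (rule Cons.IH) (use Cons.prems ki e in auto)
  ultimately show ?case by (simp add: ki)
qed simp

subsection \<open>A program for one step of a cellular automaton\<close>

definition triples :: "nat \<Rightarrow> (nat \<times> nat \<times> nat) list" where
  "triples n = List.product [0..<n] (List.product [0..<n] [0..<n])"

definition rule_part :: "nat \<Rightarrow> (nat \<Rightarrow> nat \<Rightarrow> nat \<Rightarrow> nat) \<Rightarrow> nat \<times> nat \<times> nat \<Rightarrow> (nat \<times> instr) list" where
  "rule_part n F = (\<lambda>(a, b, c). [(a, Load), (b, Load), (c, Load), (n + F a b c, Store)])"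

definition copy_part :: "nat \<Rightarrow> nat \<Rightarrow> (nat \<times> instr) list" where
  "copy_part n k = [(k, Clear), (n + k, Load), (k, Store), (n + k, Clear)]"

text \<open>
  Registers \<open>k < n\<close> say whether the cell is in state \<open>k\<close>; registers \<open>n + k\<close> collect the new states.  If all
  accumulators are true, then loading \<open>a\<close>, \<open>b\<close> and \<open>c\<close> in turn leaves an accumulator true iff its cell
  and the two cells before it are in the states \<open>c\<close>, \<open>b\<close>, \<open>a\<close>; then \<open>Store\<close> enters the new state of the
  middle cell in the next cell and makes all accumulators true again.  When all triples have been treated,
  the new states are moved to the first \<open>n\<close> registers.
\<close>

definition automaton_step :: "nat \<Rightarrow> (nat \<Rightarrow> nat \<Rightarrow> nat \<Rightarrow> nat) \<Rightarrow> (nat \<times> instr) list" where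
  "automaton_step n F = concat (map (rule_part n F) (triples n)) @ concat (map (copy_part n) [0..<n])"

text \<open>
  The new state of a cell is found three cells to the right: two of these come from \<open>rule_part\<close>, where the
  middle of the triple lies two cells before the cell written, and one from \<open>copy_part\<close>.  Near the left end
  of the array there are no predecessors to be read, and no state is entered.
\<close>

definition next_planes :: "nat \<Rightarrow> (nat \<Rightarrow> nat \<Rightarrow> nat \<Rightarrow> nat) \<Rightarrow> planes \<Rightarrow> planes" where
  "next_planes n F S k i =
     (if k < n then i \<ge> 5 \<and> (\<exists>a<n. \<exists>b<n. \<exists>c<n. F a b c = k \<and> S a (i - 4) \<and> S b (i - 3) \<and> S c (i - 2))
      else if k < 2 * n then False else S k i)"

definition fires :: "planes \<Rightarrow> nat \<times> nat \<times> nat \<Rightarrow> nat \<Rightarrow> bool" where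
  "fires S = (\<lambda>(a, b, c) i. i \<ge> 4 \<and> S a (i - 3) \<and> S b (i - 2) \<and> S c (i - 1))"

text \<open>
  The first \<open>n\<close> planes are read but not changed by these parts of the program; \<open>S0\<close> stands for them while
  the other planes of \<open>S\<close> accumulate the new states.
\<close>

lemma fold_rule_parts:
  assumes "\<And>a b c. (a, b, c) \<in> set ts \<Longrightarrow> a < n \<and> b < n \<and> c < n"
    "\<And>k. k < n \<Longrightarrow> S k = S0 k"
  shows "fold effect (concat (map (rule_part n F) ts)) (S, \<lambda>_. True) =
    ((\<lambda>k i. S k i \<or> (\<exists>(a, b, c)\<in>set ts. k = n + F a b c \<and> fires S0 (a, b, c) i)), \<lambda>_. True)"
  using assms
proof (induction ts arbitrary: S)
  case (Cons t ts)
  obtain a b c where t: "t = (a, b, c)" by (cases t)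
  have abc: "a < n" "b < n" "c < n" using Cons.prems(1)[of a b c] t by auto
  let ?S = "S(n + F a b c := \<lambda>i. S (n + F a b c) i \<or> fires S0 (a, b, c) i)"
  have one: "fold effect (rule_part n F t) (S, \<lambda>_. True) = (?S, \<lambda>_. True)"
    using abc Cons.prems(2)
    by (auto simp: rule_part_def t fires_def fun_eq_iff numeral_eq_Suc Suc_le_eq)
  have IH: "fold effect (concat (map (rule_part n F) ts)) (?S, \<lambda>_. True) =
    ((\<lambda>k i. ?S k i \<or> (\<exists>(a, b, c)\<in>set ts. k = n + F a b c \<and> fires S0 (a, b, c) i)), \<lambda>_. True)"
    by (rule Cons.IH) (use Cons.prems in auto)
  show ?case using one IH by (auto simp: t fun_eq_iff)
qed simp

lemma fold_copy_parts:
  assumes "distinct ks" "\<And>k. k \<in> set ks \<Longrightarrow> k < n"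
  shows "fold effect (concat (map (copy_part n) ks)) (S, \<lambda>_. True) =
    ((\<lambda>k i. if k \<in> set ks then i \<ge> 2 \<and> S (n + k) (i - 1)
            else if k \<ge> n \<and> k - n \<in> set ks then False else S k i), \<lambda>_. True)"
  using assms
proof (induction ks arbitrary: S)
  case (Cons k ks)
  let ?S = "S(k := \<lambda>i. i \<ge> 2 \<and> S (n + k) (i - 1), n + k := \<lambda>_. False)"
  have k: "k < n" using Cons.prems(2) by simp
  have one: "fold effect (copy_part n k) (S, \<lambda>_. True) = (?S, \<lambda>_. True)"
    using k by (auto simp: copy_part_def fun_eq_iff numeral_eq_Suc Suc_le_eq)
  have IH: "fold effect (concat (map (copy_part n) ks)) (?S, \<lambda>_. True) =
    ((\<lambda>k i. if k \<in> set ks then i \<ge> 2 \<and> ?S (n + k) (i - 1)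
            else if k \<ge> n \<and> k - n \<in> set ks then False else ?S k i), \<lambda>_. True)"
    by (rule Cons.IH) (use Cons.prems in auto)
  have lt: "j < n" if "j \<in> set ks" for j using Cons.prems(2) that by simp
  show ?case using one IH k Cons.prems(1)
    by (auto simp: fun_eq_iff dest: lt)
qed simp

lemma fold_automaton_step:
  assumes "\<And>k i. n \<le> k \<Longrightarrow> k < 2 * n \<Longrightarrow> \<not> S k i"
    and F: "\<And>a b c. a < n \<Longrightarrow> b < n \<Longrightarrow> c < n \<Longrightarrow> F a b c < n"
  shows "fold effect (automaton_step n F) (S, \<lambda>_. True) = (next_planes n F S, \<lambda>_. True)"
proof -
  let ?S1 = "\<lambda>k i. S k i \<or> (\<exists>(a, b, c)\<in>set (triples n). k = n + F a b c \<and> fires S (a, b, c) i)"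
  have 1: "fold effect (concat (map (rule_part n F) (triples n))) (S, \<lambda>_. True) = (?S1, \<lambda>_. True)"
    by (rule fold_rule_parts) (auto simp: triples_def)
  have 2: "fold effect (concat (map (copy_part n) [0..<n])) (?S1, \<lambda>_. True) =
    ((\<lambda>k i. if k \<in> set [0..<n] then i \<ge> 2 \<and> ?S1 (n + k) (i - 1)
            else if k \<ge> n \<and> k - n \<in> set [0..<n] then False else ?S1 k i), \<lambda>_. True)"
    by (rule fold_copy_parts) auto
  have "(if k \<in> set [0..<n] then i \<ge> 2 \<and> ?S1 (n + k) (i - 1)
            else if k \<ge> n \<and> k - n \<in> set [0..<n] then False else ?S1 k i) = next_planes n F S k i" for k i
  proof -
    consider "k < n" | "n \<le> k" "k < 2 * n" | "2 * n \<le> k" by linarith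
    then show ?thesis
    proof cases
      case 1
      have "\<not> S (n + k) (i - 1)" using assms(1)[of "n + k" "i - 1"] 1 by simp
      moreover have f: "fires S (a, b, c) (i - 1) \<longleftrightarrow> i \<ge> 5 \<and> S a (i - 4) \<and> S b (i - 3) \<and> S c (i - 2)" for a b c
      proof -
        have "i - 1 - 3 = i - 4" "i - 1 - 2 = i - 3" "i - 1 - 1 = i - 2" "4 \<le> i - 1 \<longleftrightarrow> 5 \<le> i" by arith+
        then show ?thesis unfolding fires_def by simp
      qed
      have "(\<exists>(a, b, c)\<in>set (triples n). n + k = n + F a b c \<and> fires S (a, b, c) (i - 1)) \<longleftrightarrow>
          i \<ge> 5 \<and> (\<exists>a<n. \<exists>b<n. \<exists>c<n. F a b c = k \<and> S a (i - 4) \<and> S b (i - 3) \<and> S c (i - 2))"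
        unfolding f triples_def by (auto simp: Bex_def)
      ultimately have "(i \<ge> 2 \<and> ?S1 (n + k) (i - 1)) \<longleftrightarrow>
          i \<ge> 5 \<and> (\<exists>a<n. \<exists>b<n. \<exists>c<n. F a b c = k \<and> S a (i - 4) \<and> S b (i - 3) \<and> S c (i - 2))"
        by auto
      then show ?thesis using 1 by (auto simp: next_planes_def)
    next
      case 2
      then show ?thesis by (auto simp: next_planes_def)
    next
      case 3
      then have "\<not> (\<exists>(a, b, c)\<in>set (triples n). k = n + F a b c \<and> fires S (a, b, c) i)"
        using F by (fastforce simp: triples_def)
      then show ?thesis using 3 by (auto simp: next_planes_def)
    qed
  qed
  then show ?thesis unfolding automaton_step_def fold_append comp_apply 1 2 by simp
qed

definition automaton_program :: "nat \<Rightarrow> (nat \<Rightarrow> nat \<Rightarrow> nat \<Rightarrow> nat) \<Rightarrow> instr list" where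
  "automaton_program n F = concat (map (on_register (2 * n)) (automaton_step n F))"

lemma automaton_step_bounds:
  assumes F: "\<And>a b c. a < n \<Longrightarrow> b < n \<Longrightarrow> c < n \<Longrightarrow> F a b c < n"
    and "(k, i) \<in> set (automaton_step n F)"
  shows "k < 2 * n \<and> i \<in> {Load, Store, Clear}"
  using assms by (fastforce simp: automaton_step_def rule_part_def copy_part_def triples_def)

lemma automaton_program_no_tick:
  assumes F: "\<And>a b c. a < n \<Longrightarrow> b < n \<Longrightarrow> c < n \<Longrightarrow> F a b c < n"
  shows "Tick \<notin> set (automaton_program n F)"
  using automaton_step_bounds[OF F] by (fastforce simp: automaton_program_def on_register_def)

lemma simulate_automaton:
  assumes n: "n > 0" and F: "\<And>a b c. a < n \<Longrightarrow> b < n \<Longrightarrow> c < n \<Longrightarrow> F a b c < n"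
    and S: "\<And>k i. n \<le> k \<Longrightarrow> k < 2 * n \<Longrightarrow> \<not> S k i"
    and d: "d = array_word [0..<2 * n] N S (\<lambda>_. True) \<phi>"
  shows "\<exists>\<phi>'. sim_result (automaton_program n F) d = program_word (automaton_program n F @ [Tick]) @
    array_word [0..<2 * n] N ((next_planes n F ^^ fuel d) S) (\<lambda>_. True) \<phi>'"
proof -
  let ?g = "\<lambda>d. run_program (automaton_program n F) (run_instr Tick d)"
  have ne: "[0..<2 * n] \<noteq> []" using n by simp
  have zero: "\<not> (next_planes n F ^^ t) S k i" if "n \<le> k" "k < 2 * n" for t k i
    using that S by (cases t) (auto simp: next_planes_def)
  have iter: "\<exists>\<phi>'. (?g ^^ t) d = array_word [0..<2 * n] N ((next_planes n F ^^ t) S) (\<lambda>_. True) \<phi>'" for t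
  proof (induction t)
    case 0
    then show ?case using d by auto
  next
    case (Suc t)
    then obtain \<phi>1 where 1: "(?g ^^ t) d = array_word [0..<2 * n] N ((next_planes n F ^^ t) S) (\<lambda>_. True) \<phi>1"
      by blast
    obtain \<phi>2 where 2: "run_instr Tick (array_word [0..<2 * n] N ((next_planes n F ^^ t) S) (\<lambda>_. True) \<phi>1)
        = array_word [0..<2 * n] N ((next_planes n F ^^ t) S) (\<lambda>_. True) \<phi>2"
      using tick_array[OF ne] by blast
    have "run_program (automaton_program n F) (array_word [0..<2 * n] N ((next_planes n F ^^ t) S) (\<lambda>_. True) \<phi>2)
        = array_word [0..<2 * n] N (next_planes n F ((next_planes n F ^^ t) S)) (\<lambda>_. True) \<phi>2"
      unfolding automaton_program_def
      by (rule run_registers[OF automaton_step_bounds[OF F] fold_automaton_step[OF zero F]])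
    then show ?case using 1 2 by auto
  qed
  obtain \<phi>1 where 1: "(?g ^^ fuel d) d = array_word [0..<2 * n] N ((next_planes n F ^^ fuel d) S) (\<lambda>_. True) \<phi>1"
    using iter by blast
  show ?thesis unfolding sim_result_def 1 using tick_array[OF ne] by auto
qed


section \<open>Turing machines as cellular automata\<close>

text \<open>
  The machine \<open>M\<close> is given two more states.  In state \<open>num_states M\<close> the head steps from the blank cell
  before the input onto the input, and after acceptance it steps from the output back to the blank cell
  before it, where state \<open>num_states M + 1\<close> remains.  Thus at the beginning and at the end no cell
  combines the head with a letter of a word.  The extended machine never halts but comes to rest,
  because the cellular automaton cannot stop either.
\<close>

definition ext_trans :: "tm \<Rightarrow> nat \<Rightarrow> nat \<Rightarrow> nat \<times> nat \<times> direction" where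
  "ext_trans M q s =
     (if q = num_states M then (start_state, s, Rightward)
      else if q = num_states M + 1 then (q, s, Stationary)
      else if q = accept_state then (num_states M + 1, s, Leftward)
      else if q = reject_state then (q, s, Stationary)
      else trans M q s)"

fun ext_step :: "tm \<Rightarrow> config \<Rightarrow> config" where
  "ext_step M (q, tp, h) = (case ext_trans M q (tp h) of (q', s', d) \<Rightarrow> (q', tp(h := s'), h + offset d))"

definition ext_start :: "tm \<Rightarrow> bool list \<Rightarrow> config" where
  "ext_start M x = (num_states M, ntape (map bit_code x), - 1)"

lemma ext_step_running:
  assumes "turing_machine M" "valid_config M c" "\<not> halted c"
  shows "ext_step M c = step M c"
proof -
  obtain q tp h where c: "c = (q, tp, h)" by (cases c)
  have "q < num_states M" using assms(2) by (simp add: c valid_config_def)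
  then show ?thesis using assms(3) by (auto simp: c ext_trans_def halted_def)
qed

lemma ext_steps_running:
  assumes "turing_machine M" "valid_config M c"
  shows "\<exists>t'\<le>t. (ext_step M ^^ t') c = (step M ^^ t) c"
  using assms(2)
proof (induction t arbitrary: c)
  case 0
  then show ?case by simp
next
  case (Suc t)
  show ?case
  proof (cases "halted c")
    case True
    then show ?thesis by (intro exI[of _ 0]) (simp only: steps_halted, simp)
  next
    case False
    obtain t' where t': "t' \<le> t" "(ext_step M ^^ t') (step M c) = (step M ^^ t) (step M c)"
      using Suc.IH[OF step_valid[OF assms(1) Suc.prems]] by blast
    then have "(ext_step M ^^ Suc t') c = (step M ^^ Suc t) c"
      using ext_step_running[OF assms(1) Suc.prems False] by (simp only: funpow_Suc_right comp_apply)
    then show ?thesis using t'(1) by (intro exI[of _ "Suc t'"]) simp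
  qed
qed

text \<open>
  The two additional steps are the one onto the input and the one off the output.
\<close>

lemma ext_run:
  assumes M: "turing_machine M" and d: "delivers M (map bit_code x) t r" and T: "T \<ge> t + 2"
  obtains q tp h where "(ext_step M ^^ T) (ext_start M x) = (q, tp, h)"
    "case r of Some v \<Rightarrow> q = num_states M + 1 \<and> (\<forall>i. tp (h + 1 + i) = ntape v i)
     | None \<Rightarrow> q = reject_state"
proof -
  have ge: "num_states M \<ge> 3" "num_symbols M \<ge> 3" using turing_machineD[OF M] by simp_all
  have first: "ext_step M (ext_start M x) = (0, ntape (map bit_code x), 0)"
    by (auto simp: ext_start_def ext_trans_def fun_eq_iff)
  have "valid_config M (0, ntape (map bit_code x), 0)"
    using ge by (intro initial_valid[OF M]) (auto simp: bit_code_def)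
  then obtain t' where t': "t' \<le> t" and
    run: "(ext_step M ^^ t') (0, ntape (map bit_code x), 0) = (step M ^^ t) (0, ntape (map bit_code x), 0)"
    using ext_steps_running[OF M] by blast
  obtain q tp h where c: "(step M ^^ t) (0, ntape (map bit_code x), 0) = (q, tp, h)" by (metis prod_cases3)
  have reach: "(ext_step M ^^ Suc t') (ext_start M x) = (q, tp, h)"
    using run c first by (simp only: funpow_Suc_right comp_apply)
  define k where "k = T - Suc t' - 1"
  have Tk: "T = k + 1 + Suc t'" using T t' by (simp add: k_def)
  have fixed: "(ext_step M ^^ j) c' = c'" if "ext_step M c' = c'" for c' j
    using that by (induction j) auto
  show thesis
  proof (cases r)
    case None
    then have q: "q = 2" using d c by (simp add: delivers_def)
    have "ext_step M (2, tp, h) = (2, tp, h)" using ge by (auto simp: ext_trans_def)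
    from fixed[OF this, of "k + 1"] have "(ext_step M ^^ T) (ext_start M x) = (2, tp, h)"
      unfolding Tk funpow_add[of "k + 1" "Suc t'"] comp_apply reach q .
    then show thesis using None by (intro that) auto
  next
    case (Some v)
    then have q: "q = 1" "\<forall>i. tp (h + i) = ntape v i" using d c by (simp_all add: delivers_def)
    have a: "ext_step M (1, tp, h) = (num_states M + 1, tp, h - 1)" using ge by (auto simp: ext_trans_def)
    have b: "ext_step M (num_states M + 1, tp, h - 1) = (num_states M + 1, tp, h - 1)"
      by (auto simp: ext_trans_def)
    have e: "T = k + Suc (Suc t')" using Tk by simp
    have "(ext_step M ^^ Suc (Suc t')) (ext_start M x) = (num_states M + 1, tp, h - 1)"
      using reach q a by simp
    then have "(ext_step M ^^ T) (ext_start M x) = (num_states M + 1, tp, h - 1)"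
      unfolding e funpow_add comp_apply using fixed[OF b, of k] by simp
    then show thesis using Some q(2) by (intro that) auto
  qed
qed

lemma ext_range:
  "(ext_step M ^^ t) (ext_start M x) = (q, tp, h) \<Longrightarrow>
     - 1 - int t \<le> h \<and> h \<le> int t \<and> (\<forall>i. tp i \<noteq> 0 \<longrightarrow> - 1 - int t \<le> i \<and> i \<le> int (length x) + int t)"
proof (induction t arbitrary: q tp h)
  case 0
  then show ?case by (auto simp: ext_start_def ntape_def split: if_splits)
next
  case (Suc t)
  obtain q0 tp0 h0 where c: "(ext_step M ^^ t) (ext_start M x) = (q0, tp0, h0)" by (metis prod_cases3)
  obtain q' s' d where e: "ext_trans M q0 (tp0 h0) = (q', s', d)" by (metis prod_cases3)
  have "tp = tp0(h0 := s')" "h = h0 + offset d" using Suc.prems c e by auto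
  moreover have "- 1 \<le> offset d" "offset d \<le> 1" by (cases d; simp)+
  moreover have "- 1 - int (Suc t) \<le> i \<and> i \<le> int (length x) + int (Suc t)" if "tp i \<noteq> 0" for i
  proof (cases "i = h0")
    case True
    then show ?thesis using Suc.IH[OF c] by auto
  next
    case False
    then have "tp0 i \<noteq> 0" using that \<open>tp = tp0(h0 := s')\<close> by simp
    then have "- 1 - int t \<le> i \<and> i \<le> int (length x) + int t" using Suc.IH[OF c] by blast
    then show ?thesis by simp
  qed
  ultimately show ?case using Suc.IH[OF c] by auto
qed

type_synonym cell_state = "nat option \<times> nat"

definition cell_at :: "config \<Rightarrow> int \<Rightarrow> cell_state" where
  "cell_at c i = (if i = snd (snd c) then Some (fst c) else None, fst (snd c) i)"

definition moving :: "tm \<Rightarrow> direction \<Rightarrow> cell_state \<Rightarrow> nat option" where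
  "moving M d s = (case fst s of None \<Rightarrow> None
     | Some q \<Rightarrow> (case ext_trans M q (snd s) of (q', s', d') \<Rightarrow> if d' = d then Some q' else None))"

text \<open>
  A cell depends on its neighbours only through a head that moves in from one of them.
\<close>

definition local_rule :: "tm \<Rightarrow> cell_state \<Rightarrow> cell_state \<Rightarrow> cell_state \<Rightarrow> cell_state" where
  "local_rule M l c r =
     (if moving M Rightward l \<noteq> None then moving M Rightward l
      else if moving M Leftward r \<noteq> None then moving M Leftward r
      else moving M Stationary c,
      case fst c of None \<Rightarrow> snd c | Some q \<Rightarrow> fst (snd (ext_trans M q (snd c))))"

lemma local_rule_step:
  "cell_at (ext_step M c) i = local_rule M (cell_at c (i - 1)) (cell_at c i) (cell_at c (i + 1))"
proof -
  obtain q tp h where c: "c = (q, tp, h)" by (cases c)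
  obtain q' s' d where e: "ext_trans M q (tp h) = (q', s', d)" by (metis prod_cases3)
  show ?thesis
    by (cases d) (auto simp: c e cell_at_def local_rule_def moving_def)
qed

definition cell_states :: "tm \<Rightarrow> cell_state set" where
  "cell_states M = insert None (Some ` {..<num_states M + 2}) \<times> {..<num_symbols M}"

lemma ext_trans_bounds:
  assumes M: "turing_machine M" and "q < num_states M + 2" "s < num_symbols M" "ext_trans M q s = (q', s', d)"
  shows "q' < num_states M + 2" "s' < num_symbols M"
proof -
  have ge: "num_states M \<ge> 3" by (rule turing_machineD[OF M])
  show "q' < num_states M + 2" "s' < num_symbols M"
    using assms ge turing_machineD(3)[OF M, of q s q' s' d]
    by (auto simp: ext_trans_def split: if_splits)
qed

lemma local_rule_closed:
  assumes M: "turing_machine M" and lcr: "l \<in> cell_states M" "c \<in> cell_states M" "r \<in> cell_states M"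
  shows "local_rule M l c r \<in> cell_states M"
proof -
  have mv: "moving M d s \<in> insert None (Some ` {..<num_states M + 2})" if s: "s \<in> cell_states M" for s d
  proof (cases "fst s")
    case None
    then show ?thesis by (simp add: moving_def)
  next
    case (Some q)
    obtain q' s' d' where e: "ext_trans M q (snd s) = (q', s', d')" by (metis prod_cases3)
    have "q < num_states M + 2" "snd s < num_symbols M" using s Some by (auto simp: cell_states_def)
    from ext_trans_bounds[OF M this e] show ?thesis by (simp add: moving_def Some e)
  qed
  have "(case fst c of None \<Rightarrow> snd c | Some q \<Rightarrow> fst (snd (ext_trans M q (snd c)))) < num_symbols M"
  proof (cases "fst c")
    case None
    then show ?thesis using lcr(2) by (auto simp: cell_states_def)
  next
    case (Some q)
    obtain q' s' d' where e: "ext_trans M q (snd c) = (q', s', d')" by (metis prod_cases3)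
    have "q < num_states M + 2" "snd c < num_symbols M" using lcr(2) Some by (auto simp: cell_states_def)
    from ext_trans_bounds[OF M this e] show ?thesis by (simp add: Some e)
  qed
  then show ?thesis using mv[OF lcr(1)] mv[OF lcr(2)] mv[OF lcr(3)]
    unfolding local_rule_def cell_states_def by (simp add: mem_Times_iff)
qed

lemma cell_at_states:
  assumes M: "turing_machine M"
  shows "cell_at ((ext_step M ^^ t) (ext_start M x)) i \<in> cell_states M"
proof (induction t arbitrary: i)
  case 0
  have ge: "num_symbols M \<ge> 3" by (rule turing_machineD[OF M])
  have "ntape (map bit_code x) i < num_symbols M"
    using ge by (auto simp: ntape_def bit_code_def)
  then show ?case by (auto simp: cell_at_def ext_start_def cell_states_def)
next
  case (Suc t)
  show ?case using local_rule_closed[OF M Suc Suc Suc] local_rule_step by simp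
qed

text \<open>
  The states that occur before the first and matter after the last step get fixed numbers, because they are
  known to the generators that write and read the cells, which do not depend on the machine: blank, the two
  bits, the initial head and the final head.
\<close>

definition special_states :: "tm \<Rightarrow> cell_state list" where
  "special_states M = [(None, 0), (None, 1), (None, 2), (Some (num_states M), 0), (Some (num_states M + 1), 0)]"

lemma ex_state_list:
  assumes M: "turing_machine M"
  obtains cs where "distinct cs" "set cs = cell_states M" "\<And>j. j < 5 \<Longrightarrow> cs ! j = special_states M ! j" "length cs \<ge> 5"
proof -
  have "finite (cell_states M)" by (simp add: cell_states_def)
  then obtain ds where ds: "set ds = cell_states M - set (special_states M)" "distinct ds"
    using finite_distinct_list[of "cell_states M - set (special_states M)"] by auto
  have sub: "set (special_states M) \<subseteq> cell_states M"
    using turing_machineD(2)[OF M] by (auto simp: special_states_def cell_states_def)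
  show thesis
  proof (rule that[of "special_states M @ ds"])
    show "distinct (special_states M @ ds)" using ds by (auto simp: special_states_def)
    show "set (special_states M @ ds) = cell_states M" using ds sub by auto
    show "(special_states M @ ds) ! j = special_states M ! j" if "j < 5" for j
      using that unfolding nth_append by (simp add: special_states_def)
  qed (simp add: special_states_def)
qed

subsection \<open>The simulation invariant\<close>

definition start_planes :: "cell_state list \<Rightarrow> config \<Rightarrow> int \<Rightarrow> planes" where
  "start_planes cs c off k i \<longleftrightarrow> k < length cs \<and> cs ! k = cell_at c (int i - off)"

text \<open>
  After \<open>t\<close> steps the contents have drifted \<open>3 * t\<close> cells to the right.  At the left end no states are
  entered, and this defect spreads by four cells per step.  But it is one-sided: a state that is present is
  correct everywhere.
\<close>

lemma planes_follow:
  fixes x :: "bool list" and off :: int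
  assumes cs: "set cs = cell_states M" and M: "turing_machine M"
    and F: "\<And>a b c. a < length cs \<Longrightarrow> b < length cs \<Longrightarrow> c < length cs \<Longrightarrow>
      F a b c < length cs \<and> cs ! (F a b c) = local_rule M (cs ! a) (cs ! b) (cs ! c)"
    and dist: "distinct cs" and k: "k < length cs"
  defines "S \<equiv> \<lambda>t. (next_planes (length cs) F ^^ t) (start_planes cs (ext_start M x) off)"
    and "C \<equiv> \<lambda>t. (ext_step M ^^ t) (ext_start M x)"
  shows "(S t k i \<longrightarrow> cs ! k = cell_at (C t) (int i - 3 * int t - off)) \<and>
    (i \<ge> 4 * t + 1 \<longrightarrow> cs ! k = cell_at (C t) (int i - 3 * int t - off) \<longrightarrow> S t k i)"
  using k
proof (induction t arbitrary: k i)
  case 0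
  then show ?case by (auto simp: S_def C_def start_planes_def)
next
  case (Suc t)
  let ?n = "length cs" and ?p = "int i - 3 * int (Suc t) - off"
  have S': "S (Suc t) k i \<longleftrightarrow> i \<ge> 5 \<and> (\<exists>a<?n. \<exists>b<?n. \<exists>c<?n. F a b c = k \<and> S t a (i - 4) \<and> S t b (i - 3) \<and> S t c (i - 2))"
    using Suc.prems by (simp add: S_def next_planes_def)
  have step: "cell_at (C (Suc t)) ?p = local_rule M (cell_at (C t) (?p - 1)) (cell_at (C t) ?p) (cell_at (C t) (?p + 1))"
    by (simp add: C_def local_rule_step)
  have pos: "int (i - 4) - 3 * int t - off = ?p - 1" "int (i - 3) - 3 * int t - off = ?p"
    "int (i - 2) - 3 * int t - off = ?p + 1" if "i \<ge> 5"
  proof -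
    have "int (i - 4) = int i - 4" "int (i - 3) = int i - 3" "int (i - 2) = int i - 2"
      using that by (simp_all add: of_nat_diff)
    moreover have "int (Suc t) = int t + 1" by simp
    note e = this calculation
    show "int (i - 4) - 3 * int t - off = ?p - 1" unfolding e by simp
    show "int (i - 3) - 3 * int t - off = ?p" unfolding e by simp
    show "int (i - 2) - 3 * int t - off = ?p + 1" unfolding e by simp
  qed
  show ?case
  proof (intro conjI impI)
    assume "S (Suc t) k i"
    then obtain a b c where abc: "i \<ge> 5" "a < ?n" "b < ?n" "c < ?n" "F a b c = k"
      "S t a (i - 4)" "S t b (i - 3)" "S t c (i - 2)" unfolding S' by blast
    have "cs ! a = cell_at (C t) (?p - 1)" "cs ! b = cell_at (C t) ?p" "cs ! c = cell_at (C t) (?p + 1)"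
      using conjunct1[OF Suc.IH[OF abc(2)], of "i - 4"] conjunct1[OF Suc.IH[OF abc(3)], of "i - 3"]
        conjunct1[OF Suc.IH[OF abc(4)], of "i - 2"] abc(6-8) unfolding pos[OF abc(1)] by blast+
    then show "cs ! k = cell_at (C (Suc t)) ?p" using F[OF abc(2-4)] abc(5) step by simp
  next
    assume i: "4 * Suc t + 1 \<le> i" and eq: "cs ! k = cell_at (C (Suc t)) ?p"
    have i5: "i \<ge> 5" using i by simp
    have ex: "\<exists>a<?n. cs ! a = cell_at (C t) j" for j
      using cell_at_states[OF M, of t x j] unfolding C_def cs[symmetric] by (simp add: in_set_conv_nth)
    obtain a b c where abc: "a < ?n" "cs ! a = cell_at (C t) (?p - 1)" "b < ?n" "cs ! b = cell_at (C t) ?p"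
      "c < ?n" "cs ! c = cell_at (C t) (?p + 1)" using ex by metis
    have "S t a (i - 4)" "S t b (i - 3)" "S t c (i - 2)"
    proof -
      have "4 * t + 1 \<le> i - 4" "4 * t + 1 \<le> i - 3" "4 * t + 1 \<le> i - 2" using i by arith+
      then show "S t a (i - 4)" "S t b (i - 3)" "S t c (i - 2)"
        using conjunct2[OF Suc.IH[OF abc(1)], of "i - 4"] conjunct2[OF Suc.IH[OF abc(3)], of "i - 3"]
          conjunct2[OF Suc.IH[OF abc(5)], of "i - 2"] abc(2,4,6) unfolding pos[OF i5] by blast+
    qed
    moreover have "F a b c = k"
    proof -
      have "F a b c < ?n" "cs ! (F a b c) = cs ! k" using F[OF abc(1,3,5)] abc step eq by simp_all
      then show ?thesis using dist Suc.prems by (simp add: nth_eq_iff_index_eq)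
    qed
    ultimately show "S (Suc t) k i" unfolding S' using i5 abc by blast
  qed
qed

section \<open>Reading the result from the cells\<close>

text \<open>
  The letters stored in the cells are found in registers 1, 2 and 4, according to the positions in
  \<open>special_states\<close>.
\<close>

definition reg_label :: "nat \<Rightarrow> letter option" where
  "reg_label j = (if j = 1 then Some (Bit False) else if j = 2 then Some (Bit True)
     else if j = 4 then Some Answer else None)"

text \<open>
  One letter is written for each letter that is read, so the function is balanced although it
  discards most of the information.  The state counts the registers of the current cell up to 5, and
  remembers whether a final head has been seen.
\<close>

definition reader_transducer :: "(nat \<times> letter option \<times> bool, sym) transducer" where
  "reader_transducer = \<lparr>init = (0, None, False),
     move = (\<lambda>(j, l, a) s. case fst s of
         Reg b \<Rightarrow> ((min 5 (Suc j), if b \<and> l = None then reg_label j else l, a), [(Filler, False)])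
       | Sep _ \<Rightarrow> ((0, None, a \<or> l = Some Answer), [(case l of None \<Rightarrow> Filler | Some y \<Rightarrow> y, False)])
       | _ \<Rightarrow> ((j, l, a), [(Filler, False)])),
     final_output = (\<lambda>_. []),
     verdict = (\<lambda>(j, l, a). if a then Accept else Reject)\<rparr>"

definition reader :: "sym list \<rightharpoonup> sym list" where
  "reader w = (case pass reader_transducer (0, None, False) w of
     ((j, l, a), v) \<Rightarrow> if a then Some v else None)"

lemma reader_pass:
  "pass reader_transducer q w = (p, v) \<Longrightarrow> length v = length w \<and> all_fresh v"
proof (induction w arbitrary: q v)
  case (Cons s w)
  obtain q1 u where m: "move reader_transducer q s = (q1, u)" by (cases "move reader_transducer q s")
  have u: "length u = 1 \<and> all_fresh u"
    using m by (cases q; cases "fst s") (auto simp: reader_transducer_def)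
  obtain v' where v': "pass reader_transducer q1 w = (p, v')" "v = u @ v'"
    using Cons.prems m by (auto split: prod.splits)
  show ?case using Cons.IH[OF v'(1)] v'(2) u by simp
qed simp

lemma polytime_reader: "polytime reader"
proof (rule polytime_one_pass)
  let ?Q = "{..5 :: nat} \<times> (UNIV :: letter option set) \<times> (UNIV :: bool set)"
  have "fst (move reader_transducer q s) \<in> ?Q" if "q \<in> ?Q" for q s
    using that by (cases q; cases "fst s") (auto simp: reader_transducer_def)
  moreover have "verdict reader_transducer q \<noteq> Again q'" for q q'
    by (cases q) (simp add: reader_transducer_def)
  ultimately show "finite_states reader_transducer ?Q"
    unfolding finite_states_def by (simp add: reader_transducer_def)
  show "poly_bounded (\<lambda>n. n)" by (rule poly_bounded_id)
next
  fix w p v assume "pass reader_transducer (init reader_transducer) w = (p, v)"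
  then have pv: "pass reader_transducer (0, None, False) w = (p, v)" by (simp add: reader_transducer_def)
  obtain j l a where p: "p = (j, l, a)" by (cases p)
  have "reader w = (if a then Some v else None)" using pv by (simp add: reader_def p)
  then show "length (v @ final_output reader_transducer p) \<le> length w \<and>
      (verdict reader_transducer p = Accept \<and> reader w = Some (v @ final_output reader_transducer p) \<or>
       verdict reader_transducer p = Reject \<and> reader w = None)"
    using reader_pass[OF pv] by (auto simp: p reader_transducer_def)
qed

lemma reader_length: "reader w = Some v \<Longrightarrow> length v = length w \<and> all_fresh v"
  by (auto simp: reader_def split: prod.splits if_splits dest: reader_pass)

lemma reader_balanced: "word_balanced reader"
  by (rule word_balancedI[of "\<lambda>n. n"]) (auto simp: poly_bounded_id monoI dest: reader_length)

definition cell_label :: "bool list \<Rightarrow> letter option" where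
  "cell_label rs = (if rs ! 1 then Some (Bit False) else if rs ! 2 then Some (Bit True)
     else if rs ! 4 then Some Answer else None)"

text \<open>
  Registers from number 5 on never contribute a letter.
\<close>

lemma reader_tail:
  "pass reader_transducer (5, l, a) (reg_word rs @ w) =
     (let (p, v) = pass reader_transducer (5, l, a) w in (p, replicate (length rs) (Filler, False) @ v))"
proof (induction rs)
  case (Cons r rs)
  have "move reader_transducer (5, l, a) (Reg r, False) = ((5, l, a), [(Filler, False)])"
    by (auto simp: reader_transducer_def reg_label_def)
  then show ?case using Cons by (auto split: prod.splits)
qed simp

lemma reader_cell:
  assumes "length rs \<ge> 5"
  shows "pass reader_transducer (0, None, a) (cell_word rs e f @ w) =
     (let (p, v) = pass reader_transducer (0, None, a \<or> cell_label rs = Some Answer) w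
      in (p, replicate (length rs) (Filler, False) @
        (case cell_label rs of None \<Rightarrow> Filler | Some y \<Rightarrow> y, False) # v))"
proof -
  obtain r0 r1 r2 r3 r4 rest where rs: "rs = r0 # r1 # r2 # r3 # r4 # rest"
    using assms by (auto simp: numeral_eq_Suc Suc_le_length_iff)
  have head: "pass reader_transducer (0, None, a) (reg_word [r0, r1, r2, r3, r4] @ z) =
    (let (p, v) = pass reader_transducer (5, cell_label rs, a) z in (p, replicate 5 (Filler, False) @ v))" for z
    by (cases r1; cases r2; cases r4)
      (auto simp: reader_transducer_def reg_label_def cell_label_def rs numeral_eq_Suc split: prod.splits)
  have sep: "move reader_transducer (5, cell_label rs, a) (Sep e, f) =
    ((0, None, a \<or> cell_label rs = Some Answer), [(case cell_label rs of None \<Rightarrow> Filler | Some y \<Rightarrow> y, False)])"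
    by (simp add: reader_transducer_def)
  have "cell_word rs e f @ w = reg_word [r0, r1, r2, r3, r4] @ (reg_word rest @ ((Sep e, f) # w))"
    by (simp add: cell_word_def rs)
  then show ?thesis
    by (simp only: head reader_tail pass.simps sep)
      (auto simp: rs numeral_eq_Suc split: prod.splits)
qed

lemma reader_array:
  fixes S :: planes
  assumes B: "B \<ge> 5"
  defines "lab \<equiv> \<lambda>i. if S 1 i then Some (Bit False) else if S 2 i then Some (Bit True)
     else if S 4 i then Some Answer else None"
  shows "if \<exists>i<N. lab i = Some Answer
    then \<exists>v. reader (array_word [0..<B] N S \<alpha> \<phi>) = Some v \<and>
      core v = concat (map (\<lambda>i. case lab i of None \<Rightarrow> [] | Some y \<Rightarrow> [y]) [0..<N])
    else reader (array_word [0..<B] N S \<alpha> \<phi>) = None"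
proof -
  have cl: "cell_label (map (\<lambda>k. S k i) [0..<B]) = lab i" for i
  proof -
    have nth: "map (\<lambda>k. S k i) [0..<B] ! j = S j i" if "j < B" for j using that by simp
    have "map (\<lambda>k. S k i) [0..<B] ! 1 = S 1 i" "map (\<lambda>k. S k i) [0..<B] ! 2 = S 2 i"
      "map (\<lambda>k. S k i) [0..<B] ! 4 = S 4 i" using B by (intro nth; simp)+
    then show ?thesis by (simp add: cell_label_def lab_def)
  qed
  have nf: "lab i \<noteq> Some Filler" for i by (simp add: lab_def)
  have core_app: "core (u @ v) = core u @ core v" for u v by (simp add: core_def)
  have core_rep: "core (replicate n (Filler, False)) = []" for n by (simp add: core_def)
  have "\<exists>v. pass reader_transducer (0, None, a) (concat (map (\<lambda>i. cell_word (map (\<lambda>k. S k i) [0..<B]) (\<alpha> i) (\<phi> i)) is))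
     = ((0, None, a \<or> (\<exists>i\<in>set is. lab i = Some Answer)), v) \<and>
     core v = concat (map (\<lambda>i. case lab i of None \<Rightarrow> [] | Some y \<Rightarrow> [y]) is)" for a "is"
  proof (induction "is" arbitrary: a)
    case Nil
    then show ?case by (simp add: core_def)
  next
    case (Cons i ks)
    obtain v where v: "pass reader_transducer (0, None, a \<or> lab i = Some Answer)
        (concat (map (\<lambda>i. cell_word (map (\<lambda>k. S k i) [0..<B]) (\<alpha> i) (\<phi> i)) ks))
     = ((0, None, (a \<or> lab i = Some Answer) \<or> (\<exists>i\<in>set ks. lab i = Some Answer)), v)"
     "core v = concat (map (\<lambda>i. case lab i of None \<Rightarrow> [] | Some y \<Rightarrow> [y]) ks)"
      using Cons.IH by blast
    have len: "length (map (\<lambda>k. S k i) [0..<B]) \<ge> 5" using B by simp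
    let ?v = "replicate B (Filler, False) @ (case lab i of None \<Rightarrow> Filler | Some y \<Rightarrow> y, False) # v"
    have "pass reader_transducer (0, None, a) (concat (map (\<lambda>i. cell_word (map (\<lambda>k. S k i) [0..<B]) (\<alpha> i) (\<phi> i)) (i # ks)))
       = ((0, None, (a \<or> lab i = Some Answer) \<or> (\<exists>i\<in>set ks. lab i = Some Answer)), ?v)"
      using v(1) unfolding list.map concat.simps reader_cell[OF len] cl by simp
    moreover have "core ?v = concat (map (\<lambda>i. case lab i of None \<Rightarrow> [] | Some y \<Rightarrow> [y]) (i # ks))"
      using v(2) nf[of i] unfolding core_app core_rep by (auto simp: core_def split: option.split)
    ultimately show ?case by (intro exI[of _ ?v]) auto
  qed
  from this[of False "[0..<N]"] show ?thesis
    unfolding reader_def array_word_def by (auto simp: Bex_def)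
qed

section \<open>The initial cells\<close>

definition one_hot :: "nat \<Rightarrow> nat \<Rightarrow> bool \<Rightarrow> sym list" where
  "one_hot B j f = cell_word (map (\<lambda>k. k = j) [0..<B]) True f"

text \<open>
  Each letter of padding becomes ten blank cells, one of which has fuel.  With \<open>a\<close> letters on each side this
  gives \<open>2 * a\<close> steps and \<open>10 * a\<close> cells of room on each side.  On the right the contents drift by
  \<open>6 * a\<close> cells and the head may move \<open>2 * a\<close> cells away; on the left the first \<open>8 * a + 1\<close> cells
  become unreliable, whereas the contents stay to the right of cell \<open>14 * a - 1\<close>.
\<close>

definition pad_cells :: "(nat \<times> bool) list" where
  "pad_cells = (0, False) # replicate 9 (0, True)"

definition layout_cells :: "letter \<Rightarrow> (nat \<times> bool) list" where
  "layout_cells b = (case b of Pad \<Rightarrow> pad_cells | Entry \<Rightarrow> [(3, True)]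
     | Bit c \<Rightarrow> [(if c then 2 else 1, True)] | _ \<Rightarrow> [])"

text \<open>
  Letters that do not occur in a padded input are sent to a nonempty word as well, for the
  sake of balance.
\<close>

definition layout_hom :: "sym \<Rightarrow> sym list" where
  "layout_hom s = (if layout_cells (fst s) = [] then [(Filler, False)]
     else concat (map (\<lambda>(j, f). one_hot 5 j f) (layout_cells (fst s))))"

definition widen_hom :: "sym \<Rightarrow> sym list" where
  "widen_hom s = (case fst s of Sep _ \<Rightarrow> [(Reg False, False), s] | _ \<Rightarrow> [s])"

lemma widen_one_hot:
  assumes "j < B"
  shows "concat (map widen_hom (one_hot B j f)) = one_hot (Suc B) j f"
proof -
  have "concat (map widen_hom (reg_word rs)) = reg_word rs" for rs
    by (induction rs) (simp_all add: widen_hom_def)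
  then show ?thesis using assms by (simp add: one_hot_def cell_word_def widen_hom_def)
qed

lemma widen_cells:
  assumes "\<And>j f. (j, f) \<in> set jl \<Longrightarrow> j < B"
  shows "concat (map widen_hom (concat (map (\<lambda>(j, f). one_hot B j f) jl))) = concat (map (\<lambda>(j, f). one_hot (Suc B) j f) jl)"
  using assms
proof (induction jl)
  case (Cons p jl)
  obtain j f where p: "p = (j, f)" by (cases p)
  have j: "j < B" using Cons.prems[of j f] p by simp
  have IH: "concat (map widen_hom (concat (map (\<lambda>(j, f). one_hot B j f) jl))) = concat (map (\<lambda>(j, f). one_hot (Suc B) j f) jl)"
    by (rule Cons.IH) (use Cons.prems in auto)
  show ?case unfolding p list.map concat.simps case_prod_conv map_append concat_append widen_one_hot[OF j] IH ..
qed simp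

definition input_cells :: "nat \<Rightarrow> bool list \<Rightarrow> (nat \<times> bool) list" where
  "input_cells a x = concat (replicate a pad_cells) @ [(3, True)] @ map (\<lambda>b. (if b then 2 else 1, True)) x
     @ concat (replicate a pad_cells)"

lemma layout_padded:
  "concat (map layout_hom (padded_input a x)) = concat (map (\<lambda>(j, f). one_hot 5 j f) (input_cells a x))"
proof -
  have p: "concat (map layout_hom (fresh_word (replicate a Pad))) = concat (map (\<lambda>(j, f). one_hot 5 j f) (concat (replicate a pad_cells)))" for a
    by (induction a) (simp_all add: fresh_word_def layout_hom_def layout_cells_def pad_cells_def)
  have b: "concat (map layout_hom (fresh_word (map Bit x))) = concat (map (\<lambda>(j, f). one_hot 5 j f) (map (\<lambda>b. (if b then 2 else 1, True)) x))"
    by (induction x) (simp_all add: fresh_word_def layout_hom_def layout_cells_def)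
  have e: "concat (map layout_hom (fresh_word [Entry])) = one_hot 5 3 True"
    by (simp add: fresh_word_def layout_hom_def layout_cells_def)
  have app: "fresh_word (u @ v) = fresh_word u @ fresh_word v" for u v by (simp add: fresh_word_def)
  show ?thesis
    unfolding padded_input_def input_cells_def app map_append concat_append p b e by simp
qed

lemma length_concat_pads: "length (concat (replicate a pad_cells)) = 10 * a"
  by (induction a) (simp_all add: pad_cells_def)

lemma set_concat_pads: "p \<in> set (concat (replicate a pad_cells)) \<Longrightarrow> fst p = 0"
  by (auto simp: pad_cells_def split: if_splits)

lemma length_input_cells: "length (input_cells a x) = 20 * a + 1 + length x"
  unfolding input_cells_def length_append length_concat_pads by simp

lemma input_cells_bound: "(j, f) \<in> set (input_cells a x) \<Longrightarrow> j < 5"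
  unfolding input_cells_def using set_concat_pads[of "(j, f)" a] by (auto split: if_splits)

lemma input_cells_nth:
  assumes "i < length (input_cells a x)"
  shows "special_states M ! fst (input_cells a x ! i) = cell_at (ext_start M x) (int i - int (10 * a + 1))"
proof -
  have len: "length (concat (replicate a pad_cells)) = 10 * a" by (rule length_concat_pads)
  have zero: "fst (concat (replicate a pad_cells) ! j) = 0" if "j < 10 * a" for j
    by (rule set_concat_pads[of _ a], rule nth_mem) (use that len in simp)
  let ?p = "int i - int (10 * a + 1)"
  consider "i < 10 * a" | "i = 10 * a" | "10 * a < i" "i < 10 * a + 1 + length x" | "10 * a + 1 + length x \<le> i" by linarith
  then show ?thesis
  proof cases
    case 1
    then have "fst (input_cells a x ! i) = 0"
      unfolding input_cells_def using len by (simp add: nth_append zero)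
    moreover have "?p < -1" using 1 by simp
    ultimately show ?thesis by (simp add: special_states_def cell_at_def ext_start_def ntape_def)
  next
    case 2
    then have "fst (input_cells a x ! i) = 3" unfolding input_cells_def using len by (simp add: nth_append)
    then show ?thesis using 2 by (simp add: special_states_def cell_at_def ext_start_def ntape_def)
  next
    case 3
    define j where "j = i - 10 * a - 1"
    have j: "i = 10 * a + Suc j" "j < length x" using 3 by (simp_all add: j_def)
    have "input_cells a x ! i = (if x ! j then 2 else 1, True)"
      unfolding input_cells_def using len j by (simp add: nth_append)
    moreover have "?p = int j" using j by simp
    ultimately show ?thesis using j(2)
      by (simp add: special_states_def cell_at_def ext_start_def ntape_def bit_code_def)
  next
    case 4
    define j where "j = i - 10 * a - 1 - length x"
    have j: "i = 10 * a + Suc (length x + j)" "j < 10 * a" using 4 assms by (simp_all add: j_def length_input_cells)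
    have "input_cells a x ! i = concat (replicate a pad_cells) ! j"
      unfolding input_cells_def using len j by (simp add: nth_append)
    then have "fst (input_cells a x ! i) = 0" using j(2) by (simp add: zero)
    moreover have "?p = int (length x + j)" using j by simp
    ultimately show ?thesis by (simp add: special_states_def cell_at_def ext_start_def ntape_def)
  qed
qed

lemma input_cells_array:
  fixes a :: nat and x :: "bool list"
  assumes cs: "\<And>j. j < 5 \<Longrightarrow> cs ! j = special_states M ! j" "length cs \<ge> 5" "distinct cs"
  defines "N \<equiv> length (input_cells a x)"
  shows "concat (map (\<lambda>(j, f). one_hot (2 * length cs) j f) (input_cells a x)) =
    array_word [0..<2 * length cs] N (start_planes cs (ext_start M x) (int (10 * a + 1))) (\<lambda>_. True)
      (\<lambda>i. snd (input_cells a x ! i))"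
proof -
  let ?S = "start_planes cs (ext_start M x) (int (10 * a + 1))"
  have cell: "map (\<lambda>k. k = fst (input_cells a x ! i)) [0..<2 * length cs] = map (\<lambda>k. ?S k i) [0..<2 * length cs]"
    if i: "i < N" for i
  proof (rule map_cong)
    fix k assume "k \<in> set [0..<2 * length cs]"
    let ?j = "fst (input_cells a x ! i)"
    have "input_cells a x ! i \<in> set (input_cells a x)" using i by (simp add: N_def)
    then have j: "?j < 5" using input_cells_bound[of ?j "snd (input_cells a x ! i)" a x] by simp
    have "cs ! ?j = cell_at (ext_start M x) (int i - int (10 * a + 1))"
      using input_cells_nth[of i a x M] i cs(1)[OF j] by (simp add: N_def)
    then have "?S k i \<longleftrightarrow> k < length cs \<and> cs ! k = cs ! ?j" by (simp only: start_planes_def)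
    also have "\<dots> \<longleftrightarrow> k = ?j" using j cs(2,3) by (auto simp: nth_eq_iff_index_eq)
    finally show "(k = ?j) = ?S k i" by blast
  qed simp
  have el: "(\<lambda>(j, f). one_hot (2 * length cs) j f) (input_cells a x ! i) =
    cell_word (map (\<lambda>k. ?S k i) [0..<2 * length cs]) True (snd (input_cells a x ! i))" if "i < N" for i
    unfolding one_hot_def case_prod_beta cell[OF that] ..
  have "map (\<lambda>(j, f). one_hot (2 * length cs) j f) (input_cells a x) =
    map (\<lambda>i. (\<lambda>(j, f). one_hot (2 * length cs) j f) (input_cells a x ! i)) [0..<N]"
    unfolding N_def by (rule nth_equalityI) simp_all
  also have "\<dots> = map (\<lambda>i. cell_word (map (\<lambda>k. ?S k i) [0..<2 * length cs]) True (snd (input_cells a x ! i))) [0..<N]"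
    by (rule map_cong[OF refl], rule el) simp
  finally show ?thesis unfolding array_word_def by simp
qed

lemma fuel_input_cells: "B > 0 \<Longrightarrow> fuel (concat (map (\<lambda>(j, f). one_hot B j f) (input_cells a x))) = 2 * a"
proof -
  have r: "fuel (concat (replicate n w)) = n * fuel w" for n w by (induction n) simp_all
  have p: "fuel (concat (map (\<lambda>(j, f). one_hot B j f) (concat (replicate a pad_cells)))) = a" for a
    by (induction a) (simp_all add: pad_cells_def one_hot_def r)
  have b: "fuel (concat (map (\<lambda>(j, f). one_hot B j f) (map (\<lambda>b. (if b then 2 else 1, True)) x))) = 0"
    by (induction x) (simp_all add: one_hot_def)
  show ?thesis unfolding input_cells_def map_append concat_append fuel_simps p b
    by (simp add: one_hot_def)
qed


section \<open>Reading off the result of a simulated computation\<close>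

lemma concat_window:
  assumes "\<And>m. m < length z \<Longrightarrow> g (i0 + m) = Some (z ! m)"
    and "\<And>i. i < i0 \<Longrightarrow> g i = None" "\<And>i. i0 + length z \<le> i \<Longrightarrow> g i = None"
    and "i0 + length z \<le> N"
  shows "concat (map (\<lambda>i. case g i of None \<Rightarrow> [] | Some y \<Rightarrow> [y]) [0..<N]) = z"
proof -
  let ?h = "\<lambda>i. case g i of None \<Rightarrow> [] | Some y \<Rightarrow> [y]"
  have split: "[0..<N] = [0..<i0] @ [i0..<i0 + length z] @ [i0 + length z..<N]"
    using assms(4) by (metis upt_add_eq_append le_add_diff_inverse le0 trans_le_add1 le_add1)
  have e1: "map ?h [0..<i0] = map (\<lambda>_. []) [0..<i0]" using assms(2) by (intro map_cong) auto
  have e2: "map ?h [i0 + length z..<N] = map (\<lambda>_. []) [i0 + length z..<N]"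
    using assms(3) by (intro map_cong) auto
  have e3: "concat (map (\<lambda>_. []) xs) = []" for xs :: "nat list" by (induction xs) simp_all
  have e4: "concat (map ?h [i0..<i0 + length z]) = z"
  proof -
    have "map ?h [i0..<i0 + length z] = map (\<lambda>y. [y]) z"
      by (rule nth_equalityI) (simp_all add: assms(1))
    moreover have "concat (map (\<lambda>y. [y]) z) = z" by (induction z) simp_all
    ultimately show ?thesis by simp
  qed
  show ?thesis unfolding split map_append concat_append e1 e2 e3 e4 by simp
qed

text \<open>
  The registers that matter are correct in all cells that can hold the head or a nonblank symbol, and all these
  cells lie within the array.  Hence the letters found in the array are exactly the output, preceded by the
  final head.
\<close>

lemma read_result:
  fixes x :: "bool list" and a :: nat and \<phi> :: "nat \<Rightarrow> bool"
  assumes M: "turing_machine M"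
    and cs: "distinct cs" "set cs = cell_states M" "\<And>j. j < 5 \<Longrightarrow> cs ! j = special_states M ! j" "length cs \<ge> 5"
    and F: "\<And>a b c. a < length cs \<Longrightarrow> b < length cs \<Longrightarrow> c < length cs \<Longrightarrow>
      F a b c < length cs \<and> cs ! (F a b c) = local_rule M (cs ! a) (cs ! b) (cs ! c)"
    and d: "delivers M (map bit_code x) t (map_option (map bit_code) r)" and a: "a \<ge> 1" "2 * a \<ge> t + 2"
  defines "W \<equiv> array_word [0..<2 * length cs] (length (input_cells a x))
    ((next_planes (length cs) F ^^ (2 * a)) (start_planes cs (ext_start M x) (int (10 * a + 1)))) (\<lambda>_. True) \<phi>"
  shows "case r of None \<Rightarrow> reader W = None
    | Some y \<Rightarrow> \<exists>v. reader W = Some v \<and> core v = Answer # map Bit y"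
proof -
  define T where "T = 2 * a"
  define off where "off = int (10 * a + 1)"
  define N where "N = length (input_cells a x)"
  define S where "S = (next_planes (length cs) F ^^ T) (start_planes cs (ext_start M x) off)"
  have W: "W = array_word [0..<2 * length cs] N S (\<lambda>_. True) \<phi>"
    by (simp add: W_def N_def S_def T_def off_def)
  have N: "int N = 20 * int a + 1 + int (length x)" by (simp add: N_def length_input_cells)
  have T: "int T = 2 * int a" and o: "off = 10 * int a + 1" by (simp_all add: T_def off_def)
  obtain q tp h where C: "(ext_step M ^^ T) (ext_start M x) = (q, tp, h)"
    and res: "case map_option (map bit_code) r of Some v \<Rightarrow> q = num_states M + 1 \<and> (\<forall>i. tp (h + 1 + i) = ntape v i)
      | None \<Rightarrow> q = reject_state"
    using ext_run[OF M d, of T] a(2) unfolding T_def by blast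
  let ?C = "(q, tp, h)"
  have range: "- 1 - int T \<le> h" "h \<le> int T"
    "\<And>i. tp i \<noteq> 0 \<Longrightarrow> - 1 - int T \<le> i \<and> i \<le> int (length x) + int T"
    using ext_range[OF C] by blast+
  define pos where "pos i = int i - 3 * int T - off" for i
  define L where "L p = (if cell_at ?C p = special_states M ! 1 then Some (Bit False)
    else if cell_at ?C p = special_states M ! 2 then Some (Bit True)
    else if cell_at ?C p = special_states M ! 4 then Some Answer else None)" for p
  have sp: "special_states M ! 1 = (None, 1)" "special_states M ! 2 = (None, 2)"
    "special_states M ! 4 = (Some (num_states M + 1), 0)" "special_states M ! Suc 0 = (None, 1)"
    by (simp_all add: special_states_def)
  have near: "- 1 - int T \<le> p \<and> p \<le> int (length x) + int T"
    if "cell_at ?C p = special_states M ! j" "j \<in> {1, 2, 4}" for p j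
  proof (cases "p = h")
    case True
    then show ?thesis using range(1,2) by simp
  next
    case False
    then have "tp p \<noteq> 0" using that sp by (auto simp: cell_at_def)
    then show ?thesis by (rule range(3))
  qed
  have plane: "S j i \<longleftrightarrow> cell_at ?C (pos i) = special_states M ! j" if j: "j \<in> {1, 2, 4}" for i j
  proof -
    have "j < length cs" "cs ! j = special_states M ! j" using j cs(3)[of j] cs(4) by auto
    then have follow: "(S j i \<longrightarrow> special_states M ! j = cell_at ?C (pos i)) \<and>
      (i \<ge> 4 * T + 1 \<longrightarrow> special_states M ! j = cell_at ?C (pos i) \<longrightarrow> S j i)"
      using planes_follow[OF cs(2) M F cs(1), where k = j and t = T and x = x and off = off and i = i] unfolding S_def C pos_def by simp
    moreover have "i \<ge> 4 * T + 1" if "cell_at ?C (pos i) = special_states M ! j"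
    proof -
      have "- 1 - int T \<le> int i - 3 * int T - off" using near[OF that j] by (simp add: pos_def)
      then have "int (4 * T + 1) \<le> int i" using T o a(1) by simp
      then show ?thesis by (simp only: of_nat_le_iff)
    qed
    ultimately show ?thesis by metis
  qed
  have lab: "(if S 1 i then Some (Bit False) else if S 2 i then Some (Bit True)
     else if S 4 i then Some Answer else None) = L (pos i)" for i
    unfolding L_def using plane[of 1 i] plane[of 2 i] plane[of 4 i] by simp
  have B: "5 \<le> 2 * length cs" using cs(4) by simp
  have read: "if \<exists>i<N. L (pos i) = Some Answer
    then \<exists>v. reader W = Some v \<and> core v = concat (map (\<lambda>i. case L (pos i) of None \<Rightarrow> [] | Some y \<Rightarrow> [y]) [0..<N])
    else reader W = None"
    using reader_array[OF B, of N S "\<lambda>_. True" \<phi>] unfolding lab W .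
  show ?thesis
  proof (cases r)
    case None
    then have "q = 2" using res by simp
    then have "L p \<noteq> Some Answer" for p
      using turing_machineD(1)[OF M] by (auto simp: L_def sp cell_at_def)
    then show ?thesis using read None by simp
  next
    case (Some y)
    then have q: "q = num_states M + 1" and tp: "\<And>i. tp (h + 1 + i) = ntape (map bit_code y) i"
      using res by simp_all
    define z where "z = Answer # map Bit y"
    have at: "cell_at ?C (h + 1 + i) = (if i = -1 then (Some (num_states M + 1), 0) else (None, ntape (map bit_code y) i))" for i
      using tp[of i] q by (auto simp: cell_at_def ntape_def)
    have Lz: "L (h + int m) = Some (z ! m)" if "m < length z" for m
    proof (cases m)
      case 0
      then show ?thesis using at[of "-1"] by (simp add: L_def sp z_def)
    next
      case (Suc m')
      then have m': "m' < length y" using that by (simp add: z_def)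
      have "cell_at ?C (h + int m) = (None, bit_code (y ! m'))"
        using at[of "int m'"] m' Suc by (simp add: ntape_def algebra_simps)
      then show ?thesis using Suc m' by (simp add: L_def sp z_def bit_code_def)
    qed
    have Ln: "L p = None" if "p < h \<or> p \<ge> h + int (length z)" for p
    proof -
      have "cell_at ?C (h + 1 + (p - h - 1)) = (None, ntape (map bit_code y) (p - h - 1))"
        using at[of "p - h - 1"] that by (auto simp: z_def)
      moreover have "ntape (map bit_code y) (p - h - 1) = 0"
        using that by (auto simp: ntape_def z_def)
      ultimately show ?thesis by (simp add: L_def sp)
    qed
    have nonneg: "h + 3 * int T + off \<ge> 0" using range(1) T o a(1) by simp
    define i0 where "i0 = nat (h + 3 * int T + off)"
    have i0: "int i0 = h + 3 * int T + off" using nonneg by (simp add: i0_def)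
    have pos0: "pos i = h + (int i - int i0)" for i using i0 by (simp add: pos_def)
    have fit: "i0 + length z \<le> N"
    proof -
      have "L (h + int (length y)) \<noteq> None" using Lz[of "length y"] by (simp add: z_def)
      then have "h + int (length y) \<le> int (length x) + int T"
        unfolding L_def using near[of "h + int (length y)" 1] near[of "h + int (length y)" 2]
          near[of "h + int (length y)" 4] by (auto split: if_splits)
      then have "int (i0 + length z) \<le> int N" using i0 T o N a(1) by (simp add: z_def)
      then show ?thesis by (simp only: of_nat_le_iff)
    qed
    have "concat (map (\<lambda>i. case L (pos i) of None \<Rightarrow> [] | Some y \<Rightarrow> [y]) [0..<N]) = z"
    proof (rule concat_window[OF _ _ _ fit])
      show "L (pos (i0 + m)) = Some (z ! m)" if "m < length z" for m
        using Lz[OF that] by (simp add: pos0)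
      show "L (pos i) = None" if "i < i0" for i by (rule Ln) (use that in \<open>simp add: pos0\<close>)
      show "L (pos i) = None" if "i0 + length z \<le> i" for i
        by (rule Ln) (use that in \<open>simp add: pos0\<close>)
    qed
    moreover have "\<exists>i<N. L (pos i) = Some Answer"
      by (rule exI[of _ i0]) (use Lz[of 0] fit in \<open>simp add: pos0 z_def\<close>)
    ultimately show ?thesis using read Some by (simp add: z_def)
  qed
qed

section \<open>Finite generation\<close>

definition iter_map :: "('a \<rightharpoonup> 'a) \<Rightarrow> nat \<Rightarrow> ('a \<rightharpoonup> 'a)" where
  "iter_map F k = ((\<circ>\<^sub>m) F ^^ k) Some"

lemma iter_map_simps [simp]: "iter_map F 0 = Some" "iter_map F (Suc k) = F \<circ>\<^sub>m iter_map F k"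
  by (simp_all add: iter_map_def)

lemma iter_map_first: "F w = Some v \<Longrightarrow> iter_map F (Suc k) w = iter_map F k v"
  by (induction k) (simp_all add: map_comp_def)

lemma iter_map_binary: "iter_map (binary F) k (spell w) = map_option spell (iter_map F k w)"
  by (induction k) (auto simp: map_comp_def split: option.split)

definition layout :: "sym list \<rightharpoonup> sym list" where
  "layout w = Some ([] @ concat (map layout_hom w) @ [])"

definition widen :: "sym list \<rightharpoonup> sym list" where
  "widen w = Some ([] @ concat (map widen_hom w) @ [])"

definition prepend :: "sym \<Rightarrow> sym list \<rightharpoonup> sym list" where
  "prepend s w = Some ([s] @ concat (map (\<lambda>s. [s]) w) @ [])"

definition drop_letter :: "sym list \<rightharpoonup> sym list" where
  "drop_letter = drop_first (\<lambda>_. True) UNIV"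

lemma prepend_eq: "prepend s w = Some (s # w)"
proof -
  have "concat (map (\<lambda>s. [s]) w) = w" by (induction w) simp_all
  then show ?thesis by (simp add: prepend_def)
qed

text \<open>
  A homomorphism that erases no letter changes lengths only by a constant factor.
\<close>

lemma hom_balanced:
  assumes "\<And>s. h s \<noteq> []"
  shows "word_balanced (\<lambda>w. Some (u @ concat (map h w) @ v))"
proof -
  obtain B where B: "\<And>w. length (concat (map h w)) \<le> B * length w" using hom_length_bound[of h] by blast
  have low: "length w \<le> length (concat (map h w))" for w
  proof (induction w)
    case (Cons s w)
    have "1 \<le> length (h s)" using assms[of s] by (simp add: Suc_leI)
    then show ?case using Cons by simp
  qed simp
  show ?thesis
  proof (rule word_balancedI[of "\<lambda>n. length u + B * n + length v + n"])
    show "poly_bounded (\<lambda>n. length u + B * n + length v + n)"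
      by (intro poly_bounded_add poly_bounded_mult poly_bounded_const poly_bounded_id)
    show "mono (\<lambda>n. length u + B * n + length v + n)" by (intro monoI add_mono mult_le_mono) auto
  next
    fix w v' assume "Some (u @ concat (map h w) @ v) = Some v'"
    then have "length v' = length u + length (concat (map h w)) + length v" by auto
    then show "length v' \<le> length u + B * length w + length v + length w \<and>
        length w \<le> length u + B * length v' + length v + length v'"
      using B[of w] low[of w] by simp
  qed
qed

lemma drop_letter_balanced: "word_balanced drop_letter"
proof (rule word_balancedI[of "\<lambda>n. n + 1"])
  show "poly_bounded (\<lambda>n. n + 1)" by (intro poly_bounded_add poly_bounded_const poly_bounded_id)
  fix w v assume "drop_letter w = Some v"
  then show "length v \<le> length w + 1 \<and> length w \<le> length v + 1"
    by (cases w) (auto simp: drop_letter_def)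
qed (simp add: monoI)

lemma iter_drop: "iter_map drop_letter (length u) (u @ w) = Some w"
proof (induction u)
  case (Cons s u)
  have "drop_letter ((s # u) @ w) = Some (u @ w)" by (simp add: drop_letter_def)
  from iter_map_first[where F = drop_letter and k = "length u", OF this] Cons show ?case by (simp only: length_Cons)
qed simp

lemma iter_widen:
  assumes "\<And>j f. (j, f) \<in> set jl \<Longrightarrow> j < 5"
  shows "iter_map widen k (concat (map (\<lambda>(j, f). one_hot 5 j f) jl)) = Some (concat (map (\<lambda>(j, f). one_hot (5 + k) j f) jl))"
proof (induction k)
  case (Suc k)
  have "concat (map widen_hom (concat (map (\<lambda>(j, f). one_hot (5 + k) j f) jl))) = concat (map (\<lambda>(j, f). one_hot (Suc (5 + k)) j f) jl)"
    by (rule widen_cells) (use assms in fastforce)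
  then show ?case using Suc by (simp add: map_comp_def widen_def)
qed simp

text \<open>
  The amount of padding on each side after \<open>j\<close> expansions, for an input of length \<open>m\<close>.
\<close>

fun pads :: "nat \<Rightarrow> nat \<Rightarrow> nat" where
  "pads 0 m = 1"
| "pads (Suc j) m = pads j m * (2 * pads j m + 1 + m + 2)"

lemma iter_expand: "iter_map expand j (padded_input 1 x) = Some (padded_input (pads j (length x)) x)"
  by (induction j) (simp_all add: map_comp_def expand_padded)

lemma pads_ge: "(m + 3) ^ j \<le> pads j m"
proof (induction j)
  case (Suc j)
  have "(m + 3) ^ j * (m + 3) \<le> pads j m * (2 * pads j m + 1 + m + 2)"
    by (rule mult_le_mono[OF Suc]) simp
  then show ?case by (simp add: mult.commute)
qed simp

lemma pads_poly: "poly_bounded (pads j)"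
proof (induction j)
  case 0
  show ?case using poly_bounded_const[of 1] by (simp add: fun_eq_iff)
next
  case (Suc j)
  have "pads (Suc j) = (\<lambda>m. pads j m * (2 * pads j m + 1 + m + 2))" by auto
  moreover have "poly_bounded (\<lambda>m. pads j m * (2 * pads j m + 1 + m + 2))"
    by (intro poly_bounded_add poly_bounded_mult poly_bounded_const poly_bounded_id Suc)
  ultimately show ?case by simp
qed

definition prepend_all :: "sym list \<Rightarrow> (bool list \<rightharpoonup> bool list)" where
  "prepend_all u = foldr (\<lambda>s g. binary (prepend s) \<circ>\<^sub>m g) u Some"

lemma prepend_all_spell: "prepend_all u (spell w) = Some (spell (u @ w))"
proof (induction u)
  case (Cons s u)
  have "prepend_all (s # u) (spell w) = binary (prepend s) (spell (u @ w))"
    using Cons by (simp add: prepend_all_def map_comp_def)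
  then show ?case by (simp add: prepend_eq)
qed (simp add: prepend_all_def)

lemma length_array_word: "length (array_word ks N S \<alpha> \<phi>) = N * (length ks + 1)"
proof -
  have "length (concat (map (\<lambda>i. cell_word (map (\<lambda>k. S k i) ks) (\<alpha> i) (\<phi> i)) is)) = length is * (length ks + 1)" for "is"
    by (induction "is") (simp_all add: cell_word_def)
  then show ?thesis by (simp add: array_word_def)
qed

text \<open>
  The number of fillers is divided by \<open>length (core w) + 1\<close> each time, until it is less than one.
\<close>

lemma iter_contract:
  assumes C: "contracting C"
    and w: "all_fresh w" "core w \<noteq> []" "fillers w < (length (core w) + 1) ^ k"
  shows "iter_map C k w = Some (fresh_word (core w))"
proof -
  have "\<exists>v. iter_map C k w = Some v \<and> core v = core w \<and> all_fresh v \<and>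
      (length (core w) + 1) ^ k * fillers v \<le> fillers w" for k
  proof (induction k)
    case 0
    then show ?case using w by simp
  next
    case (Suc k)
    then obtain v where v: "iter_map C k w = Some v" "core v = core w" "all_fresh v"
      "(length (core w) + 1) ^ k * fillers v \<le> fillers w" by blast
    obtain u where u: "C v = Some u" "core u = core v" "all_fresh u"
      "(length (core v) + 1) * fillers u \<le> fillers v" using C v(2,3) w(2) unfolding contracting_def by metis
    have "(length (core w) + 1) ^ Suc k * fillers u = (length (core w) + 1) ^ k * ((length (core v) + 1) * fillers u)"
      using v(2) by (simp add: algebra_simps)
    also have "\<dots> \<le> (length (core w) + 1) ^ k * fillers v" by (rule mult_le_mono2[OF u(4)])
    finally have "(length (core w) + 1) ^ Suc k * fillers u \<le> fillers w" using v(4) by linarith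
    then show ?case using u v by (intro exI[of _ u]) (simp add: map_comp_def)
  qed
  then obtain v where v: "iter_map C k w = Some v" "core v = core w" "all_fresh v"
      "(length (core w) + 1) ^ k * fillers v \<le> fillers w" by blast
  have "fillers v = 0"
  proof (rule ccontr)
    assume "fillers v \<noteq> 0"
    then have "(length (core w) + 1) ^ k * 1 \<le> (length (core w) + 1) ^ k * fillers v"
      by (intro mult_le_mono2) simp
    then show False using v(4) w(3) by linarith
  qed
  then have "v = fresh_word (core v)" using v(3)
    by (induction v) (auto simp: core_def fillers_def fresh_word_def split: if_splits)
  then show ?thesis using v(1,2) by simp
qed

definition pipeline where
  "pipeline U C j b u l k = output_map \<circ>\<^sub>m (iter_map (binary C) k \<circ>\<^sub>m (binary reader \<circ>\<^sub>m
    (iter_map (binary drop_letter) l \<circ>\<^sub>m (binary U \<circ>\<^sub>m (prepend_all u \<circ>\<^sub>m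
    (iter_map (binary widen) b \<circ>\<^sub>m (binary layout \<circ>\<^sub>m
    (iter_map (binary expand) j \<circ>\<^sub>m input_map))))))))"

text \<open>
  The number \<open>j\<close> of expansions comes from the time bound of a machine for \<open>f\<close>, the number \<open>b\<close> of
  additional registers and the program \<open>u\<close> from its transition table, and the number \<open>k\<close> of contractions
  from the balance of \<open>f\<close>, which bounds the final amount of padding by a polynomial in the length of
  the output.
\<close>

lemma factorization:
  assumes U: "universal U" and C: "contracting C" and f: "f \<in> fP"
  shows "\<exists>j b u l k. f = pipeline U C j b u l k"
proof -
  obtain M g where M: "turing_machine M" and g: "poly_bounded g"
    and del: "\<And>x. delivers M (map bit_code x) (g (length x)) (map_option (map bit_code) (f x))"
    and bal: "polynomially_balanced f" using fP_E[OF f] by blast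
  obtain cs where cs: "distinct cs" "set cs = cell_states M" "\<And>j. j < 5 \<Longrightarrow> cs ! j = special_states M ! j" "length cs \<ge> 5"
    using ex_state_list[OF M] by blast
  define n where "n = length cs"
  have "\<exists>k<n. cs ! k = local_rule M (cs ! a) (cs ! b) (cs ! c)" if "a < n" "b < n" "c < n" for a b c
    using local_rule_closed[OF M, of "cs ! a" "cs ! b" "cs ! c"] that unfolding n_def cs(2)[symmetric]
    by (metis in_set_conv_nth nth_mem)
  then obtain F where F: "\<And>a b c. a < n \<Longrightarrow> b < n \<Longrightarrow> c < n \<Longrightarrow>
      F a b c < n \<and> cs ! (F a b c) = local_rule M (cs ! a) (cs ! b) (cs ! c)"
    by metis
  have n5: "n \<ge> 5" using cs(4) by (simp add: n_def)
  then have n0: "n > 0" by linarith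
  note n = n5 n0
  have Fn: "\<And>a b c. a < n \<Longrightarrow> b < n \<Longrightarrow> c < n \<Longrightarrow> F a b c < n" using F by blast
  define prog where "prog = automaton_program n F"
  have tick: "Tick \<notin> set prog" unfolding prog_def by (rule automaton_program_no_tick[OF Fn])
  obtain k0 where k0: "\<And>m. g m \<le> (m + 2) ^ k0" using g unfolding poly_bounded_def by blast
  \<comment> \<open>One extra expansion provides for the two additional steps of the extended machine.\<close>
  define j where "j = k0 + 1"
  have enough: "2 * pads j m \<ge> g m + 2" "pads j m \<ge> 1" for m
  proof -
    have "(m + 2) ^ k0 \<le> (m + 3) ^ k0" by (rule power_mono) auto
    moreover have "1 \<le> (m + 3) ^ k0" by simp
    ultimately have "g m + 2 \<le> 3 * (m + 3) ^ k0" using k0[of m] by linarith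
    also have "3 * (m + 3) ^ k0 \<le> (m + 3) * (m + 3) ^ k0" by (rule mult_le_mono1) simp
    finally have "g m + 2 \<le> (m + 3) ^ j" unfolding j_def by simp
    then show "2 * pads j m \<ge> g m + 2" "pads j m \<ge> 1" using pads_ge[of m j] by simp_all
  qed
  obtain e where e: "poly_bounded e" "\<And>x y. f x = Some y \<Longrightarrow> length y \<le> e (length x) \<and> length x \<le> e (length y)"
    using polynomially_balancedE[OF bal] by blast
  \<comment> \<open>The length of the array: \<open>20 * a + 1 + m\<close> cells with \<open>2 * n\<close> registers and a separator.\<close>
  have "poly_bounded (\<lambda>m. (20 * pads j m + 1 + m) * (2 * n + 1))"
    by (intro poly_bounded_add poly_bounded_mult poly_bounded_const poly_bounded_id pads_poly)
  from poly_bounded_comp[OF this e(1)] obtain H where H: "poly_bounded H"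
    "\<And>i m. m \<le> e i \<Longrightarrow> (20 * pads j m + 1 + m) * (2 * n + 1) \<le> H i" by blast
  obtain k1 where k1: "\<And>m. H m \<le> (m + 2) ^ k1" using H(1) unfolding poly_bounded_def by blast
  define k where "k = k1 + 1"
  let ?pre = "program_word (Tick # prog)"
  let ?l = "length (program_word (prog @ [Tick]))"
  have main: "pipeline U C j (2 * n - 5) ?pre ?l k x = f x" for x
  proof -
    define a where "a = pads j (length x)"
    define d where "d = concat (map (\<lambda>(j, f). one_hot (2 * n) j f) (input_cells a x))"
    define N where "N = length (input_cells a x)"
    let ?S = "start_planes cs (ext_start M x) (int (10 * a + 1))"
    have d_array: "d = array_word [0..<2 * n] N ?S (\<lambda>_. True) (\<lambda>i. snd (input_cells a x ! i))"
      unfolding d_def N_def n_def by (rule input_cells_array[OF cs(3,4,1)])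
    have fuel: "fuel d = 2 * a" unfolding d_def by (rule fuel_input_cells) (use n in simp)
    have empty: "\<not> ?S k i" if "n \<le> k" "k < 2 * n" for k i using that by (simp add: start_planes_def n_def)
    obtain \<phi> where \<phi>: "sim_result prog d = program_word (prog @ [Tick]) @
        array_word [0..<2 * n] N ((next_planes n F ^^ (2 * a)) ?S) (\<lambda>_. True) \<phi>"
      using simulate_automaton[where n = n and F = F and S = ?S, OF n(2) Fn empty d_array]
      unfolding fuel prog_def by blast
    define W where "W = array_word [0..<2 * n] N ((next_planes n F ^^ (2 * a)) ?S) (\<lambda>_. True) \<phi>"
    have s1: "input_map x = Some (spell (padded_input 1 x))"
      by (simp add: input_map_def padded_input_def fresh_word_def comp_def)
    have s2: "iter_map (binary expand) j (spell (padded_input 1 x)) = Some (spell (padded_input a x))"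
      by (simp add: iter_map_binary iter_expand a_def del: One_nat_def)
    have s3: "binary layout (spell (padded_input a x)) = Some (spell (concat (map (\<lambda>(j, f). one_hot 5 j f) (input_cells a x))))"
      by (simp add: layout_def layout_padded)
    have n25: "5 + (2 * n - 5) = 2 * n" using n by simp
    have s4: "iter_map (binary widen) (2 * n - 5) (spell (concat (map (\<lambda>(j, f). one_hot 5 j f) (input_cells a x)))) = Some (spell d)"
      using iter_widen[where jl = "input_cells a x" and k = "2 * n - 5", OF input_cells_bound] unfolding iter_map_binary n25 d_def by simp
    have s5: "prepend_all ?pre (spell d) = Some (spell (?pre @ d))" by (rule prepend_all_spell)
    have "is_data d" unfolding d_array by simp
    then have s6: "binary U (spell (?pre @ d)) = Some (spell (program_word (prog @ [Tick]) @ W))"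
      using U[unfolded universal_def, rule_format, OF tick] \<phi> unfolding binary_spell W_def by simp
    have s7: "iter_map (binary drop_letter) ?l (spell (program_word (prog @ [Tick]) @ W)) = Some (spell W)"
      unfolding iter_map_binary iter_drop by simp
    have steps: "pipeline U C j (2 * n - 5) ?pre ?l k x
      = (output_map \<circ>\<^sub>m (iter_map (binary C) k \<circ>\<^sub>m binary reader)) (spell W)"
      by (simp only: pipeline_def map_comp_def s1 s2 s3 s4 s5 s6 s7 option.case)
    have read: "case f x of None \<Rightarrow> reader W = None
      | Some y \<Rightarrow> \<exists>v. reader W = Some v \<and> core v = Answer # map Bit y"
      unfolding W_def N_def n_def
      by (rule read_result[OF M cs F[unfolded n_def] del]) (use enough in \<open>simp_all add: a_def\<close>)
    show ?thesis
    proof (cases "f x")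
      case None
      then have "reader W = None" using read by simp
      then show ?thesis unfolding steps by (simp add: map_comp_def None)
    next
      case (Some y)
      then obtain v where v: "reader W = Some v" "core v = Answer # map Bit y" using read by auto
      have "fillers v \<le> length v" by (simp add: fillers_def)
      also have "length v = length W" using reader_length[OF v(1)] by simp
      also have "\<dots> = (20 * a + 1 + length x) * (2 * n + 1)"
        by (simp add: W_def length_array_word N_def length_input_cells)
      also have "\<dots> \<le> H (length y)" unfolding a_def by (rule H(2)) (use e(2)[OF Some] in simp)
      also have "\<dots> \<le> (length y + 2) ^ k1" by (rule k1)
      also have "\<dots> < (length y + 2) ^ k" unfolding k_def by (rule power_strict_increasing) simp_all
      also have "length y + 2 = length (core v) + 1" using v(2) by simp
      finally have "iter_map C k v = Some (fresh_word (core v))"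
        by (intro iter_contract C) (use reader_length[OF v(1)] v(2) in simp_all)
      then have "iter_map (binary C) k (spell v) = Some (spell ((Answer, False) # bits y))"
        by (simp add: iter_map_binary v(2) fresh_word_def comp_def)
      moreover have "output_map (spell ((Answer, False) # bits y)) = Some y" by (simp only: output_map_eq)
      ultimately show ?thesis unfolding steps using v(1) Some by (simp add: map_comp_def del: spell_simps)
    qed
  qed
  have "pipeline U C j (2 * n - 5) ?pre ?l k = f"
    by (rule ext) (rule main)
  then show ?thesis by metis
qed

theorem proposition4p5: "finitely_generated_monoid fP_monoid"
proof -
  obtain U where U: "polytime U" "word_balanced U" "universal U" by (rule ex_simulator)
  obtain C where C: "polytime C" "word_balanced C" "contracting C" by (rule ex_contract)
  define Gs where "Gs = {input_map, output_map} \<union> binary ` {expand, layout, widen, U, drop_letter, reader, C}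
    \<union> range (\<lambda>s. binary (prepend s))"
  have fin: "finite Gs" by (simp add: Gs_def)
  have hom: "binary (\<lambda>w. Some (u @ concat (map h w) @ v)) \<in> fP" if "\<And>s. h s \<noteq> []" for u h v
    using that by (intro binary_fP polytime_hom hom_balanced)
  have lay: "layout_hom s \<noteq> []" for s
    by (auto simp: layout_hom_def one_hot_def cell_word_def layout_cells_def pad_cells_def split: letter.splits)
  have wid: "widen_hom s \<noteq> []" for s by (auto simp: widen_hom_def split: letter.splits)
  have "binary layout \<in> fP" "binary widen \<in> fP" "binary (prepend s) \<in> fP" for s
    using hom[of layout_hom "[]" "[]"] hom[of widen_hom "[]" "[]"] hom[of "\<lambda>s. [s]" "[s]" "[]"] lay wid
    unfolding layout_def[abs_def] widen_def[abs_def] prepend_def[abs_def] by simp_all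
  moreover have "binary drop_letter \<in> fP"
    using drop_letter_balanced polytime_drop_first unfolding drop_letter_def by (intro binary_fP)
  ultimately have sub: "Gs \<subseteq> fP"
    using input_map_fP output_map_fP binary_fP[OF polytime_expand expand_balanced]
      binary_fP[OF U(1,2)] binary_fP[OF C(1,2)] binary_fP[OF polytime_reader reader_balanced]
    unfolding Gs_def by auto
  have gen: "f \<in> H" if H: "submonoid H fP_monoid" "Gs \<subseteq> H" and f: "f \<in> fP" for H f
  proof -
    have comp: "p \<circ>\<^sub>m q \<in> H" if "p \<in> H" "q \<in> H" for p q
      using submonoid.m_closed[OF H(1) that] by (simp add: fP_monoid_def)
    have one: "Some \<in> H" using submonoid.one_closed[OF H(1)] by (simp add: fP_monoid_def)
    have iter: "iter_map p k \<in> H" if "p \<in> H" for p k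
      using that by (induction k) (simp_all add: one comp)
    have pre: "prepend_all u \<in> H" for u
    proof (induction u)
      case (Cons s u)
      have "binary (prepend s) \<in> H" using H(2) by (auto simp: Gs_def)
      then show ?case using Cons comp by (simp add: prepend_all_def)
    qed (simp add: prepend_all_def one)
    have base: "input_map \<in> H" "output_map \<in> H" "binary expand \<in> H" "binary layout \<in> H" "binary widen \<in> H"
      "binary U \<in> H" "binary drop_letter \<in> H" "binary reader \<in> H" "binary C \<in> H"
      using H(2) by (auto simp: Gs_def)
    obtain j b u l k where f: "f = pipeline U C j b u l k"
      using factorization[OF U(3) C(3) f] by blast
    show ?thesis unfolding f pipeline_def by (intro comp iter pre base)
  qed
  have carrier: "carrier fP_monoid = fP" by (simp add: fP_monoid_def)
  have "submonoid fP fP_monoid"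
    by unfold_locales (auto simp: fP_monoid_def fP_one fP_comp)
  then have "\<Inter>{H. submonoid H fP_monoid \<and> Gs \<subseteq> H} = carrier fP_monoid"
    unfolding carrier using sub gen by blast
  moreover have "Gs \<subseteq> carrier fP_monoid" unfolding carrier by (rule sub)
  ultimately show ?thesis
    unfolding finitely_generated_monoid_def using fin by (intro conjI exI[of _ Gs] fP_monoid)
qed

end
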